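(* Let $M^4$ be an ultra-minimal Lagrangian submanifold of $\mathbb{C}^4$. Then $$\rho\leq-\rho^{\perp}$$ at every point of $M^4$, and equality holds at a point $p$ if and only if there exist an orthonormal basis $\{e_1,e_2,e_3,e_4\}$ of $T_pM$ and real numbers $a,b$ such that, with respect to this basis, $$A_{Je_1}=\begin{pmatrix} a & b & 0 & 0 \\ b & -a & 0 & 0 \\ 0 & 0 & 0 & 0 \\ 0 & 0 & 0 & 0 \end{pmatrix},\quad A_{Je_2}=\begin{pmatrix} b & -a & 0 & 0 \\ -a & -b & 0 & 0 \\ 0 & 0 & 0 & 0 \\ 0 & 0 & 0 & 0 \end{pmatrix},\quad A_{Je_3}=0,\quad A_{Je_4}=0.$$
   Context: $\mathbb{C}^4\cong\mathbb{E}^8$ carries its standard flat K\"ahler structure with complex structure $J$. A submanifold $M^4$ is Lagrangian if at every point $p$ the map $J$ induces an isomorphism between $T_pM$ and the normal space $T_p^{\perp}M$. For a normal vector $U$, the shape operator $A_U$ is defined by $\langle A_UX,Y\rangle=\langle h(X,Y),U\rangle$, with $h$ the second fundamental form. A submanifold $M^n$ of a Riemannian manifold $\widetilde{M}^{n+m}$ is called ultra-minimal if around each point $p\in M^n$ there exist a local orthonormal tangent frame and a local orthonormal normal frame $\{U_1,\ldots,U_m\}$ such that, with respect to the tangent frame, all shape operators take the block-diagonal form $$A_{U_\alpha}=\mathrm{diag}(A_1^{\alpha},\ldots,A_k^{\alpha},0,\ldots,0),\qquad \alpha=1,\ldots,m,$$ where $A_j^{\alpha}$ is a symmetric $(n_j\times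 n_j)$-matrix with $\mathrm{tr}(A_j^{\alpha})=0$ (the block sizes $n_1,\ldots,n_k$ not depending on $\alpha$), and $n_1\neq n$. Let $R$ be the Riemann curvature tensor of $M^4$ (with the sign convention that $\langle R(X,Y)Y,X\rangle$ is the sectional curvature for orthonormal $X,Y$) and $R^{\perp}$ the curvature tensor of the normal connection. With $\{e_1,\ldots,e_4\}$ an orthonormal basis of $T_pM$ and $\{u_1,\ldots,u_4\}$ an orthonormal basis of $T_p^{\perp}M$, define at $p$ $$\rho=\frac16\sum_{1\le i<j\le 4}\langle R(e_i,e_j)e_j,e_i\rangle,\qquad \rho^{\perp}=\frac16\sqrt{\sum_{1\le i<j\le 4}\ \sum_{1\le\alpha<\beta\le 4}\langle R^{\perp}(e_i,e_j)u_{\alpha},u_{\beta}\rangle^2}.$$ *)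

theory Defs
  imports "HOL-Analysis.Analysis"
begin

section \<open>Smooth maps and immersed submanifolds of Euclidean space\<close>

abbreviation dd :: "'a::real_normed_vector \<Rightarrow> ('a \<Rightarrow> 'b::real_normed_vector) \<Rightarrow> 'a \<Rightarrow> 'b"
  where "dd v f x \<equiv> frechet_derivative f (at x) v"

primrec C_k_on :: "nat \<Rightarrow> 'a::euclidean_space set \<Rightarrow> ('a \<Rightarrow> 'b::real_normed_vector) \<Rightarrow> bool"
  where
    "C_k_on 0 W f \<longleftrightarrow> continuous_on W f"
  | "C_k_on (Suc k) W f \<longleftrightarrow>
       (\<forall>x\<in>W. f differentiable (at x)) \<and> (\<forall>b\<in>Basis. C_k_on k W (dd b f))"

text \<open>Only used for open \<open>W\<close>.\<close>

definition smooth_on :: "'a::euclidean_space set \<Rightarrow> ('a \<Rightarrow> 'b::real_normed_vector) \<Rightarrow> bool"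
  where "smooth_on W f \<longleftrightarrow> (\<forall>k. C_k_on k W f)"

text \<open>
  A submanifold is a topological space \<open>M\<close> with a map \<open>\<phi>\<close> into Euclidean space (not necessarily
  injective; an embedded submanifold \<open>S\<close> is the case \<open>M = top_of_set S\<close>, \<open>\<phi> = id\<close>). Its charts are
  the homeomorphisms \<open>\<sigma>\<close> from open sets \<open>W\<close> of \<open>\<real>\<^sup>n\<close> onto open sets of \<open>M\<close> for which \<open>\<phi> \<circ> \<sigma>\<close> is a
  smooth immersion. No compatibility condition is needed: an immersion is locally an embedding with
  a smooth left inverse, so the transition maps between such charts are automatically smooth, and
  these charts form the unique smooth structure on \<open>M\<close> that makes \<open>\<phi>\<close> a smooth immersion.
\<close>

definition local_param ::
    "'m topology \<Rightarrow> ('m \<Rightarrow> 'v::euclidean_space) \<Rightarrow> (real^'n::finite) set \<Rightarrow> (real^'n \<Rightarrow> 'm) \<Rightarrow> bool"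
  where "local_param M \<phi> W \<sigma> \<longleftrightarrow>
    open W \<and> embedding_map (top_of_set W) M \<sigma> \<and> openin M (\<sigma> ` W) \<and>
    smooth_on W (\<phi> \<circ> \<sigma>) \<and> (\<forall>x\<in>W. inj (frechet_derivative (\<phi> \<circ> \<sigma>) (at x)))"

definition immersed_submanifold ::
    "'n::finite itself \<Rightarrow> 'm topology \<Rightarrow> ('m \<Rightarrow> 'v::euclidean_space) \<Rightarrow> bool"
  where "immersed_submanifold _ M \<phi> \<longleftrightarrow>
    Hausdorff_space M \<and> second_countable M \<and>
    (\<forall>p\<in>topspace M. \<exists>(W :: (real^'n) set) \<sigma>. local_param M \<phi> W \<sigma> \<and> p \<in> \<sigma> ` W)"

section \<open>Local geometry of a parametrization\<close>

text \<open>
  In this section \<open>f\<close> stands for a parametrization \<open>\<phi> \<circ> \<sigma>\<close>. Tangent vectors at \<open>\<sigma> x\<close> are identified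
  with their images in the ambient space.
\<close>

definition tangent_fibre :: "(real^'n::finite \<Rightarrow> 'v::euclidean_space) \<Rightarrow> real^'n \<Rightarrow> 'v set"
  where "tangent_fibre f x = range (frechet_derivative f (at x))"

definition normal_fibre :: "(real^'n::finite \<Rightarrow> 'v::euclidean_space) \<Rightarrow> real^'n \<Rightarrow> 'v set"
  where "normal_fibre f x = orthogonal_comp (tangent_fibre f x)"

definition normal_part :: "(real^'n::finite \<Rightarrow> 'v::euclidean_space) \<Rightarrow> real^'n \<Rightarrow> 'v \<Rightarrow> 'v"
  where "normal_part f x y = (THE z. z \<in> normal_fibre f x \<and> y - z \<in> tangent_fibre f x)"

definition coords :: "(real^'n::finite \<Rightarrow> 'v::euclidean_space) \<Rightarrow> real^'n \<Rightarrow> 'v \<Rightarrow> real^'n"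
  where "coords f x = inv (frechet_derivative f (at x))"

definition orthonormal_basis :: "nat \<Rightarrow> (nat \<Rightarrow> 'v::euclidean_space) \<Rightarrow> 'v set \<Rightarrow> bool"
  where "orthonormal_basis n e S \<longleftrightarrow>
    (\<forall>i\<in>{1..n}. \<forall>j\<in>{1..n}. e i \<bullet> e j = (if i = j then 1 else 0)) \<and> span (e ` {1..n}) = S"

subsection \<open>Intrinsic curvature: Levi-Civita connection of the induced metric\<close>

definition metric :: "(real^'n::finite \<Rightarrow> 'v::euclidean_space) \<Rightarrow> real^'n \<Rightarrow> real^'n^'n"
  where "metric f x = (\<chi> i j. dd (axis i 1) f x \<bullet> dd (axis j 1) f x)"

definition christoffel ::
    "(real^'n::finite \<Rightarrow> 'v::euclidean_space) \<Rightarrow> 'n \<Rightarrow> 'n \<Rightarrow> 'n \<Rightarrow> real^'n \<Rightarrow> real"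
  where "christoffel f k i j x = (1/2) * (\<Sum>l\<in>UNIV. matrix_inv (metric f x) $ k $ l *
      (dd (axis i 1) (\<lambda>y. metric f y $ j $ l) x
       + dd (axis j 1) (\<lambda>y. metric f y $ i $ l) x
       - dd (axis l 1) (\<lambda>y. metric f y $ i $ j) x))"

text \<open>Covariant derivative in direction \<open>v\<close> of the vector field with components \<open>V\<close>.\<close>

definition cov_deriv ::
    "(real^'n::finite \<Rightarrow> 'v::euclidean_space) \<Rightarrow> real^'n \<Rightarrow> (real^'n \<Rightarrow> real^'n) \<Rightarrow> real^'n \<Rightarrow> real^'n"
  where "cov_deriv f v V x =
    dd v V x + (\<chi> k. \<Sum>i\<in>UNIV. \<Sum>j\<in>UNIV. christoffel f k i j x * v $ i * V x $ j)"

text \<open>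
  \<open>R(X,Y)Z = \<nabla>\<^sub>X\<nabla>\<^sub>Y Z - \<nabla>\<^sub>Y\<nabla>\<^sub>X Z - \<nabla>\<^bsub>[X,Y]\<^esub> Z\<close>, evaluated on the extensions of \<open>X, Y, Z\<close> with constant
  components, whose brackets vanish.
\<close>

definition riemann ::
    "(real^'n::finite \<Rightarrow> 'v::euclidean_space) \<Rightarrow> real^'n \<Rightarrow> 'v \<Rightarrow> 'v \<Rightarrow> 'v \<Rightarrow> 'v"
  where "riemann f x X Y Z =
    (let v = coords f x X; w = coords f x Y; z = coords f x Z
     in dd (cov_deriv f v (cov_deriv f w (\<lambda>_. z)) x - cov_deriv f w (cov_deriv f v (\<lambda>_. z)) x) f x)"

subsection \<open>Extrinsic geometry\<close>

text \<open>
  \<open>h(X,Y)\<close> is the normal part of the flat derivative \<open>D\<^sub>X Y\<close>, with \<open>Y\<close> extended by constant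
  components to a tangent vector field.
\<close>

definition second_ff :: "(real^'n::finite \<Rightarrow> 'v::euclidean_space) \<Rightarrow> real^'n \<Rightarrow> 'v \<Rightarrow> 'v \<Rightarrow> 'v"
  where "second_ff f x X Y = normal_part f x (dd (coords f x X) (dd (coords f x Y) f) x)"

definition shape_op :: "(real^'n::finite \<Rightarrow> 'v::euclidean_space) \<Rightarrow> real^'n \<Rightarrow> 'v \<Rightarrow> 'v \<Rightarrow> 'v"
  where "shape_op f x U X =
    (THE Z. Z \<in> tangent_fibre f x \<and> (\<forall>Y\<in>tangent_fibre f x. Z \<bullet> Y = second_ff f x X Y \<bullet> U))"

definition shape_matrix ::
    "(real^'n::finite \<Rightarrow> 'v::euclidean_space) \<Rightarrow> real^'n \<Rightarrow> (nat \<Rightarrow> 'v) \<Rightarrow> 'v \<Rightarrow> nat \<Rightarrow> nat \<Rightarrow> real"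
  where "shape_matrix f x e U i j = shape_op f x U (e j) \<bullet> e i"

definition normal_deriv ::
    "(real^'n::finite \<Rightarrow> 'v::euclidean_space) \<Rightarrow> real^'n \<Rightarrow> (real^'n \<Rightarrow> 'v) \<Rightarrow> real^'n \<Rightarrow> 'v"
  where "normal_deriv f v \<xi> x = normal_part f x (dd v \<xi> x)"

text \<open>
  As for \<open>riemann\<close>, with the normal vector \<open>U\<close> extended to the normal field
  \<open>y \<mapsto> normal_part f y U\<close>.
\<close>

definition normal_curv ::
    "(real^'n::finite \<Rightarrow> 'v::euclidean_space) \<Rightarrow> real^'n \<Rightarrow> 'v \<Rightarrow> 'v \<Rightarrow> 'v \<Rightarrow> 'v"
  where "normal_curv f x X Y U =
    (let v = coords f x X; w = coords f x Y; \<xi> = (\<lambda>y. normal_part f y U)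
     in normal_deriv f v (normal_deriv f w \<xi>) x - normal_deriv f w (normal_deriv f v \<xi>) x)"

subsection \<open>Normalized scalar and normal scalar curvature in dimension and codimension 4\<close>

definition norm_scal :: "(real^4 \<Rightarrow> 'v::euclidean_space) \<Rightarrow> real^4 \<Rightarrow> (nat \<Rightarrow> 'v) \<Rightarrow> real"
  where "norm_scal f x e =
    (1/6) * (\<Sum>i\<in>{1..4}. \<Sum>j\<in>{i<..4}. riemann f x (e i) (e j) (e j) \<bullet> e i)"

definition norm_normal_scal ::
    "(real^4 \<Rightarrow> 'v::euclidean_space) \<Rightarrow> real^4 \<Rightarrow> (nat \<Rightarrow> 'v) \<Rightarrow> (nat \<Rightarrow> 'v) \<Rightarrow> real"
  where "norm_normal_scal f x e u =
    (1/6) * sqrt (\<Sum>i\<in>{1..4}. \<Sum>j\<in>{i<..4}. \<Sum>\<alpha>\<in>{1..4}. \<Sum>\<beta>\<in>{\<alpha><..4}.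
      (normal_curv f x (e i) (e j) (u \<alpha>) \<bullet> u \<beta>)\<^sup>2)"

section \<open>Ultra-minimal and Lagrangian submanifolds\<close>

text \<open>
  Matrices are indexed from 1. With \<open>ns = [n\<^sub>1, \<dots>, n\<^sub>k]\<close>, \<open>block_range ns b\<close> is the set of indices of
  the block of size \<open>ns ! b\<close>.
\<close>

definition block_range :: "nat list \<Rightarrow> nat \<Rightarrow> nat set"
  where "block_range ns b = {sum_list (take b ns)<..sum_list (take (Suc b) ns)}"

definition traceless_block_diag :: "nat \<Rightarrow> nat list \<Rightarrow> (nat \<Rightarrow> nat \<Rightarrow> real) \<Rightarrow> bool"
  where "traceless_block_diag n ns A \<longleftrightarrow>
    (\<forall>i\<in>{1..n}. \<forall>j\<in>{1..n}.
       \<not> (\<exists>b<length ns. i \<in> block_range ns b \<and> j \<in> block_range ns b) \<longrightarrow> A i j = 0) \<and>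
    (\<forall>b<length ns.
       (\<forall>i\<in>block_range ns b. \<forall>j\<in>block_range ns b. A i j = A j i) \<and>
       (\<Sum>i\<in>block_range ns b. A i i) = 0)"

text \<open>
  The ambient Riemannian manifold is a Euclidean space here. The neighbourhood of \<open>p\<close> carrying the
  two (smooth) frames is taken to be the image of a chart; the frames are functions of the chart
  coordinates.
\<close>

definition ultra_minimal ::
    "'n::finite itself \<Rightarrow> 'm topology \<Rightarrow> ('m \<Rightarrow> 'v::euclidean_space) \<Rightarrow> bool"
  where "ultra_minimal _ M \<phi> \<longleftrightarrow>
    (\<forall>p\<in>topspace M. \<exists>(W :: (real^'n) set) \<sigma> E U ns.
       local_param M \<phi> W \<sigma> \<and> p \<in> \<sigma> ` W \<and>
       (\<forall>i\<in>{1..CARD('n)}. smooth_on W (E i)) \<and>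
       (\<forall>\<alpha>\<in>{1..DIM('v) - CARD('n)}. smooth_on W (U \<alpha>)) \<and>
       ns \<noteq> [] \<and> (\<forall>k\<in>set ns. 1 \<le> k) \<and> sum_list ns \<le> CARD('n) \<and> hd ns \<noteq> CARD('n) \<and>
       (\<forall>x\<in>W.
          orthonormal_basis CARD('n) (\<lambda>i. E i x) (tangent_fibre (\<phi> \<circ> \<sigma>) x) \<and>
          orthonormal_basis (DIM('v) - CARD('n)) (\<lambda>\<alpha>. U \<alpha> x) (normal_fibre (\<phi> \<circ> \<sigma>) x) \<and>
          (\<forall>\<alpha>\<in>{1..DIM('v) - CARD('n)}. traceless_block_diag CARD('n) ns
             (shape_matrix (\<phi> \<circ> \<sigma>) x (\<lambda>i. E i x) (U \<alpha> x)))))"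

definition cplx_J :: "complex^'d::finite \<Rightarrow> complex^'d"
  where "cplx_J v = \<i> *s v"

definition lagrangian :: "'m topology \<Rightarrow> ('m \<Rightarrow> complex^'n::finite) \<Rightarrow> bool"
  where "lagrangian M \<phi> \<longleftrightarrow>
    (\<forall>(W :: (real^'n) set) \<sigma>. local_param M \<phi> W \<sigma> \<longrightarrow>
       (\<forall>x\<in>W. bij_betw cplx_J (tangent_fibre (\<phi> \<circ> \<sigma>) x) (normal_fibre (\<phi> \<circ> \<sigma>) x)))"

definition matrix_rows :: "real list list \<Rightarrow> nat \<Rightarrow> nat \<Rightarrow> real"
  where "matrix_rows rs i j = rs ! (i - 1) ! (j - 1)"

end

theory Submission
  imports Defs
begin

text \<open>
  For a Lagrangian immersion the cubic form \<open>C(X,Y,Z) = \<langle>h(X,Y), JZ\<rangle>\<close> is totally symmetric, and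
  ultra-minimality forces it, in a suitable orthonormal frame, to be either a trace-free cubic form
  on a 3-dimensional subspace or a sum of trace-free cubic forms on two orthogonal planes. By the
  equations of Gauss and Ricci, \<open>6 \<rho> = - |C|\<^sup>2 / 2\<close> and \<open>36 (\<rho>\<^sup>\<bottom>)\<^sup>2\<close> is a quartic polynomial in the
  coefficients of \<open>C\<close>. On two planes, \<open>36 (\<rho>\<^sup>2 - (\<rho>\<^sup>\<bottom>)\<^sup>2) = 8 (a\<^sup>2 + b\<^sup>2) (a'\<^sup>2 + b'\<^sup>2)\<close>. On a 3-space, take
  \<open>e\<^sub>1\<close> maximizing \<open>C(u,u,u)\<close> on the unit sphere and \<open>e\<^sub>2, e\<^sub>3\<close> diagonalizing \<open>C(e\<^sub>1,\<cdot>,\<cdot>)\<close> on the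
  complement; with \<open>m = C\<^sub>1\<^sub>2\<^sub>2\<close>, \<open>n = C\<^sub>1\<^sub>3\<^sub>3\<close>, \<open>p = C\<^sub>2\<^sub>2\<^sub>2\<close>, \<open>q = C\<^sub>3\<^sub>3\<^sub>3\<close> the same difference is
  \<open>6 (m n)\<^sup>2 + 6 (p\<^sup>2 + q\<^sup>2) (m + n)\<^sup>2\<close>. Both are nonnegative and vanish only for forms living on a
  single plane.
\<close>

section \<open>Iterated directional derivatives\<close>

text \<open>The inequality is pointwise algebra; most of the work lies in reaching it. The frames of
  ultra-minimality live in some chart around the point and the curvatures in a given one, so tangent
  spaces and shape operators have to be compared across charts. Curvature is defined by Christoffel
  symbols and by derivatives of normal extensions, so the Gauss and Ricci equations must be derived
  before any coefficient appears. The block structure is given in a normal frame unrelated to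
  \<open>J\<close>, but it consists of linear conditions with the same blocks for every normal
  vector, so it passes to the normal vectors \<open>J e_k\<close>. Total symmetry of
  \<open>C\<close> then couples the blocks: two indices from different blocks make a coefficient
  vanish, wherever they stand. Blocks of size one are zero by their trace, which leaves 3 and 2+2 as
  the essential patterns. A trace-free cubic form in three variables has seven coefficients; a
  rotation removes three of them, and only after that does the difference become a visible sum of
  squares. Since \<rho> is nonpositive, comparing squares loses nothing, and the estimate is carried
  as a sign together with a comparison of squares.\<close>

lemma dd_eqI: "(f has_derivative f') (at x) \<Longrightarrow> dd v f x = f' v"
  by (simp add: frechet_derivative_at[symmetric])

lemma has_derivative_dd: "f differentiable at x \<Longrightarrow> (f has_derivative (\<lambda>v. dd v f x)) (at x)"
  by (simp add: frechet_derivative_works)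

lemma linear_dd: "f differentiable at x \<Longrightarrow> linear (\<lambda>v. dd v f x)"
  by (rule linear_frechet_derivative)

text \<open>\<open>frechet_derivative\<close> is a choice among the derivatives at the point, so it
  is determined by the set of these derivatives. That set is the same for functions agreeing near
  \<open>x\<close>, even when it is empty.\<close>

lemma dd_cong:
  assumes "open W" "x \<in> W" "\<And>y. y \<in> W \<Longrightarrow> f y = g y"
  shows "dd v f x = dd v g x"
proof -
  have "(f has_derivative f') (at x) \<longleftrightarrow> (g has_derivative f') (at x)" for f'
    using assms has_derivative_transform_within_open[of f f' x UNIV W g]
      has_derivative_transform_within_open[of g f' x UNIV W f] by auto
  then show ?thesis unfolding frechet_derivative_def by simp
qed

lemma differentiable_cong:
  assumes "open W" "x \<in> W" "\<And>y. y \<in> W \<Longrightarrow> f y = g y" "f differentiable at x"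
  shows "g differentiable at x"
  using assms has_derivative_transform_within_open unfolding differentiable_def by blast

lemma C_k_on_cong:
  assumes "open W" "\<And>y. y \<in> W \<Longrightarrow> f y = g y" "C_k_on k W f"
  shows "C_k_on k W g"
  using assms(2,3)
proof (induction k arbitrary: f g)
  case 0
  then show ?case using continuous_on_cong by auto
next
  case (Suc k)
  have "C_k_on k W (dd b g)" if "b \<in> Basis" for b
    by (rule Suc.IH[of "dd b f"], rule dd_cong[OF assms(1)]) (use Suc.prems that in auto)
  moreover have "g differentiable at x" if "x \<in> W" for x
    by (rule differentiable_cong[OF assms(1) that Suc.prems(1)]) (use Suc.prems that in auto)
  ultimately show ?case by simp
qed

lemma C_k_on_add:
  assumes "open W" "C_k_on k W f" "C_k_on k W g"
  shows "C_k_on k W (\<lambda>x. f x + g x)"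
  using assms(2,3)
proof (induction k arbitrary: f g)
  case 0
  then show ?case by (auto intro: continuous_intros)
next
  case (Suc k)
  have "C_k_on k W (dd b (\<lambda>x. f x + g x))" if "b \<in> Basis" for b
  proof (rule C_k_on_cong[OF assms(1)])
    show "C_k_on k W (\<lambda>x. dd b f x + dd b g x)"
      using Suc that by auto
    show "dd b f y + dd b g y = dd b (\<lambda>x. f x + g x) y" if "y \<in> W" for y
      by (rule dd_eqI[symmetric]) (use Suc.prems that in \<open>auto intro!: has_derivative_add has_derivative_dd\<close>)
  qed
  then show ?case using Suc.prems by auto
qed

lemma C_k_on_scaleR:
  assumes "open W" "C_k_on k W f"
  shows "C_k_on k W (\<lambda>x. c *\<^sub>R f x)"
  using assms(2)
proof (induction k arbitrary: f)
  case 0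
  then show ?case by (auto intro: continuous_intros)
next
  case (Suc k)
  have "C_k_on k W (dd b (\<lambda>x. c *\<^sub>R f x))" if "b \<in> Basis" for b
  proof (rule C_k_on_cong[OF assms(1)])
    show "C_k_on k W (\<lambda>x. c *\<^sub>R dd b f x)"
      using Suc that by auto
    show "c *\<^sub>R dd b f y = dd b (\<lambda>x. c *\<^sub>R f x) y" if "y \<in> W" for y
      by (rule dd_eqI[symmetric]) (use Suc.prems that in \<open>auto intro!: has_derivative_scaleR_right has_derivative_dd\<close>)
  qed
  then show ?case using Suc.prems by auto
qed

lemma smooth_on_differentiable: "smooth_on W f \<Longrightarrow> x \<in> W \<Longrightarrow> f differentiable at x"
  unfolding smooth_on_def by (metis C_k_on.simps(2))

lemma smooth_on_continuous: "smooth_on W f \<Longrightarrow> continuous_on W f"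
  unfolding smooth_on_def by (metis C_k_on.simps(1))

text \<open>\<open>C_k_on\<close> speaks of basis directions only. By linearity in the direction,
  \<open>dd v f\<close> is a combination of the \<open>dd b f\<close> with the constant coefficients
  \<open>v \<bullet> b\<close>, and \<open>C_k_on\<close> is closed under such combinations.\<close>

lemma smooth_on_dd:
  fixes f :: "'a::euclidean_space \<Rightarrow> 'b::real_normed_vector"
  assumes "open W" "smooth_on W f"
  shows "smooth_on W (dd v f)"
  unfolding smooth_on_def
proof
  fix k
  have *: "C_k_on k W (dd b f)" if "b \<in> Basis" for b
    using assms(2) that unfolding smooth_on_def by (metis C_k_on.simps(2))
  have zero: "C_k_on k W (\<lambda>x. 0::'b)"
    by (induction k) auto
  have sum: "C_k_on k W (\<lambda>x. \<Sum>b\<in>B. (v \<bullet> b) *\<^sub>R dd b f x)" if "finite B" "B \<subseteq> Basis" for B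
    using that
    by (induction) (auto simp: zero intro!: C_k_on_add[OF assms(1)] C_k_on_scaleR[OF assms(1)] *)
  show "C_k_on k W (dd v f)"
  proof (rule C_k_on_cong[OF assms(1) _ sum[of Basis]])
    fix y assume "y \<in> W"
    then interpret linear "\<lambda>v. dd v f y"
      using linear_dd smooth_on_differentiable[OF assms(2)] by blast
    have "dd v f y = dd (\<Sum>b\<in>Basis. (v \<bullet> b) *\<^sub>R b) f y"
      by (simp add: euclidean_representation)
    then show "(\<Sum>b\<in>Basis. (v \<bullet> b) *\<^sub>R dd b f y) = dd v f y"
      by (simp add: sum scaleR)
  qed auto
qed

text \<open>Pairing with \<open>c\<close> produces a real function of one variable, so the mean
  value theorem and Taylor's formula apply to vector-valued \<open>f\<close> one component at a
  time.\<close>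

lemma DERIV_line:
  fixes f :: "'a::euclidean_space \<Rightarrow> 'b::real_inner"
  assumes "f differentiable at (a + t *\<^sub>R v)"
  shows "((\<lambda>s. f (a + s *\<^sub>R v) \<bullet> c) has_real_derivative dd v f (a + t *\<^sub>R v) \<bullet> c) (at t)"
proof -
  have "((\<lambda>s. a + s *\<^sub>R v) has_derivative (\<lambda>s. s *\<^sub>R v)) (at t)"
    by (auto intro!: derivative_eq_intros)
  from has_derivative_compose[OF this has_derivative_dd[OF assms]]
  have "((\<lambda>s. f (a + s *\<^sub>R v) \<bullet> c) has_derivative (\<lambda>s. dd (s *\<^sub>R v) f (a + t *\<^sub>R v) \<bullet> c)) (at t)"
    by (rule has_derivative_inner_left)
  moreover have "(\<lambda>s. dd (s *\<^sub>R v) f (a + t *\<^sub>R v) \<bullet> c) = (*) (dd v f (a + t *\<^sub>R v) \<bullet> c)"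
    using linear_cmul[OF linear_dd[OF assms]] by (auto simp: fun_eq_iff)
  ultimately show ?thesis
    by (simp add: has_field_derivative_def)
qed

text \<open>Both mixed partials are limits of the second difference quotient of \<open>f\<close> along \<open>v\<close> and \<open>w\<close>.\<close>

lemma second_difference:
  fixes f :: "'a::euclidean_space \<Rightarrow> 'b::real_inner"
  assumes W: "open W" "smooth_on W f" "x \<in> W"
  shows "((\<lambda>t. (f (x + t *\<^sub>R v + t *\<^sub>R w) - f (x + t *\<^sub>R v) - f (x + t *\<^sub>R w) + f x) \<bullet> c / t\<^sup>2)
    \<longlongrightarrow> dd w (dd v f) x \<bullet> c) (at_right 0)"
proof -
  let ?g = "dd v f" and ?D = "\<lambda>h. dd h (dd v f) x"
  let ?q = "\<lambda>t. (f (x + t *\<^sub>R v + t *\<^sub>R w) - f (x + t *\<^sub>R v) - f (x + t *\<^sub>R w) + f x) \<bullet> c"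
  have gd: "?g differentiable at x"
    using W smooth_on_dd smooth_on_differentiable by blast
  interpret D: linear ?D by (rule linear_dd[OF gd])
  define K where "K = norm v + norm w + 1"
  have K: "K > 0" unfolding K_def by (simp add: add_nonneg_pos)
  obtain r where r: "r > 0" "ball x r \<subseteq> W"
    using W open_contains_ball by blast
  show ?thesis
  proof (rule tendstoI)
    fix e :: real assume e: "e > 0"
    \<comment> \<open>Chosen so that the final bound \<open>2 * e' * K * norm c\<close> equals
      \<open>e\<close> times a factor below 1/2; the summand 1 keeps the denominator positive when
      \<open>c\<close> is zero.\<close>
    define e' where "e' = e / (4 * K * (norm c + 1))"
    have e': "e' > 0" using e K unfolding e'_def by (simp add: add_nonneg_pos)
    obtain d where d: "d > 0" "\<And>y. norm (y - x) < d \<Longrightarrow> norm (?g y - ?g x - ?D (y - x)) \<le> e' * norm (y - x)"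
      using has_derivative_dd[OF gd] e' unfolding has_derivative_at_alt by blast
    have "dist (?q t / t\<^sup>2) (?D w \<bullet> c) < e" if t: "0 < t" "t < min (r / K) (d / K)" for t
    proof -
      have tK: "t * K < r" "t * K < d"
        using t K by (auto simp: field_simps)
      have nb: "norm (s *\<^sub>R v + s' *\<^sub>R w) \<le> t * K" if "0 \<le> s" "s \<le> t" "0 \<le> s'" "s' \<le> t" for s s'
      proof -
        have "norm (s *\<^sub>R v + s' *\<^sub>R w) \<le> s * norm v + s' * norm w"
          using norm_triangle_ineq[of "s *\<^sub>R v" "s' *\<^sub>R w"] that by simp
        also have "\<dots> \<le> t * norm v + t * norm w"
          using that by (intro add_mono mult_right_mono) auto
        finally show ?thesis using t unfolding K_def by (simp add: algebra_simps)
      qed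
      have inW: "x + s *\<^sub>R v + s' *\<^sub>R w \<in> W" if "0 \<le> s" "s \<le> t" "0 \<le> s'" "s' \<le> t" for s s'
        using nb[OF that] tK r(2) by (auto simp: dist_norm norm_minus_commute subset_iff add.assoc)
      \<comment> \<open>The second difference is the increment of \<open>h\<close> over
        \<open>{0..t}\<close>. The mean value theorem gives one common \<open>z\<close> for both
        terms of \<open>h\<close>, so what remains is a difference of \<open>dd v f\<close> at two
        points that differ by \<open>t *\<^sub>R w\<close>.\<close>
      define h where "h = (\<lambda>s. f ((x + t *\<^sub>R w) + s *\<^sub>R v) \<bullet> c - f (x + s *\<^sub>R v) \<bullet> c)"
      have "\<exists>z>0. z < t \<and> h t - h 0 =
          (t - 0) * (?g ((x + t *\<^sub>R w) + z *\<^sub>R v) \<bullet> c - ?g (x + z *\<^sub>R v) \<bullet> c)"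
      proof (rule MVT2[OF t(1)])
        fix s assume s: "0 \<le> s" "s \<le> t"
        have "f differentiable at ((x + t *\<^sub>R w) + s *\<^sub>R v)" "f differentiable at (x + s *\<^sub>R v)"
          using inW[of s t] inW[of s 0] s t smooth_on_differentiable[OF W(2)]
          by (auto simp: add.assoc add.left_commute add.commute)
        then show "(h has_real_derivative
            ?g ((x + t *\<^sub>R w) + s *\<^sub>R v) \<bullet> c - ?g (x + s *\<^sub>R v) \<bullet> c) (at s)"
          unfolding h_def by (intro DERIV_diff DERIV_line)
      qed
      then obtain z where z: "0 < z" "z < t"
        and eq: "h t - h 0 = t * ((?g ((x + t *\<^sub>R w) + z *\<^sub>R v) - ?g (x + z *\<^sub>R v)) \<bullet> c)"
        by (auto simp: inner_diff_left)
      have qh: "?q t = h t - h 0"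
        unfolding h_def by (simp add: algebra_simps inner_diff_left inner_add_left)
      let ?y1 = "(x + t *\<^sub>R w) + z *\<^sub>R v" and ?y2 = "x + z *\<^sub>R v"
      let ?E = "\<lambda>y. ?g y - ?g x - ?D (y - x)"
      have n1: "norm (?y1 - x) \<le> t * K" and n2: "norm (?y2 - x) \<le> t * K"
        using nb[of z t] nb[of z 0] z by (auto simp: algebra_simps)
      have "norm (?E ?y1) \<le> e' * (t * K)" "norm (?E ?y2) \<le> e' * (t * K)"
        using d(2)[of ?y1] d(2)[of ?y2] n1 n2 tK e'
        by (meson mult_left_mono order.trans order.strict_trans1 less_imp_le)+
      then have E: "norm (?E ?y1 - ?E ?y2) \<le> 2 * (e' * (t * K))"
        using norm_triangle_ineq4[of "?E ?y1" "?E ?y2"] by linarith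
      have "?D (?y1 - x) - ?D (?y2 - x) = t *\<^sub>R ?D w"
        by (simp add: D.add D.diff D.scale)
      then have "?g ?y1 - ?g ?y2 = (?E ?y1 - ?E ?y2) + t *\<^sub>R ?D w"
        by (simp add: algebra_simps)
      then have qE: "?q t = t * ((?E ?y1 - ?E ?y2) \<bullet> c) + t\<^sup>2 * (?D w \<bullet> c)"
        unfolding qh eq by (simp only: inner_add_left) (simp add: power2_eq_square distrib_left)
      have le: "\<bar>(?E ?y1 - ?E ?y2) \<bullet> c\<bar> \<le> 2 * (e' * (t * K)) * norm c"
        using Cauchy_Schwarz_ineq2[of "?E ?y1 - ?E ?y2" c] E
        by (meson mult_right_mono norm_ge_zero order.trans)
      have "?q t / t\<^sup>2 - ?D w \<bullet> c = ((?E ?y1 - ?E ?y2) \<bullet> c) / t"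
        unfolding qE using t by (simp add: field_simps power2_eq_square)
      then have "\<bar>?q t / t\<^sup>2 - ?D w \<bullet> c\<bar> \<le> 2 * (e' * (t * K)) * norm c / t"
        using divide_right_mono[OF le, of t] t by (simp only: abs_divide abs_of_pos less_imp_le)
      also have "\<dots> = 2 * e' * K * norm c"
        using t by simp
      also have "\<dots> = e * (norm c / (2 * (norm c + 1)))"
      proof -
        have "norm c + 1 \<noteq> 0" using norm_ge_zero[of c] by linarith
        then show ?thesis unfolding e'_def using K by (simp add: divide_simps)
      qed
      also have "\<dots> < e"
        using e by (simp add: divide_less_eq add_nonneg_pos)
      finally show ?thesis by (simp add: dist_real_def)
    qed
    moreover have "min (r / K) (d / K) > 0" using r d K by simp
    ultimately show "\<forall>\<^sub>F t in at_right 0. dist (?q t / t\<^sup>2) (?D w \<bullet> c) < e"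
      using eventually_at_right_field by blast
  qed
qed

lemma dd_commute:
  fixes f :: "'a::euclidean_space \<Rightarrow> 'b::euclidean_space"
  assumes "open W" "smooth_on W f" "x \<in> W"
  shows "dd v (dd w f) x = dd w (dd v f) x"
proof (rule euclidean_eqI)
  fix c :: 'b
  have "((\<lambda>t. (f (x + t *\<^sub>R v + t *\<^sub>R w) - f (x + t *\<^sub>R v) - f (x + t *\<^sub>R w) + f x) \<bullet> c / t\<^sup>2)
    \<longlongrightarrow> dd v (dd w f) x \<bullet> c) (at_right 0)"
    using second_difference[OF assms, where v = w and w = v and c = c]
    by (simp add: algebra_simps)
  from tendsto_unique[OF _ this second_difference[OF assms]]
  show "dd v (dd w f) x \<bullet> c = dd w (dd v f) x \<bullet> c"
    by simp
qed

section \<open>Coordinate expansions, determinants and matrix inverses\<close>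

lemma vec_axis_expansion: "(\<Sum>i\<in>UNIV. v $ i *\<^sub>R axis i 1) = (v :: real^'n::finite)"
  using basis_expansion[of v] by (simp add: scalar_mult_eq_scaleR)

lemma linear_axis_expansion:
  fixes h :: "real^'n::finite \<Rightarrow> 'b::real_vector"
  assumes "linear h"
  shows "h v = (\<Sum>i\<in>UNIV. v $ i *\<^sub>R h (axis i 1))"
proof -
  have "h v = h (\<Sum>i\<in>UNIV. v $ i *\<^sub>R axis i 1)" by (simp add: vec_axis_expansion)
  also have "\<dots> = (\<Sum>i\<in>UNIV. v $ i *\<^sub>R h (axis i 1))"
    by (simp add: linear_sum[OF assms] linear_cmul[OF assms])
  finally show ?thesis .
qed

lemma differentiable_prod:
  fixes g :: "'i \<Rightarrow> 'a::real_normed_vector \<Rightarrow> real"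
  assumes "\<And>i. i \<in> I \<Longrightarrow> g i differentiable at x"
  shows "(\<lambda>y. \<Prod>i\<in>I. g i y) differentiable at x"
  using assms by (induction I rule: infinite_finite_induct) auto

lemma differentiable_det:
  fixes A :: "'a::real_normed_vector \<Rightarrow> real^'n^'n::finite"
  assumes "\<And>i j. (\<lambda>y. A y $ i $ j) differentiable at x"
  shows "(\<lambda>y. det (A y)) differentiable at x"
proof -
  have "(\<lambda>y. \<Prod>i\<in>UNIV. A y $ i $ p i) differentiable at x" for p
    by (rule differentiable_prod) (rule assms)
  then show ?thesis
    unfolding det_def by (intro differentiable_sum differentiable_mult differentiable_const) auto
qed

lemma dd_inner:
  assumes "f differentiable at x" "g differentiable at x"
  shows "dd v (\<lambda>y. f y \<bullet> g y) x = dd v f x \<bullet> g x + f x \<bullet> dd v g x"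
  by (rule dd_eqI[of _ "\<lambda>v. dd v f x \<bullet> g x + f x \<bullet> dd v g x"])
    (use assms in \<open>auto intro!: derivative_eq_intros has_derivative_dd\<close>)

lemma differentiable_inner:
  assumes "f differentiable at x" "g differentiable at x"
  shows "(\<lambda>y. f y \<bullet> g y) differentiable at x"
  using has_derivative_inner[OF has_derivative_dd[OF assms(1)] has_derivative_dd[OF assms(2)]]
  unfolding differentiable_def by blast

lemma matrix_inv_inverse:
  fixes A :: "real^'n^'n::finite"
  assumes "invertible A"
  shows "A ** matrix_inv A = mat 1" "matrix_inv A ** A = mat 1"
  using someI_ex[OF assms[unfolded invertible_def]] by (simp_all add: matrix_inv_def)

section \<open>The equations of Gauss and Ricci\<close>

lemma mem_tangent_fibre: "t \<in> tangent_fibre f x \<longleftrightarrow> (\<exists>v. t = dd v f x)"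
  by (auto simp: tangent_fibre_def)

lemma mem_normal_fibre: "t \<in> normal_fibre f x \<longleftrightarrow> (\<forall>v. t \<bullet> dd v f x = 0)"
  by (auto simp: normal_fibre_def orthogonal_comp_def tangent_fibre_def orthogonal_def inner_commute)

text \<open>\<open>coords\<close> is an inverse function with unspecified values off the tangent
  space. Composing it with the orthogonal projection gives a map that is linear on the whole ambient
  space and can be applied to vectors, such as second derivatives, that are not tangent.\<close>

definition tangent_coords :: "(real^'n::finite \<Rightarrow> 'v::euclidean_space) \<Rightarrow> real^'n \<Rightarrow> 'v \<Rightarrow> real^'n"
  where "tangent_coords f x y = coords f x (y - normal_part f x y)"

locale immersion =
  fixes W :: "(real^'n::finite) set" and f :: "real^'n \<Rightarrow> 'v::euclidean_space"
  assumes open_W: "open W"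
    and smooth: "smooth_on W f"
    and inj_deriv: "x \<in> W \<Longrightarrow> inj (frechet_derivative f (at x))"
begin

lemma smooth_dd: "smooth_on W (dd v f)"
  by (rule smooth_on_dd[OF open_W smooth])

lemma smooth_dd_dd: "smooth_on W (dd w (dd v f))"
  by (rule smooth_on_dd[OF open_W smooth_dd])

context
  fixes x assumes x: "x \<in> W"
begin

lemma diff_f: "f differentiable at x"
  and diff_dd: "dd v f differentiable at x"
  and diff_dd_dd: "dd w (dd v f) differentiable at x"
  using x smooth_on_differentiable smooth smooth_dd smooth_dd_dd by blast+

lemma linear_dd_f: "linear (\<lambda>v. dd v f x)"
  by (rule linear_dd[OF diff_f])

lemma dd_f_inject: "dd v f x = dd w f x \<longleftrightarrow> v = w"
  using inj_deriv[OF x] by (auto simp: inj_eq)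

lemma hess_commute: "dd v (dd w f) x = dd w (dd v f) x"
  by (rule dd_commute[OF open_W smooth x])

lemma linear_hess_left: "linear (\<lambda>v. dd v (dd w f) x)"
  by (rule linear_dd[OF diff_dd])

lemma linear_hess_right: "linear (\<lambda>w. dd v (dd w f) x)"
  using linear_hess_left[of v] by (simp add: hess_commute[of v])

lemma third_commute: "dd u (dd v (dd w f)) x = dd v (dd u (dd w f)) x"
  by (rule dd_commute[OF open_W smooth_dd x])

lemma subspace_tangent: "subspace (tangent_fibre f x)"
  unfolding tangent_fibre_def by (rule linear_subspace_image[OF linear_dd_f subspace_UNIV])

lemma normal_tangent_zero: "z \<in> normal_fibre f x \<Longrightarrow> z \<in> tangent_fibre f x \<Longrightarrow> z = 0"
  by (metis inner_eq_zero_iff mem_normal_fibre mem_tangent_fibre)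

lemma subspace_normal: "subspace (normal_fibre f x)"
  unfolding normal_fibre_def by (rule subspace_orthogonal_comp)

lemma normal_part_eqI:
  assumes "z \<in> normal_fibre f x" "y - z \<in> tangent_fibre f x"
  shows "normal_part f x y = z"
  unfolding normal_part_def
proof (rule the_equality)
  fix z' assume z': "z' \<in> normal_fibre f x \<and> y - z' \<in> tangent_fibre f x"
  have "z' - z \<in> normal_fibre f x" using z' assms subspace_diff[OF subspace_normal] by blast
  moreover have "z' - z \<in> tangent_fibre f x"
    using subspace_diff[OF subspace_tangent assms(2), of "y - z'"] z' by simp
  ultimately show "z' = z" using normal_tangent_zero by force
qed (use assms in auto)

lemma normal_part_decomp:
  "normal_part f x y \<in> normal_fibre f x" "y - normal_part f x y \<in> tangent_fibre f x"
proof -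
  obtain t z where tz: "t \<in> span (tangent_fibre f x)"
    "\<And>w. w \<in> span (tangent_fibre f x) \<Longrightarrow> orthogonal z w" "y = t + z"
    by (rule orthogonal_subspace_decomp_exists[of "tangent_fibre f x" y]) blast
  have "z \<in> normal_fibre f x" "y - z \<in> tangent_fibre f x"
    using tz subspace_tangent unfolding mem_normal_fibre
    by (auto simp: orthogonal_def span_eq_iff[THEN iffD2] tangent_fibre_def)
  with normal_part_eqI show "normal_part f x y \<in> normal_fibre f x"
    "y - normal_part f x y \<in> tangent_fibre f x" by metis+
qed

lemma normal_part_dd_f: "normal_part f x y \<bullet> dd v f x = 0"
  using normal_part_decomp(1) mem_normal_fibre by blast

lemma normal_part_inner: "\<eta> \<in> normal_fibre f x \<Longrightarrow> normal_part f x y \<bullet> \<eta> = y \<bullet> \<eta>"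
  using normal_part_decomp(2)[of y] unfolding mem_tangent_fibre mem_normal_fibre
  by (metis diff_add_cancel inner_add_left inner_commute add_0)

lemma normal_part_inner_normal_part: "normal_part f x y \<bullet> normal_part f x z = normal_part f x y \<bullet> z"
  using normal_part_inner[OF normal_part_decomp(1), of z y] by (simp add: inner_commute)

lemma linear_normal_part: "linear (normal_part f x)"
proof
  fix y z :: 'v and r :: real
  show "normal_part f x (y + z) = normal_part f x y + normal_part f x z"
    using subspace_add[OF subspace_tangent normal_part_decomp(2)[of y] normal_part_decomp(2)[of z]]
    by (intro normal_part_eqI subspace_add[OF subspace_normal] normal_part_decomp)
      (simp add: algebra_simps)
  show "normal_part f x (r *\<^sub>R y) = r *\<^sub>R normal_part f x y"
    using subspace_mul[OF subspace_tangent normal_part_decomp(2)[of y], of r]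
    by (intro normal_part_eqI subspace_mul[OF subspace_normal] normal_part_decomp)
      (simp add: algebra_simps)
qed

lemma normal_part_of_tangent: "normal_part f x (dd v f x) = 0"
  by (rule normal_part_eqI) (auto simp: mem_tangent_fibre subspace_0[OF subspace_normal])

lemma coords_dd_f: "coords f x (dd v f x) = v"
  unfolding coords_def using inj_deriv[OF x] by simp

lemma dd_tangent_coords: "dd (tangent_coords f x y) f x = y - normal_part f x y"
  using normal_part_decomp(2)[of y] unfolding tangent_coords_def mem_tangent_fibre
  by (metis coords_dd_f)

lemma linear_tangent_coords: "linear (tangent_coords f x)"
proof
  interpret N: linear "normal_part f x" by (rule linear_normal_part)
  interpret D: linear "\<lambda>v. dd v f x" by (rule linear_dd_f)
  fix y z :: 'v and r :: real
  show "tangent_coords f x (y + z) = tangent_coords f x y + tangent_coords f x z"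
    by (subst dd_f_inject[symmetric]) (simp add: D.add dd_tangent_coords N.add)
  show "tangent_coords f x (r *\<^sub>R y) = r *\<^sub>R tangent_coords f x y"
    by (subst dd_f_inject[symmetric])
      (simp add: D.scale dd_tangent_coords N.scale scaleR_diff_right)
qed

lemma metric_mult_vec: "metric f x *v v = (\<chi> l. dd v f x \<bullet> dd (axis l 1) f x)"
proof -
  have "dd v f x \<bullet> y = (\<Sum>j\<in>UNIV. (y \<bullet> dd (axis j 1) f x) * v $ j)" for y
    by (subst linear_axis_expansion[OF linear_dd_f]) (simp add: inner_sum_left inner_sum_right inner_commute mult.commute)
  then show ?thesis
    by (simp add: metric_def matrix_vector_mult_def)
qed

lemma invertible_metric: "invertible (metric f x)"
  unfolding invertible_left_inverse matrix_left_invertible_ker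
proof (intro allI impI)
  fix v assume "metric f x *v v = 0"
  then have "dd v f x \<bullet> dd (axis l 1) f x = 0" for l
    by (simp add: metric_mult_vec vec_eq_iff)
  then have "dd v f x \<bullet> dd v f x = 0"
    by (subst (2) linear_axis_expansion[OF linear_dd_f]) (simp add: inner_sum_right)
  then have "dd v f x = dd 0 f x" by (simp add: linear_0[OF linear_dd_f])
  then show "v = 0" by (simp only: dd_f_inject)
qed

lemma metric_tangent_coords:
  "metric f x *v tangent_coords f x y = (\<chi> l. y \<bullet> dd (axis l 1) f x)"
  by (simp add: metric_mult_vec dd_tangent_coords inner_diff_left normal_part_dd_f)

text \<open>The normal equations of the orthogonal projection, solved with the inverse Gram matrix.
  This is the form in which the projection is hidden inside \<open>christoffel\<close>.\<close>

lemma tangent_coords_matrix_inv: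
  "tangent_coords f x y = matrix_inv (metric f x) *v (\<chi> l. y \<bullet> dd (axis l 1) f x)"
  by (simp add: metric_tangent_coords[symmetric] matrix_vector_mul_assoc
      matrix_inv_inverse[OF invertible_metric])

text \<open>The coordinates of the representing vector are the inverse Gram matrix applied to the
  values of \<open>h\<close> on the axis vectors. It supplies the existence behind the definite
  description in \<open>shape_op\<close>.\<close>

lemma riesz_tangent:
  assumes "linear h"
  obtains q where "\<And>w. dd q f x \<bullet> dd w f x = h w"
proof
  fix w
  let ?q = "matrix_inv (metric f x) *v (\<chi> l. h (axis l 1))"
  have "metric f x *v ?q = (\<chi> l. h (axis l 1))"
    by (simp add: matrix_vector_mul_assoc matrix_inv_inverse[OF invertible_metric])
  then have "dd ?q f x \<bullet> dd (axis l 1) f x = h (axis l 1)" for l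
    by (simp add: metric_mult_vec vec_eq_iff)
  then show "dd ?q f x \<bullet> dd w f x = h w"
    by (subst linear_axis_expansion[OF assms], subst (2) linear_axis_expansion[OF linear_dd_f])
      (simp add: inner_sum_right)
qed

end

text \<open>The projection varies with the base point. Cramer's rule writes each of its coordinates
  as a quotient of determinants with differentiable entries, whose denominator, the Gram
  determinant, does not vanish on \<open>W\<close>.\<close>

lemma differentiable_tangent_coords:
  assumes x: "x \<in> W" and Y: "Y differentiable at x"
  shows "(\<lambda>y. tangent_coords f y (Y y)) differentiable at x"
proof -
  let ?b = "\<lambda>y. \<chi> l. Y y \<bullet> dd (axis l 1) f y"
  let ?c = "\<lambda>y k. det (\<chi> i j. if j = k then ?b y $ i else metric f y $ i $ j) / det (metric f y)"
  have nz: "det (metric f y) \<noteq> 0" if "y \<in> W" for y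
    using invertible_metric[OF that] invertible_det_nz by blast
  have m: "(\<lambda>y. metric f y $ i $ j) differentiable at x" for i j
    by (simp add: metric_def differentiable_inner diff_dd[OF x])
  have b: "(\<lambda>y. ?b y $ l) differentiable at x" for l
    by (simp add: differentiable_inner diff_dd[OF x] Y)
  have "(\<lambda>y. (\<chi> i j. if j = k then ?b y $ i else metric f y $ i $ j) $ i $ j) differentiable at x" for i j k
    using m b by (cases "j = k") auto
  then have "(\<lambda>y. ?c y k) differentiable at x" for k
    using nz[OF x] m by (intro differentiable_divide differentiable_det) auto
  then have d: "(\<lambda>y. \<Sum>k\<in>UNIV. ?c y k *\<^sub>R axis k 1) differentiable at x"
    by (intro differentiable_sum differentiable_scaleR differentiable_const) auto
  have eq: "(\<Sum>k\<in>UNIV. ?c y k *\<^sub>R axis k 1) = tangent_coords f y (Y y)" if y: "y \<in> W" for y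
  proof -
    have "tangent_coords f y (Y y) = (\<chi> k. ?c y k)"
      using metric_tangent_coords[OF y, of "Y y"] unfolding cramer[OF nz[OF y]] .
    then show ?thesis
      using vec_axis_expansion[of "tangent_coords f y (Y y)"] by simp
  qed
  show ?thesis by (rule differentiable_cong[OF open_W x eq d])
qed

section \<open>The Levi-Civita connection as the tangential part of the flat derivative\<close>

context
  fixes x assumes x: "x \<in> W"
begin

lemma second_ff_dd: "second_ff f x (dd v f x) (dd w f x) = normal_part f x (dd v (dd w f) x)"
  by (simp add: second_ff_def coords_dd_f[OF x])

lemma dd_metric:
  "dd v (\<lambda>y. metric f y $ j $ l) x =
    dd v (dd (axis j 1) f) x \<bullet> dd (axis l 1) f x + dd (axis j 1) f x \<bullet> dd v (dd (axis l 1) f) x"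
  by (simp add: metric_def dd_inner diff_dd[OF x])

text \<open>In the Koszul combination of metric derivatives, symmetry of the second derivatives of
  \<open>f\<close> cancels all but twice the inner product of the \<open>i,j\<close> second
  derivative with the \<open>l\<close>-th tangent vector; the inverse metric then performs the
  tangential projection.\<close>

lemma christoffel_eq:
  "christoffel f k i j x = tangent_coords f x (dd (axis i 1) (dd (axis j 1) f) x) $ k"
proof -
  have "dd (axis i 1) (\<lambda>y. metric f y $ j $ l) x + dd (axis j 1) (\<lambda>y. metric f y $ i $ l) x
      - dd (axis l 1) (\<lambda>y. metric f y $ i $ j) x
    = 2 * (dd (axis i 1) (dd (axis j 1) f) x \<bullet> dd (axis l 1) f x)" for l
    using hess_commute[OF x, of "axis i 1" "axis j 1"] hess_commute[OF x, of "axis i 1" "axis l 1"]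
      hess_commute[OF x, of "axis j 1" "axis l 1"]
    by (simp add: dd_metric inner_commute)
  then show ?thesis
    unfolding christoffel_def tangent_coords_matrix_inv[OF x]
    by (simp add: matrix_vector_mult_def sum_distrib_left mult_ac)
qed

lemma hess_expansion:
  "dd v (dd w f) x =
    (\<Sum>i\<in>UNIV. \<Sum>j\<in>UNIV. (v $ i * w $ j) *\<^sub>R dd (axis i 1) (dd (axis j 1) f) x)"
proof -
  have "dd v (dd w f) x = (\<Sum>i\<in>UNIV. v $ i *\<^sub>R dd (axis i 1) (dd w f) x)"
    by (rule linear_axis_expansion[OF linear_hess_left[OF x]])
  also have "\<dots> = (\<Sum>i\<in>UNIV. v $ i *\<^sub>R (\<Sum>j\<in>UNIV. w $ j *\<^sub>R dd (axis i 1) (dd (axis j 1) f) x))"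
    by (intro sum.cong refl arg_cong2[of _ _ _ _ scaleR] linear_axis_expansion[OF linear_hess_right[OF x]])
  finally show ?thesis by (simp add: scaleR_sum_right)
qed

lemma cov_deriv_eq:
  "cov_deriv f v V x = dd v V x + tangent_coords f x (dd v (dd (V x) f) x)"
proof -
  interpret T: linear "tangent_coords f x" by (rule linear_tangent_coords[OF x])
  have "(\<chi> k. \<Sum>i\<in>UNIV. \<Sum>j\<in>UNIV. christoffel f k i j x * v $ i * V x $ j)
      = tangent_coords f x (dd v (dd (V x) f) x)"
    unfolding hess_expansion[where v = v and w = "V x"]
    by (simp add: vec_eq_iff christoffel_eq T.sum T.scale mult_ac)
  then show ?thesis by (simp add: cov_deriv_def)
qed

text \<open>The direction \<open>V y\<close> moves with the point, so this is not the derivative of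
  one fixed map \<open>dd v f\<close>. Expanding \<open>V y\<close> in axis vectors reduces it to
  the product rule for finitely many fixed maps.\<close>

lemma dd_field:
  assumes V: "V differentiable at x"
  shows "(\<lambda>y. dd (V y) f y) differentiable at x"
    and "dd v (\<lambda>y. dd (V y) f y) x = dd (dd v V x) f x + dd v (dd (V x) f) x"
proof -
  let ?F = "\<lambda>y. \<Sum>k\<in>UNIV. V y $ k *\<^sub>R dd (axis k 1) f y"
  have eq: "?F y = dd (V y) f y" if "y \<in> W" for y
    by (subst linear_axis_expansion[OF linear_dd_f[OF that]]) simp
  have "((\<lambda>y. V y $ k) has_derivative (\<lambda>v. dd v V x $ k)) (at x)" for k
    by (rule bounded_linear.has_derivative[OF bounded_linear_vec_nth has_derivative_dd[OF V]])
  then have D: "(?F has_derivative (\<lambda>v. \<Sum>k\<in>UNIV. V x $ k *\<^sub>R dd v (dd (axis k 1) f) x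
      + dd v V x $ k *\<^sub>R dd (axis k 1) f x)) (at x)"
    by (intro has_derivative_sum has_derivative_scaleR has_derivative_dd diff_dd[OF x])
  show "(\<lambda>y. dd (V y) f y) differentiable at x"
    by (rule differentiable_cong[OF open_W x eq differentiableI[OF D]])
  have "dd v (\<lambda>y. dd (V y) f y) x = dd v ?F x"
    using dd_cong[OF open_W x eq] by simp
  also have "\<dots> = dd (dd v V x) f x + dd v (dd (V x) f) x"
    unfolding dd_eqI[OF D]
    unfolding linear_axis_expansion[OF linear_dd_f[OF x], of "dd v V x"]
      linear_axis_expansion[OF linear_hess_right[OF x, of v], where v = "V x"]
    by (simp add: sum.distrib)
  finally show "dd v (\<lambda>y. dd (V y) f y) x = dd (dd v V x) f x + dd v (dd (V x) f) x" .
qed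

end

section \<open>The equations of Gauss and Ricci, and the shape operator\<close>

context
  fixes x assumes x: "x \<in> W"
begin

text \<open>\<open>V\<close> holds the coordinates of the tangential part \<open>?G\<close> of
  \<open>?K\<close>. Both have the same inner product with \<open>dd c f\<close> throughout
  \<open>W\<close>, and differentiating this equality expresses the derivative of a projection by
  derivatives of \<open>f\<close>. The remainder \<open>?K - ?G\<close>, which is normal, is paired
  with a second derivative and becomes the product of second fundamental forms.\<close>

lemma gauss_aux:
  assumes V: "V = cov_deriv f w (\<lambda>_. z)"
  shows "V differentiable at x"
    and "dd (cov_deriv f v V x) f x \<bullet> dd c f x =
      dd v (dd w (dd z f)) x \<bullet> dd c f x
      + normal_part f x (dd w (dd z f) x) \<bullet> normal_part f x (dd v (dd c f) x)"
proof -
  let ?K = "dd w (dd z f)"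
  have Veq: "tangent_coords f y (?K y) = V y" if "y \<in> W" for y
    using cov_deriv_eq[OF that] unfolding V by simp
  show Vd: "V differentiable at x"
    by (rule differentiable_cong[OF open_W x Veq differentiable_tangent_coords[OF x diff_dd_dd[OF x]]])
  let ?G = "\<lambda>y. dd (V y) f y"
  have Gx: "?G y = ?K y - normal_part f y (?K y)" if "y \<in> W" for y
    using dd_tangent_coords[OF that, of "?K y"] Veq[OF that] by simp
  have "dd v (\<lambda>y. ?G y \<bullet> dd c f y) x = dd v (\<lambda>y. ?K y \<bullet> dd c f y) x"
    by (rule dd_cong[OF open_W x]) (simp add: Gx normal_part_dd_f inner_diff_left)
  then have "dd v ?G x \<bullet> dd c f x + ?G x \<bullet> dd v (dd c f) x = dd v ?K x \<bullet> dd c f x + ?K x \<bullet> dd v (dd c f) x"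
    by (simp only: dd_inner[OF dd_field(1)[OF x Vd] diff_dd[OF x]] dd_inner[OF diff_dd_dd[OF x] diff_dd[OF x]])
  moreover have "dd (cov_deriv f v V x) f x \<bullet> dd c f x = dd v ?G x \<bullet> dd c f x"
    unfolding cov_deriv_eq[OF x] dd_field(2)[OF x Vd] linear_add[OF linear_dd_f[OF x]] dd_tangent_coords[OF x]
    by (simp add: inner_add_left inner_diff_left normal_part_dd_f[OF x])
  ultimately show "dd (cov_deriv f v V x) f x \<bullet> dd c f x = dd v ?K x \<bullet> dd c f x
      + normal_part f x (?K x) \<bullet> normal_part f x (dd v (dd c f) x)"
    using Gx[OF x] by (simp add: inner_diff_left normal_part_inner_normal_part[OF x])
qed

text \<open>The two orders of differentiation produce third derivatives of \<open>f\<close> that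
  agree by \<open>third_commute\<close> and cancel; only the second fundamental form terms
  remain.\<close>

lemma gauss_equation:
  "riemann f x (dd v f x) (dd w f x) (dd z f x) \<bullet> dd c f x =
    normal_part f x (dd w (dd z f) x) \<bullet> normal_part f x (dd v (dd c f) x)
    - normal_part f x (dd v (dd z f) x) \<bullet> normal_part f x (dd w (dd c f) x)"
  unfolding riemann_def Let_def coords_dd_f[OF x] linear_diff[OF linear_dd_f[OF x]] inner_diff_left
    gauss_aux(2)[OF refl] third_commute[OF x, where u = v and v = w and w = z]
  by simp

text \<open>The extension \<open>normal_part f y U\<close> is \<open>U\<close> minus the tangent
  field with components \<open>c\<close>. Its normal derivative is linear in \<open>c\<close>, and
  \<open>c\<close> vanishes at \<open>x\<close>, so a second derivative only sees the first
  derivative of \<open>c\<close>. The second conclusion identifies the latter as the components of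
  the shape operator of \<open>U\<close> applied to the direction \<open>v\<close>.\<close>

lemma ricci_aux:
  assumes U: "U \<in> normal_fibre f x" and \<eta>: "\<eta> \<in> normal_fibre f x"
  defines "c \<equiv> \<lambda>y. tangent_coords f y U"
  shows "normal_deriv f v (normal_deriv f w (\<lambda>y. normal_part f y U)) x \<bullet> \<eta>
      = - (normal_part f x (dd w (dd (dd v c x) f) x) \<bullet> \<eta>)"
    and "dd (dd v c x) f x \<bullet> dd m f x = U \<bullet> normal_part f x (dd v (dd m f) x)"
proof -
  have cd: "c differentiable at y" if "y \<in> W" for y
    unfolding c_def by (rule differentiable_tangent_coords[OF that differentiable_const])
  have Dc: "dd (c y) f y = U - normal_part f y U" if "y \<in> W" for y
    unfolding c_def by (rule dd_tangent_coords[OF that])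
  have NU: "normal_part f x U = U"
    by (rule normal_part_eqI[OF x U]) (simp add: subspace_0[OF subspace_tangent[OF x]])
  have c0: "c x = 0"
    unfolding c_def tangent_coords_def NU using linear_0[OF linear_dd_f[OF x]] coords_dd_f[OF x, of 0] by simp
  have nd: "normal_deriv f w (\<lambda>y. normal_part f y U) y
      = - (\<Sum>k\<in>UNIV. c y $ k *\<^sub>R normal_part f y (dd w (dd (axis k 1) f) y))" if y: "y \<in> W" for y
  proof -
    interpret N: linear "normal_part f y" by (rule linear_normal_part[OF y])
    have "dd w (\<lambda>y. normal_part f y U) y = dd w (\<lambda>y. U - dd (c y) f y) y"
      by (rule dd_cong[OF open_W y]) (simp add: Dc)
    also have "\<dots> = - dd w (\<lambda>y. dd (c y) f y) y"
      by (rule dd_eqI) (auto intro!: derivative_eq_intros has_derivative_dd dd_field(1) y cd)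
    also have "\<dots> = - (dd (dd w c y) f y + dd w (dd (c y) f) y)"
      by (simp add: dd_field(2)[OF y cd[OF y]])
    finally have "normal_deriv f w (\<lambda>y. normal_part f y U) y = - normal_part f y (dd w (dd (c y) f) y)"
      unfolding normal_deriv_def by (simp only: N.neg N.add normal_part_of_tangent[OF y]) simp
    then show ?thesis
      by (subst (asm) linear_axis_expansion[OF linear_hess_right[OF y]]) (simp add: N.sum N.scale)
  qed
  let ?F = "\<lambda>y. - (\<Sum>k\<in>UNIV. c y $ k *\<^sub>R normal_part f y (dd w (dd (axis k 1) f) y))"
  have Nd: "(\<lambda>y. normal_part f y (dd w (dd b f) y)) differentiable at x" for b
  proof (rule differentiable_cong[OF open_W x])
    let ?K = "dd w (dd b f)"
    show "?K y - dd (tangent_coords f y (?K y)) f y = normal_part f y (?K y)" if "y \<in> W" for y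
      by (simp add: dd_tangent_coords[OF that])
    show "(\<lambda>y. ?K y - dd (tangent_coords f y (?K y)) f y) differentiable at x"
      by (intro differentiable_diff diff_dd_dd[OF x] dd_field(1) x differentiable_tangent_coords[OF x])
  qed
  have "((\<lambda>y. c y $ k) has_derivative (\<lambda>v. dd v c x $ k)) (at x)" for k
    by (rule bounded_linear.has_derivative[OF bounded_linear_vec_nth has_derivative_dd[OF cd[OF x]]])
  then have "(?F has_derivative (\<lambda>v. - (\<Sum>k\<in>UNIV. c x $ k *\<^sub>R dd v (\<lambda>y. normal_part f y (dd w (dd (axis k 1) f) y)) x
      + dd v c x $ k *\<^sub>R normal_part f x (dd w (dd (axis k 1) f) x)))) (at x)"
    by (intro has_derivative_minus has_derivative_sum has_derivative_scaleR has_derivative_dd Nd)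
  \<comment> \<open>In the product rule the terms with a derivative of the normal part carry the
    factor \<open>c x\<close>, which is zero.\<close>
  then have "dd v ?F x = - (\<Sum>k\<in>UNIV. dd v c x $ k *\<^sub>R normal_part f x (dd w (dd (axis k 1) f) x))"
    by (subst dd_eqI) (auto simp: c0)
  also have "\<dots> = - normal_part f x (dd w (dd (dd v c x) f) x)"
    by (subst (2) linear_axis_expansion[OF linear_hess_right[OF x]])
      (simp add: linear_sum[OF linear_normal_part[OF x]] linear_cmul[OF linear_normal_part[OF x]])
  finally have "dd v (normal_deriv f w (\<lambda>y. normal_part f y U)) x = \<dots>"
    using dd_cong[OF open_W x nd] by simp
  moreover have "normal_deriv f v \<xi> x \<bullet> \<eta> = dd v \<xi> x \<bullet> \<eta>" for \<xi>
    unfolding normal_deriv_def by (rule normal_part_inner[OF x \<eta>])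
  ultimately show "normal_deriv f v (normal_deriv f w (\<lambda>y. normal_part f y U)) x \<bullet> \<eta>
      = - (normal_part f x (dd w (dd (dd v c x) f) x) \<bullet> \<eta>)"
    by simp
  \<comment> \<open>The tangential part of the constant vector \<open>U\<close> has the same inner
    products with tangent vectors as \<open>U\<close> itself; the derivative of this identity
    determines the derivative of \<open>c\<close>.\<close>
  have "dd v (\<lambda>y. dd (c y) f y \<bullet> dd m f y) x = dd v (\<lambda>y. U \<bullet> dd m f y) x"
    by (rule dd_cong[OF open_W x]) (simp add: Dc normal_part_dd_f inner_diff_left)
  then have "dd v (\<lambda>y. dd (c y) f y) x \<bullet> dd m f x + dd (c x) f x \<bullet> dd v (dd m f) x = U \<bullet> dd v (dd m f) x"
    by (simp only: dd_inner[OF dd_field(1)[OF x cd[OF x]] diff_dd[OF x]]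
        dd_inner[OF differentiable_const diff_dd[OF x]]) simp
  moreover have "dd v (\<lambda>y. dd (c y) f y) x = dd (dd v c x) f x"
    unfolding dd_field(2)[OF x cd[OF x]] c0 linear_0[OF linear_hess_right[OF x]] by simp
  moreover have "dd (c x) f x = 0"
    unfolding c0 by (rule linear_0[OF linear_dd_f[OF x]])
  ultimately show "dd (dd v c x) f x \<bullet> dd m f x = U \<bullet> normal_part f x (dd v (dd m f) x)"
    unfolding inner_commute[of U "normal_part f x _"] normal_part_inner[OF x U]
    by (simp add: inner_commute)
qed

text \<open>Resolves the description in \<open>shape_op\<close>: existence by
  \<open>riesz_tangent\<close>, uniqueness because two solutions differ by a tangent vector
  orthogonal to itself.\<close>

lemma shape_op_dd:
  assumes "U \<in> normal_fibre f x"
  shows "shape_op f x U (dd v f x) \<bullet> dd w f x = normal_part f x (dd v (dd w f) x) \<bullet> U"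
proof -
  let ?h = "\<lambda>w. normal_part f x (dd v (dd w f) x) \<bullet> U"
  have "linear ?h"
    using linear_compose[OF linear_compose[OF linear_hess_right[OF x, of v] linear_normal_part[OF x]]
        bounded_linear.linear[OF bounded_linear_inner_left[of U]]]
    by (simp only: o_def)
  then obtain q where q: "\<And>w. dd q f x \<bullet> dd w f x = ?h w"
    using riesz_tangent[OF x] by blast
  have "shape_op f x U (dd v f x) = dd q f x"
    unfolding shape_op_def
  proof (rule the_equality)
    fix Z assume "Z \<in> tangent_fibre f x \<and>
      (\<forall>Y\<in>tangent_fibre f x. Z \<bullet> Y = second_ff f x (dd v f x) Y \<bullet> U)"
    then obtain p where p: "Z = dd p f x" "\<And>w. dd p f x \<bullet> dd w f x = ?h w"
      unfolding mem_tangent_fibre by (metis mem_tangent_fibre second_ff_dd[OF x])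
    then have "(dd p f x - dd q f x) \<bullet> dd (p - q) f x = 0"
      using q by (simp add: inner_diff_left)
    then show "Z = dd q f x"
      by (simp add: p linear_diff[OF linear_dd_f[OF x]])
  qed (auto simp: mem_tangent_fibre second_ff_dd[OF x] q)
  then show ?thesis by (simp add: q)
qed

end
end

section \<open>Independence of the parametrization\<close>

text \<open>Convergence is tested componentwise because the mean value theorem supplies a different
  intermediate point for each component.\<close>

lemma tendsto_euclidean:
  fixes q :: "'a \<Rightarrow> 'v::euclidean_space"
  assumes "\<And>b. ((\<lambda>n. q n \<bullet> b) \<longlongrightarrow> l \<bullet> b) F"
  shows "(q \<longlongrightarrow> l) F"
proof -
  have "((\<lambda>n. \<Sum>b\<in>Basis. (q n \<bullet> b) *\<^sub>R b) \<longlongrightarrow> (\<Sum>b\<in>Basis. (l \<bullet> b) *\<^sub>R b)) F"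
    by (intro tendsto_intros assms)
  then show ?thesis by (simp add: euclidean_representation)
qed

context immersion
begin

context
  fixes x assumes x: "x \<in> W"
begin

lemma eventually_in_W:
  assumes "y \<longlonglongrightarrow> x"
  shows "\<forall>\<^sub>F n in sequentially. y n \<in> W"
  using topological_tendstoD[OF assms open_W x] .

text \<open>Base point and direction vary together. The axis expansion separates them into
  coefficients polynomial in the direction and finitely many second derivatives that are continuous
  in the point.\<close>

lemma tendsto_hess:
  assumes y: "y \<longlonglongrightarrow> x" and u: "u \<longlonglongrightarrow> v"
  shows "(\<lambda>n. dd (u n) (dd (u n) f) (y n)) \<longlonglongrightarrow> dd v (dd v f) x"
proof -
  have c: "(\<lambda>n. dd a (dd b f) (y n)) \<longlonglongrightarrow> dd a (dd b f) x" for a b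
    using continuous_on_eq_continuous_at[OF open_W] smooth_on_continuous[OF smooth_dd_dd] x
      isCont_tendsto_compose[OF _ y] by blast
  have "(\<lambda>n. \<Sum>i\<in>UNIV. \<Sum>j\<in>UNIV. (u n $ i * u n $ j) *\<^sub>R dd (axis i 1) (dd (axis j 1) f) (y n))
      \<longlonglongrightarrow> dd v (dd v f) x"
    unfolding hess_expansion[OF x, of v v] by (intro tendsto_intros u c)
  moreover have "\<forall>\<^sub>F n in sequentially.
      (\<Sum>i\<in>UNIV. \<Sum>j\<in>UNIV. (u n $ i * u n $ j) *\<^sub>R dd (axis i 1) (dd (axis j 1) f) (y n))
      = dd (u n) (dd (u n) f) (y n)"
    using eventually_in_W[OF y] by eventually_elim (simp add: hess_expansion)
  ultimately show ?thesis by (rule Lim_transform_eventually)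
qed

lemma tendsto_dd:
  assumes y: "y \<longlonglongrightarrow> x" and u: "u \<longlonglongrightarrow> v"
  shows "(\<lambda>n. dd (u n) f (y n)) \<longlonglongrightarrow> dd v f x"
proof -
  have c: "(\<lambda>n. dd a f (y n)) \<longlonglongrightarrow> dd a f x" for a
    using continuous_on_eq_continuous_at[OF open_W] smooth_on_continuous[OF smooth_dd] x
      isCont_tendsto_compose[OF _ y] by blast
  have "(\<lambda>n. \<Sum>i\<in>UNIV. u n $ i *\<^sub>R dd (axis i 1) f (y n)) \<longlonglongrightarrow> dd v f x"
    unfolding linear_axis_expansion[OF linear_dd_f[OF x], of v] by (intro tendsto_intros u c)
  moreover have "\<forall>\<^sub>F n in sequentially. (\<Sum>i\<in>UNIV. u n $ i *\<^sub>R dd (axis i 1) f (y n)) = dd (u n) f (y n)"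
    using eventually_in_W[OF y]
    by eventually_elim (rule linear_axis_expansion[OF linear_dd_f, symmetric])
  ultimately show ?thesis by (rule Lim_transform_eventually)
qed

lemma mean_value_segment:
  assumes seg: "\<And>s. s \<in> {0..1} \<Longrightarrow> x + s *\<^sub>R h \<in> W"
  shows "\<exists>s\<in>{0..1}. (f (x + h) - f x) \<bullet> c = dd h f (x + s *\<^sub>R h) \<bullet> c"
proof -
  have "\<exists>z>0. z < 1 \<and> f (x + 1 *\<^sub>R h) \<bullet> c - f (x + 0 *\<^sub>R h) \<bullet> c
      = (1 - 0) * (dd h f (x + z *\<^sub>R h) \<bullet> c)"
    by (rule MVT2) (auto intro!: DERIV_line diff_f seg)
  then obtain z where "0 < z" "z < 1" "(f (x + h) - f x) \<bullet> c = dd h f (x + z *\<^sub>R h) \<bullet> c"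
    by (auto simp: inner_diff_left)
  then show ?thesis by (intro bexI[of _ z]) auto
qed

lemma taylor_segment:
  assumes seg: "\<And>s. s \<in> {0..1} \<Longrightarrow> x + s *\<^sub>R h \<in> W"
  shows "\<exists>s\<in>{0..1}. (f (x + h) - f x) \<bullet> c
    = dd h f x \<bullet> c + (dd h (dd h f) (x + s *\<^sub>R h) \<bullet> c) / 2"
proof -
  let ?d = "\<lambda>(m::nat) s. if m = 0 then f (x + s *\<^sub>R h) \<bullet> c
    else if m = 1 then dd h f (x + s *\<^sub>R h) \<bullet> c else dd h (dd h f) (x + s *\<^sub>R h) \<bullet> c"
  have "\<exists>t. 0 < t \<and> t < 1 \<and> f (x + 1 *\<^sub>R h) \<bullet> c
      = (\<Sum>m<2. ?d m 0 / fact m * 1 ^ m) + ?d 2 t / fact 2 * 1 ^ 2"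
  proof (rule Maclaurin[where f = "\<lambda>s. f (x + s *\<^sub>R h) \<bullet> c"])
    show "\<forall>m t. m < 2 \<and> 0 \<le> t \<and> t \<le> 1 \<longrightarrow> (?d m has_real_derivative ?d (Suc m) t) (at t)"
    proof (intro allI impI)
      fix m :: nat and t :: real assume "m < 2 \<and> 0 \<le> t \<and> t \<le> 1"
      then have "m = 0 \<or> m = 1" "x + t *\<^sub>R h \<in> W" using seg by auto
      then show "(?d m has_real_derivative ?d (Suc m) t) (at t)"
        by (auto intro!: DERIV_line diff_f diff_dd)
    qed
  qed auto
  then obtain t where "0 < t" "t < 1"
    "(f (x + h) - f x) \<bullet> c = dd h f x \<bullet> c + (dd h (dd h f) (x + t *\<^sub>R h) \<bullet> c) / 2"
    by (auto simp: inner_diff_left numeral_2_eq_2)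
  then show ?thesis by (intro bexI[of _ t]) auto
qed

context
  fixes t :: "nat \<Rightarrow> real" and u :: "nat \<Rightarrow> real^'n" and v :: "real^'n"
  assumes t: "\<And>n. t n > 0" "t \<longlonglongrightarrow> 0" and u: "u \<longlonglongrightarrow> v"
begin

lemma segments_in_W:
  "\<forall>\<^sub>F n in sequentially. \<forall>s\<in>{0..1}. x + s *\<^sub>R t n *\<^sub>R u n \<in> W"
  and segment_points_tendsto: "(\<And>n. s n \<in> {0..1}) \<Longrightarrow> (\<lambda>n. x + s n *\<^sub>R t n *\<^sub>R u n) \<longlonglongrightarrow> x"
proof -
  have h: "(\<lambda>n. t n *\<^sub>R u n) \<longlonglongrightarrow> 0"
    using tendsto_scaleR[OF t(2) u] by simp
  obtain r where r: "r > 0" "ball x r \<subseteq> W"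
    using open_W x open_contains_ball by blast
  have bound: "norm (s *\<^sub>R h) \<le> norm h" if "s \<in> {0..1}" for s and h :: "real^'n"
    using that mult_right_mono[of s 1 "norm h"] by simp
  have "\<forall>\<^sub>F n in sequentially. norm (t n *\<^sub>R u n) < r"
    using tendstoD[OF h r(1)] by (simp add: dist_norm)
  then show "\<forall>\<^sub>F n in sequentially. \<forall>s\<in>{0..1}. x + s *\<^sub>R t n *\<^sub>R u n \<in> W"
  proof eventually_elim
    case (elim n)
    show ?case
    proof
      fix s :: real assume "s \<in> {0..1}"
      from bound[OF this, of "t n *\<^sub>R u n"] elim have "x + s *\<^sub>R t n *\<^sub>R u n \<in> ball x r"
        by (simp add: dist_norm del: norm_scaleR)
      with r show "x + s *\<^sub>R t n *\<^sub>R u n \<in> W" by blast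
    qed
  qed
  show "(\<lambda>n. x + s n *\<^sub>R t n *\<^sub>R u n) \<longlonglongrightarrow> x" if s: "\<And>n. s n \<in> {0..1}" for s
  proof -
    have "(\<lambda>n. s n *\<^sub>R t n *\<^sub>R u n) \<longlonglongrightarrow> 0"
      by (rule Lim_null_comparison[OF _ tendsto_norm_zero[OF h]]) (intro always_eventually allI bound s)
    from tendsto_add[OF tendsto_const[of x] this] show ?thesis by simp
  qed
qed

lemma difference_quotient_tendsto:
  "(\<lambda>n. (1 / t n) *\<^sub>R (f (x + t n *\<^sub>R u n) - f x)) \<longlonglongrightarrow> dd v f x"
proof (rule tendsto_euclidean)
  fix c
  let ?h = "\<lambda>n. t n *\<^sub>R u n"
  \<comment> \<open>The implication stands inside the existential so that \<open>s n\<close> can be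
    chosen in \<open>{0..1}\<close> for every \<open>n\<close>, including the finitely many
    \<open>n\<close> whose segment may leave \<open>W\<close>.\<close>
  have "\<forall>n. \<exists>s\<in>{0..1}. (\<forall>s\<in>{0..1}. x + s *\<^sub>R ?h n \<in> W) \<longrightarrow>
      (f (x + ?h n) - f x) \<bullet> c = dd (?h n) f (x + s *\<^sub>R ?h n) \<bullet> c"
    using mean_value_segment by (metis atLeastAtMost_iff order_refl zero_le_one)
  then obtain s where s: "\<And>n. s n \<in> {0..1}" and
    eq: "\<And>n. \<forall>s\<in>{0..1}. x + s *\<^sub>R ?h n \<in> W \<Longrightarrow>
      (f (x + ?h n) - f x) \<bullet> c = dd (?h n) f (x + s n *\<^sub>R ?h n) \<bullet> c"
    by metis
  have "(\<lambda>n. dd (u n) f (x + s n *\<^sub>R ?h n) \<bullet> c) \<longlonglongrightarrow> dd v f x \<bullet> c"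
    by (intro tendsto_intros tendsto_dd segment_points_tendsto s u)
  moreover have "\<forall>\<^sub>F n in sequentially. dd (u n) f (x + s n *\<^sub>R ?h n) \<bullet> c
      = ((1 / t n) *\<^sub>R (f (x + ?h n) - f x)) \<bullet> c"
    using segments_in_W
  proof eventually_elim
    case (elim n)
    have "x + s n *\<^sub>R ?h n \<in> W" using elim s by blast
    then have "dd (?h n) f (x + s n *\<^sub>R ?h n) = t n *\<^sub>R dd (u n) f (x + s n *\<^sub>R ?h n)"
      by (rule linear_cmul[OF linear_dd_f])
    then show ?case using eq[OF elim] t(1)[of n] by simp
  qed
  ultimately show "(\<lambda>n. ((1 / t n) *\<^sub>R (f (x + ?h n) - f x)) \<bullet> c) \<longlonglongrightarrow> dd v f x \<bullet> c"
    by (rule Lim_transform_eventually)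
qed

text \<open>Pairing with a normal vector kills the first-order Taylor term. That term, divided by
  the square of \<open>t n\<close>, would depend on how fast \<open>u n\<close> approaches
  \<open>v\<close>; without it only the limit direction matters, and this is what makes the limit
  comparable between parametrizations.\<close>

lemma second_difference_quotient_tendsto:
  assumes c: "c \<in> normal_fibre f x"
  shows "(\<lambda>n. ((f (x + t n *\<^sub>R u n) - f x) \<bullet> c) / (t n)\<^sup>2) \<longlonglongrightarrow> (dd v (dd v f) x \<bullet> c) / 2"
proof -
  let ?h = "\<lambda>n. t n *\<^sub>R u n"
  have c0: "dd w f x \<bullet> c = 0" for w using c by (simp add: mem_normal_fibre inner_commute)
  have "\<forall>n. \<exists>s\<in>{0..1}. (\<forall>s\<in>{0..1}. x + s *\<^sub>R ?h n \<in> W) \<longrightarrow>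
      (f (x + ?h n) - f x) \<bullet> c = (dd (?h n) (dd (?h n) f) (x + s *\<^sub>R ?h n) \<bullet> c) / 2"
    using taylor_segment[where c = c] unfolding c0 add_0
    by (metis atLeastAtMost_iff order_refl zero_le_one)
  then obtain s where s: "\<And>n. s n \<in> {0..1}" and
    eq: "\<And>n. \<forall>s\<in>{0..1}. x + s *\<^sub>R ?h n \<in> W \<Longrightarrow>
      (f (x + ?h n) - f x) \<bullet> c = (dd (?h n) (dd (?h n) f) (x + s n *\<^sub>R ?h n) \<bullet> c) / 2"
    by metis
  have "(\<lambda>n. (dd (u n) (dd (u n) f) (x + s n *\<^sub>R ?h n) \<bullet> c) / 2) \<longlonglongrightarrow> (dd v (dd v f) x \<bullet> c) / 2"
    by (intro tendsto_intros tendsto_hess segment_points_tendsto s u) simp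
  moreover have "\<forall>\<^sub>F n in sequentially. (dd (u n) (dd (u n) f) (x + s n *\<^sub>R ?h n) \<bullet> c) / 2
      = ((f (x + ?h n) - f x) \<bullet> c) / (t n)\<^sup>2"
    using segments_in_W
  proof eventually_elim
    case (elim n)
    have W: "x + s n *\<^sub>R ?h n \<in> W" using elim s by blast
    have "dd (?h n) (dd (?h n) f) (x + s n *\<^sub>R ?h n) = t n *\<^sub>R t n *\<^sub>R dd (u n) (dd (u n) f) (x + s n *\<^sub>R ?h n)"
      by (simp only: linear_cmul[OF linear_hess_left[OF W]] linear_cmul[OF linear_hess_right[OF W]])
    then show ?case using eq[OF elim] t(1)[of n] by (simp add: power2_eq_square)
  qed
  ultimately show ?thesis by (rule Lim_transform_eventually)
qed

end

text \<open>An injective linear derivative is bounded below, and close to \<open>x\<close> the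
  remainder uses up at most half of that bound. This controls the size of the directions obtained by
  pulling back a curve through another chart.\<close>

lemma lower_bound:
  obtains B d where "B > 0" "d > 0" "\<And>z. norm (z - x) < d \<Longrightarrow> B * norm (z - x) \<le> norm (f z - f x)"
proof -
  obtain B where B: "B > 0" "\<And>w. B * norm w \<le> norm (dd w f x)"
    using linear_inj_bounded_below_pos[OF linear_dd_f[OF x] inj_deriv[OF x]] by metis
  obtain d where d: "d > 0"
    "\<And>z. norm (z - x) < d \<Longrightarrow> norm (f z - f x - dd (z - x) f x) \<le> B / 2 * norm (z - x)"
    using has_derivative_dd[OF diff_f[OF x]] half_gt_zero[OF B(1)] unfolding has_derivative_at_alt by blast
  have "B / 2 * norm (z - x) \<le> norm (f z - f x)" if "norm (z - x) < d" for z
  proof -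
    have "norm (dd (z - x) f x) \<le> norm (f z - f x) + norm (f z - f x - dd (z - x) f x)"
      using norm_triangle_ineq4[of "f z - f x" "f z - f x - dd (z - x) f x"] by simp
    then show ?thesis using B(2)[of "z - x"] d(2)[OF that] by simp
  qed
  with B(1) d(1) that[of "B / 2" d] show thesis by simp
qed

end

lemma dim_tangent: "x \<in> W \<Longrightarrow> dim (tangent_fibre f x) = CARD('n)"
  unfolding tangent_fibre_def
  using dim_image_eq[OF linear_dd_f, of x UNIV] inj_deriv[of x] by simp

end

text \<open>
  The tangent space and the second fundamental form do not depend on the parametrization. The
  difference quotients of \<open>g\<close> in direction \<open>v\<close> are difference quotients of \<open>f\<close> along the bounded
  directions \<open>(\<tau> (x' + t v) - x) / t\<close>, so a limit point of these has the same first derivative and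
  the same normal second derivative; no differentiability of \<open>\<tau>\<close> is needed.
\<close>

locale reparametrization = f: immersion W f + g: immersion W' g
  for W :: "(real^'n::finite) set" and f :: "real^'n \<Rightarrow> 'v::euclidean_space"
    and W' :: "(real^'n) set" and g :: "real^'n \<Rightarrow> 'v" +
  fixes x x' :: "real^'n" and \<tau> :: "real^'n \<Rightarrow> real^'n"
  assumes x: "x \<in> W" and x': "x' \<in> W'"
    and \<tau>_cont: "isCont \<tau> x'" and \<tau>_x': "\<tau> x' = x"
    and \<tau>_eq: "\<forall>\<^sub>F y in nhds x'. f (\<tau> y) = g y"
begin

lemma direction_exists:
  obtains u where "dd u f x = dd v g x'"
    "\<And>c. c \<in> normal_fibre f x \<Longrightarrow> c \<in> normal_fibre g x' \<Longrightarrow>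
      dd u (dd u f) x \<bullet> c = dd v (dd v g) x' \<bullet> c"
proof -
  define t where "t = (\<lambda>n. inverse (real (Suc n)))"
  have t: "t n > 0" "t \<longlonglongrightarrow> 0" for n
    unfolding t_def by (simp, rule LIMSEQ_inverse_real_of_nat)
  define y where "y n = x' + t n *\<^sub>R v" for n
  have y: "y \<longlonglongrightarrow> x'"
    unfolding y_def using tendsto_add[OF tendsto_const tendsto_scaleR[OF t(2) tendsto_const]] by force
  define u where "u n = (1 / t n) *\<^sub>R (\<tau> (y n) - x)" for n
  have \<tau>u: "\<tau> (y n) = x + t n *\<^sub>R u n" for n
    using t(1)[of n] by (simp add: u_def)
  have \<tau>y: "(\<lambda>n. \<tau> (y n)) \<longlonglongrightarrow> x"
    using isCont_tendsto_compose[OF \<tau>_cont y] \<tau>_x' by simp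
  have gx: "g x' = f x"
    using eventually_nhds_x_imp_x[OF \<tau>_eq] \<tau>_x' by simp
  have ev: "\<forall>\<^sub>F n in sequentially. f (x + t n *\<^sub>R u n) = g (x' + t n *\<^sub>R v)"
  proof -
    have "\<forall>\<^sub>F n in sequentially. f (x + t n *\<^sub>R u n) = g (y n)"
      using eventually_compose_filterlim[OF \<tau>_eq y] unfolding \<tau>u .
    then show ?thesis unfolding y_def .
  qed
  let ?q = "\<lambda>n. (1 / t n) *\<^sub>R (g (x' + t n *\<^sub>R v) - g x')"
  have q: "?q \<longlonglongrightarrow> dd v g x'"
    by (rule g.difference_quotient_tendsto[OF x' t tendsto_const])
  obtain B d where B: "B > 0" "d > 0" "\<And>z. norm (z - x) < d \<Longrightarrow> B * norm (z - x) \<le> norm (f z - f x)"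
    using f.lower_bound[OF x] by metis
  have "\<forall>\<^sub>F n in sequentially. norm (\<tau> (y n) - x) < d"
    using tendstoD[OF \<tau>y B(2)] by (simp add: dist_norm)
  moreover have "\<forall>\<^sub>F n in sequentially. norm (?q n) < norm (dd v g x') + 1"
    by (rule order_tendstoD(2)[OF tendsto_norm[OF q]]) simp
  ultimately have "\<forall>\<^sub>F n in sequentially. norm (u n) \<le> (norm (dd v g x') + 1) / B"
    using ev
  proof eventually_elim
    case (elim n)
    \<comment> \<open>\<open>f\<close> and \<open>g\<close> agree at the corresponding points, so
      the lower bound for \<open>f\<close> turns into an upper bound on \<open>u n\<close> by a
      difference quotient of \<open>g\<close>, which converges.\<close>
    have "B * (t n * norm (u n)) \<le> norm (g (x' + t n *\<^sub>R v) - g x')"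
      using B(3)[OF elim(1)] t(1)[of n] unfolding \<tau>u elim(3) gx by simp
    then have "B * norm (u n) \<le> norm (g (x' + t n *\<^sub>R v) - g x') / t n"
      using t(1)[of n] by (simp add: field_simps)
    also have "\<dots> = norm (?q n)"
      using t(1)[of n] by (simp only: norm_scaleR) simp
    finally have "B * norm (u n) \<le> norm (?q n)" .
    with elim(2) show ?case using B(1) by (simp add: field_simps)
  qed
  then have "bounded (range u)"
    unfolding Bseq_eq_bounded[symmetric] by (rule BfunI)
  then obtain l r where r: "strict_mono (r :: nat \<Rightarrow> nat)" and l: "(u \<circ> r) \<longlonglongrightarrow> l"
    using bounded_imp_convergent_subsequence by blast
  have tr: "(t \<circ> r) n > 0" "(t \<circ> r) \<longlonglongrightarrow> 0" for n
    using t LIMSEQ_subseq_LIMSEQ[OF t(2) r] by auto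
  have evr: "\<forall>\<^sub>F n in sequentially. f (x + (t \<circ> r) n *\<^sub>R (u \<circ> r) n) = g (x' + (t \<circ> r) n *\<^sub>R v)"
    using eventually_subseq[OF r ev] by simp
  have "(\<lambda>n. (1 / (t \<circ> r) n) *\<^sub>R (g (x' + (t \<circ> r) n *\<^sub>R v) - g x')) \<longlonglongrightarrow> dd l f x"
    by (rule Lim_transform_eventually[OF f.difference_quotient_tendsto[OF x tr l]])
      (use evr in eventually_elim, simp add: gx)
  moreover have "(\<lambda>n. (1 / (t \<circ> r) n) *\<^sub>R (g (x' + (t \<circ> r) n *\<^sub>R v) - g x')) \<longlonglongrightarrow> dd v g x'"
    by (rule g.difference_quotient_tendsto[OF x' tr tendsto_const])
  ultimately have 1: "dd l f x = dd v g x'"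
    using LIMSEQ_unique by blast
  have 2: "dd l (dd l f) x \<bullet> c = dd v (dd v g) x' \<bullet> c"
    if c: "c \<in> normal_fibre f x" "c \<in> normal_fibre g x'" for c
  proof -
    have "(\<lambda>n. ((g (x' + (t \<circ> r) n *\<^sub>R v) - g x') \<bullet> c) / ((t \<circ> r) n)\<^sup>2) \<longlonglongrightarrow> (dd l (dd l f) x \<bullet> c) / 2"
      by (rule Lim_transform_eventually[OF f.second_difference_quotient_tendsto[OF x tr l c(1)]])
        (use evr in eventually_elim, simp add: gx)
    moreover have "(\<lambda>n. ((g (x' + (t \<circ> r) n *\<^sub>R v) - g x') \<bullet> c) / ((t \<circ> r) n)\<^sup>2)
        \<longlonglongrightarrow> (dd v (dd v g) x' \<bullet> c) / 2"
      by (rule g.second_difference_quotient_tendsto[OF x' tr tendsto_const c(2)])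
    ultimately have "(dd l (dd l f) x \<bullet> c) / 2 = (dd v (dd v g) x' \<bullet> c) / 2"
      by (rule LIMSEQ_unique)
    then show ?thesis by simp
  qed
  from 1 2 that show thesis by blast
qed

text \<open>One inclusion comes from \<open>direction_exists\<close>; the other follows since both
  tangent spaces have the dimension of the parameter space.\<close>

lemma tangent_fibre_eq: "tangent_fibre g x' = tangent_fibre f x"
proof -
  have "tangent_fibre g x' \<subseteq> tangent_fibre f x"
    using direction_exists by (metis mem_tangent_fibre subsetI)
  then show ?thesis
    using f.subspace_tangent[OF x] g.subspace_tangent[OF x'] f.dim_tangent[OF x] g.dim_tangent[OF x']
    by (intro subspace_dim_equal) auto
qed

lemma normal_fibre_eq: "normal_fibre g x' = normal_fibre f x"
  by (simp add: normal_fibre_def tangent_fibre_eq)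

lemma normal_part_eq: "normal_part g x' y = normal_part f x y"
  by (simp add: normal_part_def tangent_fibre_eq normal_fibre_eq)

text \<open>\<open>direction_exists\<close> compares only the quadratic form of the second
  derivative. Injectivity of the derivative makes the matching direction unique, hence additive in
  the tangent vector, and polarization then yields the bilinear form.\<close>

lemma second_ff_eq:
  assumes "X \<in> tangent_fibre f x" "Y \<in> tangent_fibre f x"
  shows "second_ff g x' X Y = second_ff f x X Y"
proof -
  have quad: "dd u (dd u f) x \<bullet> c = dd v (dd v g) x' \<bullet> c"
    if "dd u f x = dd v g x'" "c \<in> normal_fibre f x" for u v c
    using direction_exists[of v] that by (metis f.dd_f_inject[OF x] normal_fibre_eq)
  obtain v w where v: "X = dd v g x'" and w: "Y = dd w g x'"
    using assms tangent_fibre_eq mem_tangent_fibre by metis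
  obtain a b where a: "X = dd a f x" and b: "Y = dd b f x"
    using assms mem_tangent_fibre by metis
  have ab: "dd (a + b) f x = dd (v + w) g x'"
    using a b v w by (simp add: linear_add[OF f.linear_dd_f[OF x]] linear_add[OF g.linear_dd_f[OF x']])
  have pol: "dd (a + b) (dd (a + b) f) x = dd a (dd a f) x + 2 *\<^sub>R dd a (dd b f) x + dd b (dd b f) x"
    using f.hess_commute[OF x, of b a]
    by (simp only: linear_add[OF f.linear_hess_left[OF x]] linear_add[OF f.linear_hess_right[OF x]])
      (simp add: scaleR_2)
  have pol': "dd (v + w) (dd (v + w) g) x' = dd v (dd v g) x' + 2 *\<^sub>R dd v (dd w g) x' + dd w (dd w g) x'"
    using g.hess_commute[OF x', of w v]
    by (simp only: linear_add[OF g.linear_hess_left[OF x']] linear_add[OF g.linear_hess_right[OF x']])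
      (simp add: scaleR_2)
  have "dd a (dd b f) x \<bullet> c = dd v (dd w g) x' \<bullet> c" if c: "c \<in> normal_fibre f x" for c
    using quad[OF ab c] quad[of a v, OF _ c] quad[of b w, OF _ c] a b v w
    by (simp add: pol pol' inner_add_left)
  then have "(dd a (dd b f) x - dd v (dd w g) x') \<bullet> normal_part f x (dd a (dd b f) x - dd v (dd w g) x') = 0"
    using f.normal_part_decomp(1)[OF x] by (simp add: inner_diff_left)
  then have "normal_part f x (dd a (dd b f) x - dd v (dd w g) x')
      \<bullet> normal_part f x (dd a (dd b f) x - dd v (dd w g) x') = 0"
    unfolding f.normal_part_inner_normal_part[OF x] by (simp only: inner_commute)
  then have "normal_part f x (dd a (dd b f) x - dd v (dd w g) x') = 0"
    by (simp only: inner_eq_zero_iff)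
  then show ?thesis
    unfolding v w g.second_ff_dd[OF x'] unfolding v[symmetric] w[symmetric] unfolding a b f.second_ff_dd[OF x]
    by (simp add: normal_part_eq linear_diff[OF f.linear_normal_part[OF x]])
qed

lemma shape_op_eq:
  assumes "X \<in> tangent_fibre f x"
  shows "shape_op g x' U X = shape_op f x U X"
  unfolding shape_op_def tangent_fibre_eq using second_ff_eq[OF assms] by (metis (no_types, lifting))

end

section \<open>Transition maps between charts\<close>

lemma local_param_immersion: "local_param M \<phi> W \<sigma> \<Longrightarrow> immersion W (\<phi> \<circ> \<sigma>)"
  by unfold_locales (auto simp: local_param_def)

lemma local_param_reparametrization:
  assumes p: "local_param M \<phi> W \<sigma>" and p': "local_param M \<phi> W' \<sigma>'"
    and x: "x \<in> W" and x': "x' \<in> W'" and eq: "\<sigma> x = \<sigma>' x'"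
  shows "reparametrization W (\<phi> \<circ> \<sigma>) W' (\<phi> \<circ> \<sigma>') x x' (\<lambda>y. inv_into W \<sigma> (\<sigma>' y))"
proof -
  have oW: "open W" "open W'" and op: "openin M (\<sigma> ` W)"
    and h: "homeomorphic_map (top_of_set W) (subtopology M (\<sigma> ` W)) \<sigma>"
    and h': "homeomorphic_map (top_of_set W') (subtopology M (\<sigma>' ` W')) \<sigma>'"
    using p p' by (auto simp: local_param_def embedding_map_def)
  have inj: "inj_on \<sigma> W" using homeomorphic_imp_injective_map[OF h] by simp
  have cont: "continuous_map (top_of_set W') M \<sigma>'"
    using homeomorphic_imp_continuous_map[OF h'] continuous_map_in_subtopology by blast
  \<comment> \<open>\<open>\<sigma>\<close> maps open subsets of \<open>W\<close> to sets open in
    \<open>M\<close>, and \<open>\<sigma>'\<close> pulls these back to open sets. An arbitrary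
    \<open>S\<close> gives continuity of the transition map; \<open>S = UNIV\<close> gives a
    neighbourhood on which the two parametrizations correspond.\<close>
  have near: "\<exists>T. open T \<and> x' \<in> T \<and> T \<subseteq> W' \<and> \<sigma>' ` T \<subseteq> \<sigma> ` (W \<inter> S)" if S: "open S" "x \<in> S" for S
  proof -
    have "openin (subtopology M (\<sigma> ` W)) (\<sigma> ` (W \<inter> S))"
      using homeomorphic_imp_open_map[OF h] S(1) by (auto simp: open_map_def)
    then have "openin M (\<sigma> ` (W \<inter> S))"
      using openin_open_subtopology[OF op] by blast
    then have "openin (top_of_set W') {y \<in> W'. \<sigma>' y \<in> \<sigma> ` (W \<inter> S)}"
      using cont by (auto simp: continuous_map_def)
    then have "open {y \<in> W'. \<sigma>' y \<in> \<sigma> ` (W \<inter> S)}"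
      using oW(2) openin_open_eq by blast
    moreover have "\<sigma>' x' \<in> \<sigma> ` (W \<inter> S)" using x eq S(2) by (metis IntI image_eqI)
    ultimately show ?thesis
      using x' by (intro exI[of _ "{y \<in> W'. \<sigma>' y \<in> \<sigma> ` (W \<inter> S)}"]) auto
  qed
  let ?\<tau> = "\<lambda>y. inv_into W \<sigma> (\<sigma>' y)"
  have \<tau>x: "?\<tau> x' = x" using eq x inj by (metis inv_into_f_f)
  show ?thesis
  proof (intro reparametrization.intro reparametrization_axioms.intro local_param_immersion[OF p]
      local_param_immersion[OF p'] x x' \<tau>x)
    show "isCont ?\<tau> x'"
      unfolding continuous_at_open
    proof (intro allI impI)
      fix S assume "open S \<and> ?\<tau> x' \<in> S"
      then have S: "open S" "x \<in> S" unfolding \<tau>x by blast+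
      from near[OF S] obtain T where T: "open T" "x' \<in> T" "\<sigma>' ` T \<subseteq> \<sigma> ` (W \<inter> S)" by blast
      have "?\<tau> y \<in> S" if "y \<in> T" for y
      proof -
        have "\<sigma>' y \<in> \<sigma> ` (W \<inter> S)" using subsetD[OF T(3) imageI[OF that]] .
        then obtain z where "\<sigma>' y = \<sigma> z" "z \<in> W \<inter> S" by (rule imageE)
        then show ?thesis using inv_into_f_f[OF inj, of z] by simp
      qed
      with T(1,2) show "\<exists>T. open T \<and> x' \<in> T \<and> (\<forall>y\<in>T. ?\<tau> y \<in> S)" by (intro exI[of _ T]) simp
    qed
    from near[OF open_UNIV UNIV_I]
    obtain T where T: "open T" "x' \<in> T" "\<sigma>' ` T \<subseteq> \<sigma> ` (W \<inter> UNIV)" by blast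
    show "\<forall>\<^sub>F y in nhds x'. (\<phi> \<circ> \<sigma>) (?\<tau> y) = (\<phi> \<circ> \<sigma>') y"
      unfolding eventually_nhds
    proof (intro exI[of _ T] conjI ballI)
      fix y assume "y \<in> T"
      then have "\<sigma>' y \<in> \<sigma> ` W" using T(3) by auto
      from f_inv_into_f[OF this] show "(\<phi> \<circ> \<sigma>) (?\<tau> y) = (\<phi> \<circ> \<sigma>') y" by simp
    qed (use T in auto)
  qed
qed

section \<open>Orthonormal bases\<close>

lemma onb_inner:
  assumes "orthonormal_basis n e S" "i \<in> {1..n}" "j \<in> {1..n}"
  shows "e i \<bullet> e j = (if i = j then 1 else 0)"
  using assms by (simp add: orthonormal_basis_def)

lemma onb_mem:
  assumes "orthonormal_basis n e S" "i \<in> {1..n}"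
  shows "e i \<in> S"
  using assms span_base[of "e i" "e ` {1..n}"] unfolding orthonormal_basis_def by blast

lemma onb_subspace: "orthonormal_basis n e S \<Longrightarrow> subspace S"
  by (auto simp: orthonormal_basis_def)

lemma orthonormal_independent:
  assumes "\<And>i j. i \<in> {1..n} \<Longrightarrow> j \<in> {1..n} \<Longrightarrow> e i \<bullet> e j = (if i = j then 1 else 0)"
  shows "independent (e ` {1..n})" "card (e ` {1..n}) = n"
proof -
  have inj: "inj_on e {1..n}"
    using assms by (metis inj_onI zero_neq_one)
  then show "card (e ` {1..n}) = n" by (simp add: card_image)
  have "0 \<notin> e ` {1..n}"
    using assms by (metis imageE inner_zero_left zero_neq_one)
  moreover have "pairwise orthogonal (e ` {1..n})"
    using assms by (auto simp: pairwise_def orthogonal_def)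
  ultimately show "independent (e ` {1..n})"
    using pairwise_orthogonal_independent by blast
qed

lemma onb_dim: "orthonormal_basis n e S \<Longrightarrow> dim S = n"
  using orthonormal_independent[of n e] dim_span_eq_card_independent[of "e ` {1..n}"]
  by (auto simp: orthonormal_basis_def)

lemma onbI:
  assumes "\<And>i j. i \<in> {1..n} \<Longrightarrow> j \<in> {1..n} \<Longrightarrow> e i \<bullet> e j = (if i = j then 1 else 0)"
    and "\<And>i. i \<in> {1..n} \<Longrightarrow> e i \<in> S" and "subspace S" and "dim S = n"
  shows "orthonormal_basis n e S"
proof -
  have "span (e ` {1..n}) \<subseteq> S"
    using assms(2,3) by (intro span_minimal) auto
  moreover have "dim (span (e ` {1..n})) = n"
    using orthonormal_independent[OF assms(1)] dim_span_eq_card_independent[of "e ` {1..n}"] by simp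
  ultimately have "span (e ` {1..n}) = S"
    using assms(3,4) by (intro subspace_dim_equal) auto
  with assms(1) show ?thesis by (simp add: orthonormal_basis_def)
qed

lemma onb_expansion:
  assumes "orthonormal_basis n e S" "X \<in> S"
  shows "X = (\<Sum>i\<in>{1..n}. (X \<bullet> e i) *\<^sub>R e i)"
proof -
  let ?Y = "X - (\<Sum>i\<in>{1..n}. (X \<bullet> e i) *\<^sub>R e i)"
  have "?Y \<bullet> e j = 0" if j: "j \<in> {1..n}" for j
  proof -
    have "(\<Sum>i\<in>{1..n}. (X \<bullet> e i) *\<^sub>R e i) \<bullet> e j = (\<Sum>i\<in>{1..n}. if i = j then X \<bullet> e j else 0)"
      unfolding inner_sum_left by (rule sum.cong) (use onb_inner[OF assms(1) _ j] in auto)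
    then show ?thesis using j by (simp add: inner_diff_left)
  qed
  then have "orthogonal ?Y y" if "y \<in> e ` {1..n}" for y
    using that by (auto simp: orthogonal_def)
  then have "orthogonal ?Y y" if "y \<in> span (e ` {1..n})" for y
    using that orthogonal_to_span by blast
  moreover have "?Y \<in> S"
    using onb_mem[OF assms(1)] onb_subspace[OF assms(1)] assms(2)
    by (intro subspace_diff subspace_sum subspace_mul) auto
  ultimately have "?Y = 0"
    using assms(1) unfolding orthonormal_basis_def by (metis orthogonal_self)
  then show ?thesis by (simp only: right_minus_eq)
qed

lemma onb_inner_sum:
  assumes "orthonormal_basis n e S" "X \<in> S"
  shows "X \<bullet> Y = (\<Sum>i\<in>{1..n}. (X \<bullet> e i) * (Y \<bullet> e i))"
proof -
  have "X \<bullet> Y = (\<Sum>i\<in>{1..n}. (X \<bullet> e i) *\<^sub>R e i) \<bullet> Y"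
    by (rule arg_cong[OF onb_expansion[OF assms]])
  also have "\<dots> = (\<Sum>i\<in>{1..n}. (X \<bullet> e i) * (Y \<bullet> e i))"
    unfolding inner_sum_left inner_scaleR_left inner_commute[of Y] ..
  finally show ?thesis .
qed

lemma onb_permute:
  assumes "orthonormal_basis n e S" "bij_betw p {1..n} {1..n}"
  shows "orthonormal_basis n (\<lambda>i. e (p i)) S"
proof -
  have p: "inj_on p {1..n}" "p ` {1..n} = {1..n}"
    using assms(2) by (auto simp: bij_betw_def)
  have "e (p i) \<bullet> e (p j) = (if i = j then 1 else 0)" if "i \<in> {1..n}" "j \<in> {1..n}" for i j
  proof -
    have "p i \<in> {1..n}" "p j \<in> {1..n}" using that p(2) by blast+
    from onb_inner[OF assms(1) this] show ?thesis
      by (simp only: inj_on_eq_iff[OF p(1) that])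
  qed
  moreover have "(\<lambda>i. e (p i)) ` {1..n} = e ` {1..n}"
    using p(2) by (metis image_image)
  ultimately show ?thesis
    using assms(1) unfolding orthonormal_basis_def by simp
qed

text \<open>The change of basis matrix is orthogonal. Values in a vector space are allowed so that
  the trace of the second fundamental form is covered along with real-valued forms.\<close>

lemma onb_trace:
  fixes B :: "'v::euclidean_space \<Rightarrow> 'v \<Rightarrow> 'b::real_vector"
  assumes B: "\<And>y. linear (\<lambda>x. B x y)" "\<And>x. linear (B x)"
    and e: "orthonormal_basis n e S" and e': "orthonormal_basis n e' S"
  shows "(\<Sum>i\<in>{1..n}. B (e i) (e i)) = (\<Sum>i\<in>{1..n}. B (e' i) (e' i))"
proof -
  have "B (e i) (e i) = (\<Sum>j\<in>{1..n}. \<Sum>k\<in>{1..n}. ((e i \<bullet> e' j) * (e i \<bullet> e' k)) *\<^sub>R B (e' j) (e' k))"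
    if i: "i \<in> {1..n}" for i
  proof -
    let ?E = "\<Sum>j\<in>{1..n}. (e i \<bullet> e' j) *\<^sub>R e' j"
    have "B (e i) (e i) = B ?E ?E"
      by (intro arg_cong2[of _ _ _ _ B] onb_expansion[OF e' onb_mem[OF e i]])
    also have "\<dots> = (\<Sum>j\<in>{1..n}. (e i \<bullet> e' j) *\<^sub>R B (e' j) ?E)"
      by (simp only: linear_sum[OF B(1)] linear_cmul[OF B(1)])
    also have "\<dots> = (\<Sum>j\<in>{1..n}. \<Sum>k\<in>{1..n}. ((e i \<bullet> e' j) * (e i \<bullet> e' k)) *\<^sub>R B (e' j) (e' k))"
      by (simp only: linear_sum[OF B(2)] linear_cmul[OF B(2)] scaleR_sum_right scaleR_scaleR)
    finally show ?thesis .
  qed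
  then have "(\<Sum>i\<in>{1..n}. B (e i) (e i)) =
      (\<Sum>i\<in>{1..n}. \<Sum>j\<in>{1..n}. \<Sum>k\<in>{1..n}. ((e i \<bullet> e' j) * (e i \<bullet> e' k)) *\<^sub>R B (e' j) (e' k))"
    by (rule sum.cong[OF refl])
  also have "\<dots> = (\<Sum>j\<in>{1..n}. \<Sum>i\<in>{1..n}. \<Sum>k\<in>{1..n}. ((e i \<bullet> e' j) * (e i \<bullet> e' k)) *\<^sub>R B (e' j) (e' k))"
    by (rule sum.swap)
  also have "\<dots> = (\<Sum>j\<in>{1..n}. B (e' j) (e' j))"
  proof (rule sum.cong[OF refl])
    fix j assume j: "j \<in> {1..n}"
    \<comment> \<open>By Parseval in the frame \<open>e\<close>, the sum over \<open>i\<close> is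
      the inner product of \<open>e' j\<close> and \<open>e' k\<close>.\<close>
    have "(\<Sum>i\<in>{1..n}. \<Sum>k\<in>{1..n}. ((e i \<bullet> e' j) * (e i \<bullet> e' k)) *\<^sub>R B (e' j) (e' k))
      = (\<Sum>k\<in>{1..n}. (\<Sum>i\<in>{1..n}. (e' j \<bullet> e i) * (e' k \<bullet> e i)) *\<^sub>R B (e' j) (e' k))"
      by (subst sum.swap) (simp add: scaleR_sum_left inner_commute)
    also have "\<dots> = (\<Sum>k\<in>{1..n}. if k = j then B (e' j) (e' j) else 0)"
      by (intro sum.cong refl, subst onb_inner_sum[OF e onb_mem[OF e' j], symmetric])
        (auto simp: onb_inner[OF e' j])
    finally show "(\<Sum>i\<in>{1..n}. \<Sum>k\<in>{1..n}. ((e i \<bullet> e' j) * (e i \<bullet> e' k)) *\<^sub>R B (e' j) (e' k))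
      = B (e' j) (e' j)" using j by simp
  qed
  finally show ?thesis .
qed

lemma onb_sum_squares:
  fixes h :: "'v::euclidean_space \<Rightarrow> real"
  assumes "linear h" "orthonormal_basis n e S" "orthonormal_basis n e' S"
  shows "(\<Sum>i\<in>{1..n}. (h (e i))\<^sup>2) = (\<Sum>i\<in>{1..n}. (h (e' i))\<^sup>2)"
proof -
  have "linear (\<lambda>x. h x * c)" "linear (\<lambda>x. c * h x)" for c
    using linear_compose[OF assms(1), of "\<lambda>t. t * c"] linear_compose[OF assms(1), of "\<lambda>t. c * t"]
    by (simp_all add: o_def linear_times linear_iff algebra_simps)
  from onb_trace[of "\<lambda>x y. h x * h y", OF this assms(2,3)] show ?thesis
    by (simp add: power2_eq_square)
qed

text \<open>The frame is exchanged in one slot at a time, each time as the trace of the square of a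
  linear form.\<close>

lemma onb_sum_squares2:
  fixes Q :: "'v::euclidean_space \<Rightarrow> 'v \<Rightarrow> real"
  assumes Q: "\<And>y. linear (\<lambda>x. Q x y)" "\<And>x. linear (Q x)"
    and e: "orthonormal_basis n e S" "orthonormal_basis n e' S"
  shows "(\<Sum>i\<in>{1..n}. \<Sum>j\<in>{1..n}. (Q (e i) (e j))\<^sup>2) = (\<Sum>i\<in>{1..n}. \<Sum>j\<in>{1..n}. (Q (e' i) (e' j))\<^sup>2)"
proof -
  have "(\<Sum>i\<in>{1..n}. \<Sum>j\<in>{1..n}. (Q (e i) (e j))\<^sup>2) = (\<Sum>i\<in>{1..n}. \<Sum>j\<in>{1..n}. (Q (e i) (e' j))\<^sup>2)"
    by (intro sum.cong refl onb_sum_squares[OF Q(2) e])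
  also have "\<dots> = (\<Sum>j\<in>{1..n}. \<Sum>i\<in>{1..n}. (Q (e i) (e' j))\<^sup>2)"
    by (rule sum.swap)
  also have "\<dots> = (\<Sum>j\<in>{1..n}. \<Sum>i\<in>{1..n}. (Q (e' i) (e' j))\<^sup>2)"
    by (intro sum.cong refl onb_sum_squares[OF Q(1) e])
  also have "\<dots> = (\<Sum>i\<in>{1..n}. \<Sum>j\<in>{1..n}. (Q (e' i) (e' j))\<^sup>2)"
    by (rule sum.swap)
  finally show ?thesis .
qed

section \<open>Trace-free cubic forms\<close>

text \<open>Two adjacent transpositions generate all permutations of the three slots and carry
  linearity from the first slot to the others. The form lives on the whole space; subspaces enter
  through their frames.\<close>

locale cubic_form =
  fixes C :: "'v::euclidean_space \<Rightarrow> 'v \<Rightarrow> 'v \<Rightarrow> real"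
  assumes linear1: "linear (\<lambda>X. C X Y Z)"
    and sym12: "C X Y Z = C Y X Z"
    and sym23: "C X Y Z = C X Z Y"
begin

lemma linear2: "linear (\<lambda>Y. C X Y Z)"
  using linear1[of X Z] by (simp add: sym12[of X])

lemma linear3: "linear (\<lambda>Z. C X Y Z)"
  using linear2[of X Y] by (simp add: sym23[of X Y])

lemma continuous_on_cubic: "continuous_on A (\<lambda>u. C u u u)"
proof -
  have ex: "h u = (\<Sum>b\<in>Basis. (u \<bullet> b) * h b)" if "linear h" for h :: "'v \<Rightarrow> real" and u
    using linear_sum[OF that, of "\<lambda>b. (u \<bullet> b) *\<^sub>R b" Basis]
    by (simp add: euclidean_representation linear_cmul[OF that])
  have "C u u u = (\<Sum>b\<in>Basis. (u \<bullet> b) * (\<Sum>b'\<in>Basis. (u \<bullet> b') * (\<Sum>b''\<in>Basis. (u \<bullet> b'') * C b b' b'')))" for u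
    using ex[OF linear1, of u u u] ex[OF linear2, of _ u u] ex[OF linear3, of _ _ u] by simp
  then show ?thesis by (simp only:) (intro continuous_intros)
qed

lemma cubic_expand:
  "C (c *\<^sub>R u + s *\<^sub>R w) (c *\<^sub>R u + s *\<^sub>R w) (c *\<^sub>R u + s *\<^sub>R w) =
    c ^ 3 * C u u u + 3 * c\<^sup>2 * s * C u u w + 3 * c * s\<^sup>2 * C u w w + s ^ 3 * C w w w"
proof -
  have "C w u u = C u u w" "C u w u = C u u w" "C w w u = C u w w" "C w u w = C u w w"
    by (metis sym12 sym23)+
  then show ?thesis
    by (simp add: linear_add[OF linear1] linear_add[OF linear2] linear_add[OF linear3]
        linear_cmul[OF linear1] linear_cmul[OF linear2] linear_cmul[OF linear3]
        power2_eq_square power3_eq_cube algebra_simps)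
qed

text \<open>At a maximum of the cubic on the unit sphere of \<open>S\<close>, the derivative along
  each great circle \<open>cos t *\<^sub>R u + sin t *\<^sub>R w\<close> vanishes, and at 0 this
  derivative is three times \<open>C u u w\<close>. Other vectors \<open>w\<close> reduce to unit
  ones by scaling.\<close>

lemma critical_direction:
  assumes S: "subspace S" and e: "e \<in> S" "norm e = 1"
  obtains u where "u \<in> S" "norm u = 1" "\<And>w. w \<in> S \<Longrightarrow> w \<bullet> u = 0 \<Longrightarrow> C u u w = 0"
proof -
  have "compact (sphere 0 1 \<inter> S)"
    by (intro compact_Int_closed closed_subspace S) simp
  moreover have "sphere 0 1 \<inter> S \<noteq> {}" using e by auto
  ultimately obtain u where u: "u \<in> sphere 0 1 \<inter> S"
    and max: "\<And>y. y \<in> sphere 0 1 \<inter> S \<Longrightarrow> C y y y \<le> C u u u"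
    using continuous_attains_sup[OF _ _ continuous_on_cubic] by metis
  have uu: "u \<bullet> u = 1" using u by (simp add: norm_eq_1)
  have unit: "C u u w = 0" if w: "w \<in> S" "w \<bullet> u = 0" "w \<bullet> w = 1" for w
  proof -
    define g where "g t = C (cos t *\<^sub>R u + sin t *\<^sub>R w) (cos t *\<^sub>R u + sin t *\<^sub>R w) (cos t *\<^sub>R u + sin t *\<^sub>R w)" for t
    have "(g has_real_derivative 3 * C u u w) (at 0)"
      unfolding g_def cubic_expand by (auto intro!: derivative_eq_intros)
    moreover have "g t \<le> g 0" for t
    proof -
      have "(cos t *\<^sub>R u + sin t *\<^sub>R w) \<bullet> (cos t *\<^sub>R u + sin t *\<^sub>R w) = (cos t)\<^sup>2 + (sin t)\<^sup>2"
        using w uu by (simp add: inner_add_left inner_add_right inner_commute[of u w] power2_eq_square)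
      then have "norm (cos t *\<^sub>R u + sin t *\<^sub>R w) = 1"
        by (simp add: norm_eq_1)
      moreover have "cos t *\<^sub>R u + sin t *\<^sub>R w \<in> S"
        using u w S by (auto intro: subspace_add subspace_mul)
      ultimately show ?thesis using max unfolding g_def by simp
    qed
    ultimately have "3 * C u u w = 0"
      by (intro DERIV_local_max[of g _ 0 1]) auto
    then show ?thesis by simp
  qed
  have "C u u w = 0" if w: "w \<in> S" "w \<bullet> u = 0" for w
  proof (cases "w = 0")
    case True
    then show ?thesis using linear_0[OF linear3] by simp
  next
    case False
    let ?w = "(1 / norm w) *\<^sub>R w"
    have "?w \<in> S" using w S by (simp add: subspace_mul)
    then have "C u u ?w = 0"
      using False w by (intro unit) (auto simp: power2_norm_eq_inner[symmetric] power2_eq_square)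
    then show ?thesis using False by (simp add: linear_cmul[OF linear3])
  qed
  then show ?thesis using u that[of u] by auto
qed

text \<open>The expression is the off-diagonal entry of a symmetric 2 by 2 matrix in a frame rotated
  by \<open>t\<close>, where \<open>q\<close> is the original off-diagonal entry and
  \<open>d\<close> the difference of the diagonal ones. It runs from \<open>q\<close> to
  \<open>-q\<close> on \<open>{0..pi/2}\<close>, so it has a zero there.\<close>

lemma rotation_zero:
  obtains c s :: real where "c\<^sup>2 + s\<^sup>2 = 1" "c * s * d + (c\<^sup>2 - s\<^sup>2) * q = 0"
proof -
  let ?g = "\<lambda>t. cos t * sin t * d + ((cos t)\<^sup>2 - (sin t)\<^sup>2) * q"
  have c: "continuous_on {0..pi/2} ?g" by (intro continuous_intros)
  have "\<exists>t. ?g t = 0"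
  proof (cases "q \<ge> 0")
    case True
    then show ?thesis using IVT2'[of ?g "pi/2" 0 0, OF _ _ _ c] by auto
  next
    case False
    then show ?thesis using IVT'[of ?g 0 0 "pi/2", OF _ _ _ c] by auto
  qed
  then show ?thesis using that[of "cos t" "sin t" for t] by auto
qed

text \<open>The three vanishing coefficients correspond to the three degrees of freedom of a
  rotation: the choice of the critical vector \<open>u\<close> accounts for two, the rotation of the
  plane orthogonal to it for the third.\<close>

lemma normal_form3:
  assumes E: "orthonormal_basis 3 E S"
  obtains F where "orthonormal_basis 3 F S"
    "C (F 1) (F 1) (F 2) = 0" "C (F 1) (F 1) (F 3) = 0" "C (F 1) (F 2) (F 3) = 0"
proof -
  have S: "subspace S" "dim S = 3" using onb_subspace[OF E] onb_dim[OF E] by auto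
  have "E 1 \<in> S" "norm (E 1) = 1"
    using onb_mem[OF E, of 1] onb_inner[OF E, of 1 1] by (auto simp: norm_eq_1)
  then obtain u where u: "u \<in> S" "norm u = 1" and crit: "\<And>w. w \<in> S \<Longrightarrow> w \<bullet> u = 0 \<Longrightarrow> C u u w = 0"
    using critical_direction[OF S(1)] by metis
  let ?P = "{y \<in> S. \<forall>x\<in>span {u}. orthogonal x y}"
  have P: "y \<in> ?P \<longleftrightarrow> y \<in> S \<and> y \<bullet> u = 0" for y
    by (auto simp: span_singleton orthogonal_def inner_commute)
  have "dim ?P + dim (span {u}) = dim S"
    using u S by (intro dim_subspace_orthogonal_to_vectors) (auto intro: span_minimal[THEN subsetD])
  moreover have "u \<noteq> 0" using u by auto
  ultimately have dP: "dim ?P = 2" using S(2) by (simp add: dim_insert)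
  have "subspace ?P"
    using S(1) by (auto simp: subspace_def orthogonal_clauses)
  then obtain B where B: "B \<subseteq> ?P" "pairwise orthogonal B" "\<And>x. x \<in> B \<Longrightarrow> norm x = 1" "card B = dim ?P"
    by (rule orthonormal_basis_subspace) blast
  then obtain w1 w2 where w: "B = {w1, w2}" "w1 \<noteq> w2" using dP by (auto simp: card_2_iff)
  have ip: "u \<bullet> u = 1" "w1 \<bullet> w1 = 1" "w2 \<bullet> w2 = 1" "w1 \<bullet> u = 0" "w2 \<bullet> u = 0" "u \<bullet> w1 = 0" "u \<bullet> w2 = 0"
      "w1 \<bullet> w2 = 0" "w2 \<bullet> w1 = 0" and wS: "w1 \<in> S" "w2 \<in> S"
  proof -
    have mem: "w1 \<in> B" "w2 \<in> B" using w by auto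
    then have 1: "w1 \<in> S" "w1 \<bullet> u = 0" "w2 \<in> S" "w2 \<bullet> u = 0"
      using subsetD[OF B(1)] P by blast+
    have 2: "w1 \<bullet> w2 = 0"
      using B(2) mem w(2) by (simp add: pairwise_def orthogonal_def)
    show "u \<bullet> u = 1" "w1 \<bullet> w1 = 1" "w2 \<bullet> w2 = 1"
      using u(2) B(3)[OF mem(1)] B(3)[OF mem(2)] by (simp_all only: norm_eq_1)
    show "w1 \<bullet> u = 0" "w2 \<bullet> u = 0" "u \<bullet> w1 = 0" "u \<bullet> w2 = 0" "w1 \<bullet> w2 = 0" "w2 \<bullet> w1 = 0"
        "w1 \<in> S" "w2 \<in> S"
      using 1 2 by (simp_all only: inner_commute[of u] inner_commute[of w2 w1])
  qed
  obtain c s :: real where cs: "c\<^sup>2 + s\<^sup>2 = 1"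
    and rot: "c * s * (C u w2 w2 - C u w1 w1) + (c\<^sup>2 - s\<^sup>2) * C u w1 w2 = 0"
    by (rule rotation_zero)
  let ?a = "c *\<^sub>R w1 + s *\<^sub>R w2" and ?b = "(- s) *\<^sub>R w1 + c *\<^sub>R w2"
  define F where "F = (\<lambda>i::nat. if i = 1 then u else if i = 2 then ?a else ?b)"
  have F: "F 1 = u" "F 2 = ?a" "F 3 = ?b" by (auto simp: F_def)
  have ab: "?a \<bullet> ?a = 1" "?b \<bullet> ?b = 1" "?a \<bullet> ?b = 0" "?a \<bullet> u = 0" "?b \<bullet> u = 0" "?a \<in> S" "?b \<in> S"
    using ip cs wS S(1)
    by (auto simp: inner_add_left inner_add_right inner_diff_left inner_diff_right power2_eq_square
        intro!: subspace_add subspace_diff subspace_mul)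
  have 3: "i \<in> {1..3} \<longleftrightarrow> i = 1 \<or> i = 2 \<or> i = 3" for i :: nat by auto
  have "orthonormal_basis 3 F S"
  proof (rule onbI)
    fix i j :: nat assume "i \<in> {1..3}" "j \<in> {1..3}"
    then show "F i \<bullet> F j = (if i = j then 1 else 0)"
      unfolding 3 by (elim disjE) (simp_all only: F ab ip inner_commute[of u ?a]
          inner_commute[of u ?b] inner_commute[of ?b ?a], simp_all)
  next
    fix i :: nat assume "i \<in> {1..3}"
    then show "F i \<in> S" unfolding 3 by (elim disjE) (simp_all only: F ab u)
  qed (use S in auto)
  moreover have "C u ?a ?b = c * s * (C u w2 w2 - C u w1 w1) + (c\<^sup>2 - s\<^sup>2) * C u w1 w2"
    using sym23[of u w2 w1]
    by (simp add: linear_add[OF linear2] linear_add[OF linear3] linear_diff[OF linear3]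
        linear_cmul[OF linear2] linear_cmul[OF linear3] linear_neg[OF linear3] power2_eq_square algebra_simps)
  ultimately show ?thesis using that[of F] crit ab rot by (simp only: F)
qed

end

section \<open>Scalar and normal scalar curvature as polynomials in the coefficients of the cubic
  form\<close>

definition scal_coeffs :: "(nat \<Rightarrow> nat \<Rightarrow> nat \<Rightarrow> real) \<Rightarrow> real"
  where "scal_coeffs c = (1/2) * ((\<Sum>k\<in>{1..4}. (\<Sum>i\<in>{1..4}. c i i k)\<^sup>2)
    - (\<Sum>i\<in>{1..4}. \<Sum>j\<in>{1..4}. \<Sum>k\<in>{1..4}. (c i j k)\<^sup>2))"

text \<open>For symmetric coefficients this is the \<open>i,j\<close> entry of the commutator of the
  shape matrices belonging to the normal indices \<open>l\<close> and \<open>k\<close>, that is, the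
  right-hand side of the Ricci equation.\<close>

definition ncurv_coeffs :: "(nat \<Rightarrow> nat \<Rightarrow> nat \<Rightarrow> real) \<Rightarrow> nat \<Rightarrow> nat \<Rightarrow> nat \<Rightarrow> nat \<Rightarrow> real"
  where "ncurv_coeffs c i j k l = (\<Sum>m\<in>{1..4}. c i m l * c j m k - c j m l * c i m k)"

definition nscal_coeffs :: "(nat \<Rightarrow> nat \<Rightarrow> nat \<Rightarrow> real) \<Rightarrow> real"
  where "nscal_coeffs c = (\<Sum>i\<in>{1..4}. \<Sum>j\<in>{i<..4}. \<Sum>k\<in>{1..4}. \<Sum>l\<in>{k<..4}.
    (ncurv_coeffs c i j k l)\<^sup>2)"

definition special_coeffs :: "(nat \<Rightarrow> nat \<Rightarrow> nat \<Rightarrow> real) \<Rightarrow> real \<Rightarrow> real \<Rightarrow> bool"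
  where "special_coeffs c a b \<longleftrightarrow> (\<forall>i\<in>{1..4}. \<forall>j\<in>{1..4}.
    c i j 1 = matrix_rows [[a, b, 0, 0], [b, -a, 0, 0], [0, 0, 0, 0], [0, 0, 0, 0]] i j \<and>
    c i j 2 = matrix_rows [[b, -a, 0, 0], [-a, -b, 0, 0], [0, 0, 0, 0], [0, 0, 0, 0]] i j \<and>
    c i j 3 = 0 \<and> c i j 4 = 0)"

lemma sum4: "(\<Sum>i\<in>{1..4::nat}. g i) = g 1 + g 2 + g 3 + (g 4 :: 'b::comm_monoid_add)"
  by (simp add: numeral_eq_Suc add.assoc)

lemma sum_above:
  fixes g :: "nat \<Rightarrow> 'b::comm_monoid_add"
  shows "(\<Sum>j\<in>{1<..4}. g j) = g 2 + g 3 + g 4" "(\<Sum>j\<in>{2<..4}. g j) = g 3 + g 4"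
    "(\<Sum>j\<in>{3<..4}. g j) = g 4" "(\<Sum>j\<in>{4<..4}. g j) = 0"
proof -
  have "{1<..4} = {2, 3, 4::nat}" "{2<..4} = {3, 4::nat}" "{3<..4} = {4::nat}" by auto
  then show "(\<Sum>j\<in>{1<..4}. g j) = g 2 + g 3 + g 4" "(\<Sum>j\<in>{2<..4}. g j) = g 3 + g 4"
    "(\<Sum>j\<in>{3<..4}. g j) = g 4" "(\<Sum>j\<in>{4<..4}. g j) = 0"
    by (simp_all add: add.assoc)
qed

lemma ball4: "(\<forall>i\<in>{1..4::nat}. P i) \<longleftrightarrow> P 1 \<and> P 2 \<and> P 3 \<and> P 4"
proof -
  have "{1..4::nat} = {1, 2, 3, 4}" by auto
  then show ?thesis by simp
qed

lemma special_coeffs_iff: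
  "special_coeffs c a b \<longleftrightarrow>
    c 1 1 1 = a \<and> c 1 2 1 = b \<and> c 2 1 1 = b \<and> c 2 2 1 = -a \<and>
    c 1 1 2 = b \<and> c 1 2 2 = -a \<and> c 2 1 2 = -a \<and> c 2 2 2 = -b \<and>
    (\<forall>k\<in>{1..4}. \<forall>j\<in>{1..4}. c 3 j k = 0 \<and> c 4 j k = 0 \<and> c j 3 k = 0 \<and> c j 4 k = 0 \<and>
      c j k 3 = 0 \<and> c j k 4 = 0)"
  unfolding special_coeffs_def ball4 by (auto simp: matrix_rows_def)

text \<open>The explicit value of \<open>scal_coeffs\<close> is recorded for its sign: it decides
  which square root of \<open>nscal_coeffs\<close> is meant.\<close>

lemma special_coeffs_curv:
  assumes "special_coeffs c a b"
  shows "scal_coeffs c = - 2 * (a\<^sup>2 + b\<^sup>2)" "nscal_coeffs c = (scal_coeffs c)\<^sup>2"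
proof -
  note s = assms[unfolded special_coeffs_iff ball4]
  show sc: "scal_coeffs c = - 2 * (a\<^sup>2 + b\<^sup>2)"
    unfolding scal_coeffs_def sum4 by (simp del: One_nat_def add: s)
  show "nscal_coeffs c = (scal_coeffs c)\<^sup>2"
    unfolding sc unfolding nscal_coeffs_def ncurv_coeffs_def sum4 sum_above
    by (simp del: One_nat_def add: s power2_eq_square algebra_simps)
qed

text \<open>A single plane contributes \<open>2 * (a\<^sup>2 + b\<^sup>2)\<close> to the negative of
  \<open>scal_coeffs\<close> and the square of this to \<open>nscal_coeffs\<close>. The commutators
  of the two planes occupy disjoint index ranges, so their squares add; the factor 8 is the cross
  term of the squared sum.\<close>

lemma plane_pair_curv:
  assumes s: "c 1 1 1 = a" "c 1 1 2 = b" "c 1 2 1 = b" "c 2 1 1 = b"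
      "c 1 2 2 = -a" "c 2 1 2 = -a" "c 2 2 1 = -a" "c 2 2 2 = -b"
      "c 3 3 3 = a'" "c 3 3 4 = b'" "c 3 4 3 = b'" "c 4 3 3 = b'"
      "c 3 4 4 = -a'" "c 4 3 4 = -a'" "c 4 4 3 = -a'" "c 4 4 4 = -b'"
    and z: "\<And>i j k. i \<in> {1, 2} \<Longrightarrow> j \<in> {3, 4} \<Longrightarrow> k \<in> {1..4} \<Longrightarrow>
      c i j k = 0 \<and> c i k j = 0 \<and> c j i k = 0 \<and> c j k i = 0 \<and> c k i j = 0 \<and> c k j i = 0"
  shows "scal_coeffs c = - 2 * (a\<^sup>2 + b\<^sup>2 + a'\<^sup>2 + b'\<^sup>2)"
    "(scal_coeffs c)\<^sup>2 - nscal_coeffs c = 8 * (a\<^sup>2 + b\<^sup>2) * (a'\<^sup>2 + b'\<^sup>2)"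
proof -
  note z' = z[of 1 3] z[of 1 4] z[of 2 3] z[of 2 4]
  show sc: "scal_coeffs c = - 2 * (a\<^sup>2 + b\<^sup>2 + a'\<^sup>2 + b'\<^sup>2)"
    unfolding scal_coeffs_def sum4 by (simp del: One_nat_def add: s z')
  show "(scal_coeffs c)\<^sup>2 - nscal_coeffs c = 8 * (a\<^sup>2 + b\<^sup>2) * (a'\<^sup>2 + b'\<^sup>2)"
    unfolding sc unfolding nscal_coeffs_def ncurv_coeffs_def sum4 sum_above
    by (simp del: One_nat_def add: s z' power2_eq_square algebra_simps)
qed

text \<open>The trace conditions eliminate \<open>c 1 1 1\<close>, \<open>c 2 3 3\<close> and
  \<open>c 2 2 3\<close>, the normal form sets three more coefficients to zero, and four remain.
  Every ordering of the indices is listed so that substitution leaves a polynomial identity.\<close>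

lemma space_curv:
  assumes s: "c 1 1 1 = - (m + n)" "c 1 2 2 = m" "c 2 1 2 = m" "c 2 2 1 = m"
      "c 1 3 3 = n" "c 3 1 3 = n" "c 3 3 1 = n"
      "c 2 2 2 = p" "c 2 3 3 = -p" "c 3 2 3 = -p" "c 3 3 2 = -p"
      "c 3 3 3 = q" "c 2 2 3 = -q" "c 2 3 2 = -q" "c 3 2 2 = -q"
      "c 1 1 2 = 0" "c 1 2 1 = 0" "c 2 1 1 = 0" "c 1 1 3 = 0" "c 1 3 1 = 0" "c 3 1 1 = 0"
      "c 1 2 3 = 0" "c 1 3 2 = 0" "c 2 1 3 = 0" "c 2 3 1 = 0" "c 3 1 2 = 0" "c 3 2 1 = 0"
    and z: "\<And>j k. j \<in> {1..4} \<Longrightarrow> k \<in> {1..4} \<Longrightarrow> c 4 j k = 0 \<and> c j 4 k = 0 \<and> c j k 4 = 0"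
  shows "scal_coeffs c = - (2 * m\<^sup>2 + 2 * n\<^sup>2 + m * n + 2 * (p\<^sup>2 + q\<^sup>2))"
    "(scal_coeffs c)\<^sup>2 - nscal_coeffs c = 6 * (m * n)\<^sup>2 + 6 * (p\<^sup>2 + q\<^sup>2) * (m + n)\<^sup>2"
proof -
  show sc: "scal_coeffs c = - (2 * m\<^sup>2 + 2 * n\<^sup>2 + m * n + 2 * (p\<^sup>2 + q\<^sup>2))"
    unfolding scal_coeffs_def sum4 by (simp del: One_nat_def add: s z power2_eq_square algebra_simps)
  show "(scal_coeffs c)\<^sup>2 - nscal_coeffs c = 6 * (m * n)\<^sup>2 + 6 * (p\<^sup>2 + q\<^sup>2) * (m + n)\<^sup>2"
    unfolding sc unfolding nscal_coeffs_def ncurv_coeffs_def sum4 sum_above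
    by (simp del: One_nat_def add: s z power2_eq_square algebra_simps)
qed

lemma onb_reorder:
  assumes "orthonormal_basis 4 e S" "set [a, b, c, d] = {1..4}"
  obtains G where "orthonormal_basis 4 G S" "G 1 = e a" "G 2 = e b" "G 3 = e c" "G 4 = e d"
proof -
  let ?p = "\<lambda>i. [a, b, c, d] ! (i - 1)"
  have "?p ` {1..4} = ?p ` {1, 2, 3, 4}" by (rule arg_cong[of _ _ "image ?p"]) auto
  also have "\<dots> = {1..4}" using assms(2) by simp
  finally have im: "?p ` {1..4} = {1..4}" .
  then have "bij_betw ?p {1..4} {1..4}"
    by (simp add: bij_betw_def eq_card_imp_inj_on)
  from onb_permute[OF assms(1) this] that show thesis by auto
qed

lemma onb_vanish:
  fixes h :: "'v::euclidean_space \<Rightarrow> real"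
  assumes "linear h" "orthonormal_basis n e S" "\<And>i. i \<in> {1..n} \<Longrightarrow> h (e i) = 0" "X \<in> S"
  shows "h X = 0"
  using assms(1)
proof (rule linear_eq_0_on_span)
  show "X \<in> span (e ` {1..n})" using assms(2,4) by (simp add: orthonormal_basis_def)
  show "h y = 0" if "y \<in> e ` {1..n}" for y using assms(3) that by blast
qed

section \<open>The estimate and its equality case for each block pattern\<close>

context cubic_form
begin

text \<open>The two inequalities together say that the root of \<open>nscal_coeffs\<close> is at
  most the negative of \<open>scal_coeffs\<close>. The equality clause allows a frame
  \<open>G\<close> other than \<open>F\<close>, because the plane carrying the form need not be
  spanned by the first two vectors of \<open>F\<close>.\<close>

definition frame_estimate :: "'v set \<Rightarrow> (nat \<Rightarrow> 'v) \<Rightarrow> bool"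
  where "frame_estimate T F \<longleftrightarrow>
    (let c = (\<lambda>i j k. C (F i) (F j) (F k)) in
      scal_coeffs c \<le> 0 \<and> nscal_coeffs c \<le> (scal_coeffs c)\<^sup>2 \<and>
      (nscal_coeffs c = (scal_coeffs c)\<^sup>2 \<longrightarrow>
        (\<exists>G a b. orthonormal_basis 4 G T \<and> special_coeffs (\<lambda>i j k. C (G i) (G j) (G k)) a b)))"

text \<open>\<open>E 4\<close> annihilates the form, so the rotation to normal form takes place in
  the span of the other three vectors and \<open>E 4\<close> is adjoined again afterwards. The trace
  conditions survive the rotation by basis invariance of the trace.\<close>

lemma frame_estimate_space:
  assumes E: "orthonormal_basis 4 E T"
    and z: "\<And>j k. j \<in> {1..4} \<Longrightarrow> k \<in> {1..4} \<Longrightarrow> C (E 4) (E j) (E k) = 0"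
    and tr: "\<And>k. k \<in> {1..4} \<Longrightarrow> (\<Sum>i\<in>{1..3}. C (E i) (E i) (E k)) = 0"
  obtains F where "orthonormal_basis 4 F T" "frame_estimate T F"
proof -
  define S where "S = span (E ` {1..3})"
  have "orthonormal_basis 3 E S"
    using E by (auto simp: orthonormal_basis_def S_def)
  then obtain H where E3: "orthonormal_basis 3 E S" and H: "orthonormal_basis 3 H S"
    and nf: "C (H 1) (H 1) (H 2) = 0" "C (H 1) (H 1) (H 3) = 0" "C (H 1) (H 2) (H 3) = 0"
    using normal_form3 by metis
  have "E ` {1..3} \<subseteq> E ` {1..4}" by auto
  from span_mono[OF this] have "S \<subseteq> T"
    using E unfolding S_def orthonormal_basis_def by blast
  have ET: "E i \<in> T" if "i \<in> {1..4}" for i using onb_mem[OF E that] .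
  have HS: "H i \<in> S" if "i \<in> {1..3}" for i using onb_mem[OF H that] .
  have HT: "H i \<in> T" if "i \<in> {1..3}" for i using HS[OF that] \<open>S \<subseteq> T\<close> by blast
  have "orthogonal (E 4) y" if "y \<in> E ` {1..3}" for y
    using that onb_inner[OF E, of 4] by (auto simp: orthogonal_def)
  then have E4: "E 4 \<bullet> X = 0" if "X \<in> S" for X
    using that orthogonal_to_span[of X "E ` {1..3}" "E 4"] by (simp add: S_def orthogonal_def)
  define F where "F i = (if i = 4 then E 4 else H i)" for i :: nat
  have F: "orthonormal_basis 4 F T"
  proof (rule onbI)
    fix i j :: nat assume ij: "i \<in> {1..4}" "j \<in> {1..4}"
    have *: "k \<in> {1..4} \<Longrightarrow> k \<noteq> 4 \<Longrightarrow> k \<in> {1..3}" for k :: nat by auto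
    show "F i \<bullet> F j = (if i = j then 1 else 0)"
      using onb_inner[OF E, of 4 4] onb_inner[OF H, of i j] *[OF ij(1)] *[OF ij(2)] E4[OF HS]
        inner_commute[of "H i" "E 4"]
      by (cases "i = 4"; cases "j = 4") (simp_all add: F_def)
    show "F i \<in> T"
      using ET[of 4] HT *[OF ij(1)] by (simp add: F_def)
  qed (use onb_subspace[OF E] onb_dim[OF E] in auto)
  have z': "C (E 4) X Y = 0" if X: "X \<in> T" and Y: "Y \<in> T" for X Y
  proof -
    have "C (E 4) (E j) Y = 0" if "j \<in> {1..4}" for j
      by (rule onb_vanish[OF linear3 E _ Y]) (rule z[OF that])
    then show ?thesis
      by (intro onb_vanish[OF linear2 E _ X])
  qed
  have tr': "(\<Sum>i\<in>{1..3}. C (H i) (H i) Z) = 0" if Z: "Z \<in> T" for Z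
  proof -
    have "linear (\<lambda>Z. \<Sum>i\<in>{1..3}. C (E i) (E i) Z)"
      by (rule linear_compose_sum) (simp add: linear3)
    from onb_vanish[OF this E tr Z] have "(\<Sum>i\<in>{1..3}. C (E i) (E i) Z) = 0" .
    then show ?thesis
      using onb_trace[of "\<lambda>X Y. C X Y Z", OF linear1 linear2 H E3] by simp
  qed
  have sum3: "(\<Sum>i\<in>{1..3::nat}. g i) = g 1 + g 2 + g 3" for g :: "nat \<Rightarrow> real"
    by (simp add: numeral_eq_Suc)
  define c where "c = (\<lambda>i j k. C (F i) (F j) (F k))"
  have FH: "F 1 = H 1" "F 2 = H 2" "F 3 = H 3" "F 4 = E 4" by (auto simp: F_def)
  have cz: "c 4 j k = 0 \<and> c j 4 k = 0 \<and> c j k 4 = 0" if "j \<in> {1..4}" "k \<in> {1..4}" for j k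
    using z'[OF onb_mem[OF F that(1)] onb_mem[OF F that(2)]] sym12[of "F j" "E 4" "F k"]
      sym23[of "F j" "F k" "E 4"] by (simp add: c_def FH)
  have t: "c 1 1 k + c 2 2 k + c 3 3 k = 0" if "k \<in> {1..4}" for k
    using tr'[OF onb_mem[OF F that]] unfolding sum3 by (simp only: c_def FH)
  define m n p q where "m = c 1 2 2" and "n = c 1 3 3" and "p = c 2 2 2" and "q = c 3 3 3"
  have s12: "c i j k = c j i k" and s23: "c i j k = c i k j" for i j k
    unfolding c_def by (rule sym12, rule sym23)
  have f: "c 1 1 2 = 0" "c 1 1 3 = 0" "c 1 2 3 = 0"
    unfolding c_def FH using nf by auto
  have f': "c 1 2 1 = 0" "c 2 1 1 = 0" "c 1 3 1 = 0" "c 3 1 1 = 0"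
     "c 1 3 2 = 0" "c 2 1 3 = 0" "c 2 3 1 = 0" "c 3 1 2 = 0" "c 3 2 1 = 0"
    using f by (metis s12 s23)+
  have mn: "c 2 1 2 = m" "c 2 2 1 = m" "c 3 1 3 = n" "c 3 3 1 = n"
    unfolding m_def n_def by (metis s12 s23)+
  have l: "c 1 1 1 = - (m + n)" "c 3 3 2 = - p" "c 2 2 3 = - q"
    using t[of 1] t[of 2] t[of 3] f mn by (simp_all add: p_def q_def)
  have l': "c 2 3 3 = - p" "c 3 2 3 = - p" "c 2 3 2 = - q" "c 3 2 2 = - q"
    using l(2,3) by (metis s12 s23)+
  note sp = space_curv[OF l(1) m_def[symmetric] mn(1,2) n_def[symmetric] mn(3,4) p_def[symmetric]
      l'(1,2) l(2) q_def[symmetric] l(3) l'(3,4) f(1) f'(1,2) f(2) f'(3,4) f(3) f'(5-9) cz, simplified]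
  \<comment> \<open>Completing the square absorbs the mixed term \<open>m * n\<close>, whose sign is
    not known.\<close>
  have "scal_coeffs c = - ((m + n)\<^sup>2 / 2 + 3 / 2 * (m\<^sup>2 + n\<^sup>2) + 2 * (p\<^sup>2 + q\<^sup>2))"
    unfolding sp(1) by (simp add: power2_eq_square field_simps)
  then have "scal_coeffs c \<le> 0"
    by (simp only: neg_le_0_iff_le)
      (intro mult_nonneg_nonneg add_nonneg_nonneg divide_nonneg_nonneg zero_le_power2, simp_all)
  moreover have "nscal_coeffs c \<le> (scal_coeffs c)\<^sup>2"
  proof -
    have "0 \<le> 6 * (m * n)\<^sup>2 + (6 * p\<^sup>2 + 6 * q\<^sup>2) * (m + n)\<^sup>2" by simp
    then show ?thesis using sp(2) by linarith
  qed
  moreover have "\<exists>G a b. orthonormal_basis 4 G T \<and> special_coeffs (\<lambda>i j k. C (G i) (G j) (G k)) a b"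
    if eq: "nscal_coeffs c = (scal_coeffs c)\<^sup>2"
  proof -
    have "6 * (m * n)\<^sup>2 + 6 * (p\<^sup>2 + q\<^sup>2) * (m + n)\<^sup>2 = 0"
      using sp(2) eq by simp
    moreover have "0 \<le> 6 * (m * n)\<^sup>2" "0 \<le> 6 * (p\<^sup>2 + q\<^sup>2) * (m + n)\<^sup>2" by simp_all
    ultimately have 1: "(m * n)\<^sup>2 = 0" and 2: "(p\<^sup>2 + q\<^sup>2) * (m + n)\<^sup>2 = 0"
      by linarith+
    \<comment> \<open>If \<open>p\<close> or \<open>q\<close> is nonzero then
      \<open>m + n = 0\<close>, and \<open>m * n = 0\<close> forces both to vanish; otherwise one of
      \<open>m\<close>, \<open>n\<close> vanishes. The form then lives on the plane with indices 1,2
      or 1,3 or 2,3 respectively.\<close>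
    then consider "n = 0" "p = 0" "q = 0" | "m = 0" "p = 0" "q = 0" | "m = 0" "n = 0"
      by (auto simp: sum_power2_eq_zero_iff)
    then show ?thesis
    proof cases
      case 1
      have "special_coeffs c (- m) 0"
        unfolding special_coeffs_iff ball4
        by (simp del: One_nat_def add: f f' mn l l' cz m_def[symmetric] n_def[symmetric] p_def[symmetric]
            q_def[symmetric] 1)
      then show ?thesis using F unfolding c_def by blast
    next
      case 2
      obtain G where G: "orthonormal_basis 4 G T" "G 1 = F 1" "G 2 = F 3" "G 3 = F 2" "G 4 = F 4"
        by (rule onb_reorder[OF F, of 1 3 2 4]) auto
      have "special_coeffs (\<lambda>i j k. C (G i) (G j) (G k)) (- n) 0"
        unfolding special_coeffs_iff ball4 G(2-5) c_def[THEN fun_cong, THEN fun_cong, THEN fun_cong, symmetric]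
        by (simp del: One_nat_def add: f f' mn l l' cz m_def[symmetric] n_def[symmetric] p_def[symmetric]
            q_def[symmetric] 2)
      then show ?thesis using G(1) by blast
    next
      case 3
      obtain G where G: "orthonormal_basis 4 G T" "G 1 = F 2" "G 2 = F 3" "G 3 = F 1" "G 4 = F 4"
        by (rule onb_reorder[OF F, of 2 3 1 4]) auto
      have "special_coeffs (\<lambda>i j k. C (G i) (G j) (G k)) p (- q)"
        unfolding special_coeffs_iff ball4 G(2-5) c_def[THEN fun_cong, THEN fun_cong, THEN fun_cong, symmetric]
        by (simp del: One_nat_def add: f f' mn l l' cz m_def[symmetric] n_def[symmetric] p_def[symmetric]
            q_def[symmetric] 3)
      then show ?thesis using G(1) by blast
    qed
  qed
  ultimately have "frame_estimate T F"
    unfolding frame_estimate_def Let_def c_def by simp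
  with F that show thesis by blast
qed

text \<open>By symmetry a coefficient with indices from both planes vanishes in every order. A
  trace-free cubic form on a plane has just two coefficients, so the given frame already
  serves.\<close>

lemma frame_estimate_planes:
  assumes E: "orthonormal_basis 4 E T"
    and z: "\<And>i j k. i \<in> {1, 2} \<Longrightarrow> j \<in> {3, 4} \<Longrightarrow> k \<in> {1..4} \<Longrightarrow> C (E i) (E j) (E k) = 0"
    and tr: "\<And>k. k \<in> {1..4} \<Longrightarrow> C (E 1) (E 1) (E k) + C (E 2) (E 2) (E k) = 0"
      "\<And>k. k \<in> {1..4} \<Longrightarrow> C (E 3) (E 3) (E k) + C (E 4) (E 4) (E k) = 0"
  shows "frame_estimate T E"
proof -
  define c where "c = (\<lambda>i j k. C (E i) (E j) (E k))"
  have s12: "c i j k = c j i k" and s23: "c i j k = c i k j" for i j k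
    unfolding c_def by (rule sym12, rule sym23)
  have cz: "c i j k = 0 \<and> c i k j = 0 \<and> c j i k = 0 \<and> c j k i = 0 \<and> c k i j = 0 \<and> c k j i = 0"
    if "i \<in> {1, 2}" "j \<in> {3, 4}" "k \<in> {1..4}" for i j k
  proof -
    have "c i j k = 0" using z[OF that] by (simp add: c_def)
    then show ?thesis by (metis s12 s23)
  qed
  define a b a' b' where "a = c 1 1 1" and "b = c 1 1 2" and "a' = c 3 3 3" and "b' = c 3 3 4"
  have l: "c 2 2 1 = -a" "c 2 2 2 = -b" "c 4 4 3 = -a'" "c 4 4 4 = -b'"
    using tr(1)[of 1] tr(1)[of 2] tr(2)[of 3] tr(2)[of 4]
    by (simp_all add: c_def a_def b_def a'_def b'_def)
  have l': "c 1 2 1 = b" "c 2 1 1 = b" "c 1 2 2 = -a" "c 2 1 2 = -a"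
      "c 3 4 3 = b'" "c 4 3 3 = b'" "c 3 4 4 = -a'" "c 4 3 4 = -a'"
    using l b_def b'_def by (metis s12 s23)+
  note sp = plane_pair_curv[OF a_def[symmetric] b_def[symmetric] l'(1-4) l(1,2)
      a'_def[symmetric] b'_def[symmetric] l'(5-8) l(3,4) cz, simplified]
  have "scal_coeffs c = - (2 * (a\<^sup>2 + b\<^sup>2 + a'\<^sup>2 + b'\<^sup>2))"
    unfolding sp(1) by (simp add: algebra_simps)
  then have "scal_coeffs c \<le> 0"
    by (simp only: neg_le_0_iff_le) (intro mult_nonneg_nonneg add_nonneg_nonneg zero_le_power2, simp)
  moreover have "nscal_coeffs c \<le> (scal_coeffs c)\<^sup>2"
  proof -
    have "0 \<le> (8 * a\<^sup>2 + 8 * b\<^sup>2) * (a'\<^sup>2 + b'\<^sup>2)" by simp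
    then show ?thesis using sp(2) by linarith
  qed
  moreover have "\<exists>G a b. orthonormal_basis 4 G T \<and> special_coeffs (\<lambda>i j k. C (G i) (G j) (G k)) a b"
    if eq: "nscal_coeffs c = (scal_coeffs c)\<^sup>2"
  proof -
    have "8 * ((a\<^sup>2 + b\<^sup>2) * (a'\<^sup>2 + b'\<^sup>2)) = 0"
      using sp(2) eq by (simp only: diff_self) (simp only: distrib_left distrib_right mult.assoc)
    then have "a\<^sup>2 + b\<^sup>2 = 0 \<or> a'\<^sup>2 + b'\<^sup>2 = 0"
      by (metis mult_eq_0_iff zero_neq_numeral)
    then consider "a = 0" "b = 0" | "a' = 0" "b' = 0"
      by (auto simp: sum_power2_eq_zero_iff)
    then show ?thesis
    proof cases
      case 1
      obtain G where G: "orthonormal_basis 4 G T" "G 1 = E 3" "G 2 = E 4" "G 3 = E 1" "G 4 = E 2"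
        by (rule onb_reorder[OF E, of 3 4 1 2]) auto
      have "special_coeffs (\<lambda>i j k. C (G i) (G j) (G k)) a' b'"
        unfolding special_coeffs_iff ball4 G(2-5) c_def[THEN fun_cong, THEN fun_cong, THEN fun_cong, symmetric]
        by (simp del: One_nat_def add: cz l l' a_def[symmetric] b_def[symmetric] a'_def[symmetric]
            b'_def[symmetric] 1)
      then show ?thesis using G(1) by blast
    next
      case 2
      have "special_coeffs c a b"
        unfolding special_coeffs_iff ball4
        by (simp del: One_nat_def add: cz l l' a_def[symmetric] b_def[symmetric] a'_def[symmetric]
            b'_def[symmetric] 2)
      then show ?thesis using E unfolding c_def by blast
    qed
  qed
  ultimately show ?thesis
    unfolding frame_estimate_def Let_def c_def by simp
qed

end

section \<open>Block patterns for four indices\<close>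

lemma block_size_cases:
  assumes "ns \<noteq> []" "\<forall>k\<in>set ns. 1 \<le> (k::nat)" "sum_list ns \<le> 4" "hd ns \<noteq> 4"
  shows "ns \<in> set [[1], [2], [3], [1,1], [1,2], [1,3], [2,1], [2,2], [3,1], [1,1,1], [1,1,2],
    [1,2,1], [2,1,1], [1,1,1,1]]"
proof -
  obtain a ms where ns: "ns = a # ms" using assms(1) by (cases ns) auto
  show ?thesis
  proof (cases ms)
    case Nil
    then show ?thesis using assms ns by auto
  next
    case (Cons b ms')
    note ms = this
    show ?thesis
    proof (cases ms')
      case Nil
      then show ?thesis using assms ns ms by auto
    next
      case (Cons c ms'')
      note ms' = this
      show ?thesis
      proof (cases ms'')
        case Nil
        then show ?thesis using assms ns ms ms' by auto
      next
        case (Cons d r)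
        then show ?thesis using assms ns ms ms' by (cases r) auto
      qed
    qed
  qed
qed

text \<open>Blocks of size one are zero, and so are rows beyond the last block, so fine patterns
  merge into coarse ones: a zero row at the end, a zero row at the start, or two planes. The single
  block of size 4 is excluded by \<open>hd ns \<noteq> 4\<close>.\<close>

lemma block_shape_cases:
  assumes "ns \<noteq> []" "\<forall>k\<in>set ns. 1 \<le> (k::nat)" "sum_list ns \<le> 4" "hd ns \<noteq> 4"
  obtains
    (first) "\<And>A. traceless_block_diag 4 ns A \<Longrightarrow>
      (\<forall>j\<in>{1..4}. A 4 j = 0) \<and> A 1 1 + A 2 2 + A 3 3 = 0"
  | (last) "\<And>A. traceless_block_diag 4 ns A \<Longrightarrow>
      (\<forall>j\<in>{1..4}. A 1 j = 0) \<and> A 2 2 + A 3 3 + A 4 4 = 0"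
  | (planes) "\<And>A. traceless_block_diag 4 ns A \<Longrightarrow>
      A 1 3 = 0 \<and> A 1 4 = 0 \<and> A 2 3 = 0 \<and> A 2 4 = 0 \<and> A 1 1 + A 2 2 = 0 \<and> A 3 3 + A 4 4 = 0"
proof -
  have iv: "{0<..Suc 0} = {1}" "{0<..2::nat} = {1, 2}" "{0<..3::nat} = {1, 2, 3}"
    "{Suc 0<..2} = {2}" "{Suc 0<..3} = {2, 3}" "{Suc 0<..4} = {2, 3, 4}"
    "{2<..3::nat} = {3}" "{2<..4::nat} = {3, 4}" "{3<..4::nat} = {4}"
    by auto
  have less: "(\<forall>b<2. P b) \<longleftrightarrow> P 0 \<and> P (Suc 0)" "(\<exists>b<2. P b) \<longleftrightarrow> P 0 \<or> P (Suc 0)"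
    "(\<forall>b<3. P b) \<longleftrightarrow> P 0 \<and> P (Suc 0) \<and> P 2" "(\<exists>b<3. P b) \<longleftrightarrow> P 0 \<or> P (Suc 0) \<or> P 2"
    "(\<forall>b<4. P b) \<longleftrightarrow> P 0 \<and> P (Suc 0) \<and> P 2 \<and> P 3"
    "(\<exists>b<4. P b) \<longleftrightarrow> P 0 \<or> P (Suc 0) \<or> P 2 \<or> P 3" for P :: "nat \<Rightarrow> bool"
    by (auto simp: less_Suc_eq eval_nat_numeral)
  note d = traceless_block_diag_def block_range_def ball4 ball4[unfolded One_nat_def]
    All_less_Suc Ex_less_Suc less iv numeral_2_eq_2[symmetric]
  from block_size_cases[OF assms] consider "ns \<in> set [[1], [2], [3], [1,1], [1,2], [2,1], [3,1], [1,1,1],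
      [1,2,1], [2,1,1], [1,1,1,1]]" | "ns \<in> set [[1,3], [1,1,2]]" | "ns = [2,2]"
    by auto
  then show thesis
  proof cases
    case 1
    then have ns: "ns = [1] \<or> ns = [2] \<or> ns = [3] \<or> ns = [1,1] \<or> ns = [1,2] \<or> ns = [2,1] \<or> ns = [3,1]
      \<or> ns = [1,1,1] \<or> ns = [1,2,1] \<or> ns = [2,1,1] \<or> ns = [1,1,1,1]" by simp
    show thesis
    proof (rule first, goal_cases)
      case (1 A)
      show ?case using ns 1 by (elim disjE) (simp_all add: d)
    qed
  next
    case 2
    then have ns: "ns = [1,3] \<or> ns = [1,1,2]" by simp
    show thesis
    proof (rule last, goal_cases)
      case (1 A)
      show ?case using ns 1 by (elim disjE) (simp_all add: d)
    qed
  next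
    case 3
    note ns = 3
    show thesis
    proof (rule planes, goal_cases)
      case (1 A)
      show ?case using ns 1 by (simp add: d)
    qed
  qed
qed

section \<open>Lagrangian immersions\<close>

lemma inner_cplx_J: "cplx_J v \<bullet> cplx_J w = v \<bullet> w"
  by (simp add: cplx_J_def inner_vec_def inner_complex_def algebra_simps)

lemma inner_cplx_J_left: "cplx_J v \<bullet> w = - (v \<bullet> cplx_J w)"
  by (simp add: cplx_J_def inner_vec_def inner_complex_def sum_negf[symmetric])

lemma linear_cplx_J: "linear cplx_J"
  by (rule linearI) (simp_all add: cplx_J_def vec_eq_iff algebra_simps)

text \<open>Since the sizes add up to at most \<open>n\<close>, all block ranges lie in
  \<open>{1..n}\<close>, so agreement of the entries there also transfers the symmetry and trace
  conditions.\<close>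

lemma traceless_block_diag_cong:
  assumes ns: "sum_list ns \<le> n"
    and eq: "\<And>i j. i \<in> {1..n} \<Longrightarrow> j \<in> {1..n} \<Longrightarrow> A i j = B i j"
    and A: "traceless_block_diag n ns A"
  shows "traceless_block_diag n ns B"
proof -
  have "block_range ns b \<subseteq> {1..n}" for b
  proof -
    have "sum_list (take (Suc b) ns) \<le> sum_list ns"
      by (metis append_take_drop_id le_add1 sum_list_append)
    then show ?thesis using ns by (auto simp: block_range_def)
  qed
  then have B: "A i j = B i j" if "i \<in> block_range ns b" "j \<in> block_range ns b" for i j b
    using eq[of i j] that by blast
  have "(\<Sum>i\<in>block_range ns b. A i i) = (\<Sum>i\<in>block_range ns b. B i i)" for b
    by (rule sum.cong[OF refl B])
  note sums = this
  show ?thesis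
    unfolding traceless_block_diag_def
  proof (intro conjI ballI allI impI)
    fix i j assume ij: "i \<in> {1..n}" "j \<in> {1..n}"
      and "\<not> (\<exists>b<length ns. i \<in> block_range ns b \<and> j \<in> block_range ns b)"
    then have "A i j = 0" using A unfolding traceless_block_diag_def by blast
    then show "B i j = 0" using eq[OF ij] by simp
  next
    fix b i j assume b: "b < length ns" and ij: "i \<in> block_range ns b" "j \<in> block_range ns b"
    then have "A i j = A j i" using A unfolding traceless_block_diag_def by blast
    then show "B i j = B j i" using B[OF ij] B[OF ij(2,1)] by simp
  next
    fix b assume "b < length ns"
    then have "(\<Sum>i\<in>block_range ns b. A i i) = 0" using A unfolding traceless_block_diag_def by blast
    then show "(\<Sum>i\<in>block_range ns b. B i i) = 0" by (simp only: sums)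
  qed
qed

lemma sum_swap_pairs:
  "(\<Sum>i\<in>A. \<Sum>j\<in>B. \<Sum>a\<in>C. \<Sum>b\<in>D. g i j a b) = (\<Sum>a\<in>C. \<Sum>b\<in>D. \<Sum>i\<in>A. \<Sum>j\<in>B. g i j a b)"
proof -
  have "(\<Sum>i\<in>A. \<Sum>j\<in>B. \<Sum>a\<in>C. \<Sum>b\<in>D. g i j a b) = (\<Sum>i\<in>A. \<Sum>a\<in>C. \<Sum>j\<in>B. \<Sum>b\<in>D. g i j a b)"
    by (rule sum.cong[OF refl sum.swap])
  also have "\<dots> = (\<Sum>a\<in>C. \<Sum>i\<in>A. \<Sum>j\<in>B. \<Sum>b\<in>D. g i j a b)"
    by (rule sum.swap)
  also have "\<dots> = (\<Sum>a\<in>C. \<Sum>i\<in>A. \<Sum>b\<in>D. \<Sum>j\<in>B. g i j a b)"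
    by (rule sum.cong[OF refl sum.cong[OF refl sum.swap]])
  also have "\<dots> = (\<Sum>a\<in>C. \<Sum>b\<in>D. \<Sum>i\<in>A. \<Sum>j\<in>B. g i j a b)"
    by (rule sum.cong[OF refl sum.swap])
  finally show ?thesis .
qed

text \<open>The curvatures are sums over index pairs in increasing order, while basis invariance is
  available for full sums; this converts one into the other.\<close>

lemma symmetric_sum_half:
  fixes g :: "nat \<Rightarrow> nat \<Rightarrow> real"
  assumes "\<And>i j. g i j = g j i" "\<And>i. g i i = 0"
  shows "(\<Sum>i\<in>{1..4}. \<Sum>j\<in>{i<..4}. g i j) = (\<Sum>i\<in>{1..4}. \<Sum>j\<in>{1..4}. g i j) / 2"
  unfolding sum4 sum_above
  using assms(1)[of 2 1] assms(1)[of 3 1] assms(1)[of 4 1] assms(1)[of 3 2] assms(1)[of 4 2] assms(1)[of 4 3]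
  by (simp del: One_nat_def add: assms(2))

locale lagrangian_immersion = immersion W f
  for W :: "(real^4) set" and f :: "real^4 \<Rightarrow> complex^4" +
  assumes bij_J: "x \<in> W \<Longrightarrow> bij_betw cplx_J (tangent_fibre f x) (normal_fibre f x)"
begin

text \<open>The derivative of the Lagrangian identity
  \<open>dd w f y \<bullet> cplx_J (dd z f y) = 0\<close>, rearranged with \<open>J\<close>
  skew-adjoint. It is the source of the total symmetry of the cubic form.\<close>

lemma hess_J_commute:
  assumes x: "x \<in> W"
  shows "dd v (dd w f) x \<bullet> cplx_J (dd z f x) = dd v (dd z f) x \<bullet> cplx_J (dd w f x)"
proof -
  have J: "((\<lambda>y. cplx_J (dd z f y)) has_derivative (\<lambda>v. cplx_J (dd v (dd z f) x))) (at x)"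
    by (rule bounded_linear.has_derivative[OF linear_conv_bounded_linear[THEN iffD1, OF linear_cplx_J]
          has_derivative_dd[OF diff_dd[OF x]]])
  have "dd w f y \<bullet> cplx_J (dd z f y) = 0" if y: "y \<in> W" for y
  proof -
    have "cplx_J (dd z f y) \<in> normal_fibre f y"
      using bij_J[OF y] by (auto simp: bij_betw_def tangent_fibre_def)
    then show ?thesis by (simp add: mem_normal_fibre inner_commute)
  qed
  then have "dd v (\<lambda>y. dd w f y \<bullet> cplx_J (dd z f y)) x = dd v (\<lambda>y. 0) x"
    by (rule dd_cong[OF open_W x])
  then have "dd v (dd w f) x \<bullet> cplx_J (dd z f x) + dd w f x \<bullet> cplx_J (dd v (dd z f) x) = 0"
    using dd_inner[OF diff_dd[OF x, of w] differentiableI[OF J], of v] dd_eqI[OF J, of v] by simp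
  then show ?thesis using inner_cplx_J_left[of "dd w f x" "dd v (dd z f) x"]
    by (simp add: inner_commute)
qed

section \<open>Second fundamental form, cubic form and curvatures at a point\<close>

context
  fixes x assumes x: "x \<in> W"
begin

abbreviation "T \<equiv> tangent_fibre f x"
abbreviation "N \<equiv> normal_fibre f x"

text \<open>On tangent vectors this is the second fundamental form. Precomposition with the
  tangential projection makes it bilinear on the whole ambient space, as the locale
  \<open>cubic_form\<close> requires; \<open>cubic\<close> projects its third argument for the same
  reason.\<close>

definition hess :: "complex^4 \<Rightarrow> complex^4 \<Rightarrow> complex^4"
  where "hess X Y = normal_part f x (dd (tangent_coords f x X) (dd (tangent_coords f x Y) f) x)"

definition cubic :: "complex^4 \<Rightarrow> complex^4 \<Rightarrow> complex^4 \<Rightarrow> real"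
  where "cubic X Y Z = hess X Y \<bullet> cplx_J (dd (tangent_coords f x Z) f x)"

lemma dd_coords: "X \<in> T \<Longrightarrow> dd (tangent_coords f x X) f x = X"
  by (auto simp: mem_tangent_fibre dd_tangent_coords[OF x] normal_part_of_tangent[OF x])

lemma J_mem: "X \<in> T \<Longrightarrow> cplx_J X \<in> N"
  using bij_J[OF x] by (auto simp: bij_betw_def)

lemma hess_mem: "hess X Y \<in> N"
  unfolding hess_def by (rule normal_part_decomp(1)[OF x])

lemma linear_hess1: "linear (\<lambda>X. hess X Y)"
  using linear_compose[OF linear_tangent_coords[OF x] linear_compose[OF linear_hess_left[OF x] linear_normal_part[OF x]]]
  unfolding hess_def o_def .

lemma hess_sym: "hess X Y = hess Y X"
  by (simp add: hess_def hess_commute[OF x])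

lemma linear_hess2: "linear (hess X)"
  using linear_hess1[of X] unfolding hess_sym[of _ X] .

lemma cubic_eq: "Z \<in> T \<Longrightarrow> cubic X Y Z = hess X Y \<bullet> cplx_J Z"
  by (simp add: cubic_def dd_coords)

lemma cubic_form_cubic: "cubic_form cubic"
proof (rule cubic_form.intro)
  show "linear (\<lambda>X. cubic X Y Z)" for Y Z
    using linear_compose[OF linear_hess1 bounded_linear.linear[OF bounded_linear_inner_left]]
    unfolding cubic_def o_def .
  show "cubic X Y Z = cubic Y X Z" for X Y Z
    by (simp add: cubic_def hess_sym)
  have "cubic X Y Z = dd (tangent_coords f x X) (dd (tangent_coords f x Y) f) x
      \<bullet> cplx_J (dd (tangent_coords f x Z) f x)" for X Y Z
    unfolding cubic_def hess_def
    by (rule normal_part_inner[OF x J_mem]) (auto simp: mem_tangent_fibre)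
  then show "cubic X Y Z = cubic X Z Y" for X Y Z
    by (simp add: hess_J_commute[OF x])
qed

lemma gauss:
  assumes "X \<in> T" "Y \<in> T" "Z \<in> T" "V \<in> T"
  shows "riemann f x X Y Z \<bullet> V = hess Y Z \<bullet> hess X V - hess X Z \<bullet> hess Y V"
  using gauss_equation[OF x, of "tangent_coords f x X" "tangent_coords f x Y" "tangent_coords f x Z"
      "tangent_coords f x V"]
  by (simp add: dd_coords assms hess_def)

lemma onb_J:
  assumes "orthonormal_basis 4 E T"
  shows "orthonormal_basis 4 (\<lambda>i. cplx_J (E i)) N"
proof (rule onbI)
  have "N = cplx_J ` T" "inj_on cplx_J (span T)"
    using bij_J[OF x] subspace_tangent[OF x] by (auto simp: bij_betw_def span_eq_iff[THEN iffD2])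
  then show "dim N = 4"
    using dim_image_eq[OF linear_cplx_J, of T] dim_tangent[OF x] by simp
qed (use onb_inner[OF assms] onb_mem[OF assms] J_mem subspace_normal[OF x] in \<open>auto simp: inner_cplx_J\<close>)

text \<open>The right-hand side of the Ricci equation with the frame \<open>E\<close> of the inner
  summation held fixed, so that it is linear in each of the four vectors and their frames can be
  exchanged independently.\<close>

definition ricci_form :: "(nat \<Rightarrow> complex^4) \<Rightarrow> complex^4 \<Rightarrow> complex^4 \<Rightarrow> complex^4 \<Rightarrow> complex^4 \<Rightarrow> real"
  where "ricci_form E X Y U V = (\<Sum>m\<in>{1..4}. (hess X (E m) \<bullet> V) * (hess Y (E m) \<bullet> U)
    - (hess Y (E m) \<bullet> V) * (hess X (E m) \<bullet> U))"

text \<open>\<open>ricci_aux\<close> yields second fundamental forms applied to shape operators;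
  expanding the shape operator's value in \<open>E\<close> turns each composition into a sum over
  \<open>m\<close>.\<close>

lemma ricci:
  assumes E: "orthonormal_basis 4 E T" and X: "X \<in> T" and Y: "Y \<in> T" and U: "U \<in> N" and V: "V \<in> N"
  shows "normal_curv f x X Y U \<bullet> V = ricci_form E X Y U V"
proof -
  let ?c = "\<lambda>y. tangent_coords f y U" and ?P = "tangent_coords f x"
  have D: "normal_part f x (dd (?P Y) (dd (dd (?P X) ?c x) f) x) \<bullet> V
      = (\<Sum>m\<in>{1..4}. (hess X (E m) \<bullet> U) * (hess Y (E m) \<bullet> V))" if X: "X \<in> T" for X Y
  proof -
    let ?Z = "dd (dd (?P X) ?c x) f x"
    have Z: "?Z \<in> T" by (auto simp: mem_tangent_fibre)
    have "?P ?Z = dd (?P X) ?c x"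
      using dd_f_inject[OF x] dd_coords[OF Z] by blast
    then have "normal_part f x (dd (?P Y) (dd (dd (?P X) ?c x) f) x) = hess Y ?Z"
      by (simp add: hess_def)
    also have "\<dots> = hess Y (\<Sum>m\<in>{1..4}. (?Z \<bullet> E m) *\<^sub>R E m)"
      by (rule arg_cong[OF onb_expansion[OF E Z]])
    also have "\<dots> = (\<Sum>m\<in>{1..4}. (?Z \<bullet> E m) *\<^sub>R hess Y (E m))"
      by (simp only: linear_sum[OF linear_hess2] linear_cmul[OF linear_hess2])
    also have "\<dots> = (\<Sum>m\<in>{1..4}. (hess X (E m) \<bullet> U) *\<^sub>R hess Y (E m))"
    proof (intro sum.cong refl arg_cong2[of _ _ _ _ scaleR])
      fix m :: nat assume m: "m \<in> {1..4}"
      show "?Z \<bullet> E m = hess X (E m) \<bullet> U"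
        using ricci_aux(2)[OF x U V, of "?P X" "?P (E m)"]
        by (simp add: dd_coords[OF onb_mem[OF E m]] hess_def inner_commute)
    qed
    finally show ?thesis by (simp add: inner_sum_left)
  qed
  have "normal_curv f x X Y U \<bullet> V =
      (\<Sum>m\<in>{1..4}. (hess Y (E m) \<bullet> U) * (hess X (E m) \<bullet> V))
      - (\<Sum>m\<in>{1..4}. (hess X (E m) \<bullet> U) * (hess Y (E m) \<bullet> V))"
  proof -
    have c: "coords f x X = ?P X" "coords f x Y = ?P Y"
      using X Y by (auto simp: mem_tangent_fibre coords_dd_f[OF x] tangent_coords_def normal_part_of_tangent[OF x])
    show ?thesis
      unfolding normal_curv_def Let_def c inner_diff_left ricci_aux(1)[OF x U V] D[OF X] D[OF Y] by simp
  qed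
  then show ?thesis by (simp add: ricci_form_def sum_subtractf mult.commute)
qed

lemma linear_ricci_form:
  "linear (\<lambda>X. ricci_form E X Y U V)" "linear (\<lambda>Y. ricci_form E X Y U V)"
  "linear (\<lambda>U. ricci_form E X Y U V)" "linear (\<lambda>V. ricci_form E X Y U V)"
  unfolding ricci_form_def
  by (rule linearI; simp add: linear_add[OF linear_hess1] linear_cmul[OF linear_hess1] inner_add_left
      inner_add_right sum.distrib[symmetric] sum_distrib_left algebra_simps)+

lemma ricci_form_antisym: "ricci_form E X Y U V = - ricci_form E Y X U V"
    "ricci_form E X Y U V = - ricci_form E X Y V U"
  unfolding ricci_form_def by (simp_all add: sum_negf[symmetric] mult.commute)

text \<open>By antisymmetry the defining sum is a quarter of the sum over all indices, which is
  invariant in each pair of slots. The normal frame \<open>u\<close> is replaced by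
  \<open>J E\<close> and the tangent frame \<open>e\<close> by \<open>E\<close>; only then are
  tangent and normal frames linked.\<close>

lemma norm_normal_scal_eq:
  assumes E: "orthonormal_basis 4 E T" and e: "orthonormal_basis 4 e T" and u: "orthonormal_basis 4 u N"
  shows "norm_normal_scal f x e u = (1/6) * sqrt (nscal_coeffs (\<lambda>i j k. cubic (E i) (E j) (E k)))"
proof -
  let ?K = "ricci_form E" and ?J = "\<lambda>i. cplx_J (E i)"
  let ?half = "\<lambda>e u. \<Sum>i\<in>{1..4}. \<Sum>j\<in>{i<..4}. \<Sum>a\<in>{1..4}. \<Sum>b\<in>{a<..4}. (?K (e i) (e j) (u a) (u b))\<^sup>2"
  let ?full = "\<lambda>e u. \<Sum>i\<in>{1..4}. \<Sum>j\<in>{1..4}. \<Sum>a\<in>{1..4}. \<Sum>b\<in>{1..4}. (?K (e i) (e j) (u a) (u b))\<^sup>2"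
  have a1: "(?K X Y U V)\<^sup>2 = (?K Y X U V)\<^sup>2" and a2: "(?K X Y U V)\<^sup>2 = (?K X Y V U)\<^sup>2"
    and a3: "(?K X X U V)\<^sup>2 = 0" and a4: "(?K X Y U U)\<^sup>2 = 0" for X Y U V
    using ricci_form_antisym(1)[of E X Y U V] ricci_form_antisym(2)[of E X Y U V]
      ricci_form_antisym(1)[of E X X U V] ricci_form_antisym(2)[of E X Y U U] by auto
  have half: "?half e u = ?full e u / 4" for e u :: "nat \<Rightarrow> complex^4"
  proof -
    have "(\<Sum>a\<in>{1..4}. \<Sum>b\<in>{a<..4}. (?K X Y (u a) (u b))\<^sup>2)
        = (\<Sum>a\<in>{1..4}. \<Sum>b\<in>{1..4}. (?K X Y (u a) (u b))\<^sup>2) / 2" for X Y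
      by (rule symmetric_sum_half) (rule a2, rule a4)
    then have "?half e u = (\<Sum>i\<in>{1..4}. \<Sum>j\<in>{i<..4}. (\<Sum>a\<in>{1..4}. \<Sum>b\<in>{1..4}. (?K (e i) (e j) (u a) (u b))\<^sup>2) / 2)"
      by (simp only:)
    also have "\<dots> = (\<Sum>i\<in>{1..4}. \<Sum>j\<in>{1..4}. (\<Sum>a\<in>{1..4}. \<Sum>b\<in>{1..4}. (?K (e i) (e j) (u a) (u b))\<^sup>2) / 2) / 2"
    proof (rule symmetric_sum_half)
      fix i j
      show "(\<Sum>a\<in>{1..4}. \<Sum>b\<in>{1..4}. (?K (e i) (e j) (u a) (u b))\<^sup>2) / 2
          = (\<Sum>a\<in>{1..4}. \<Sum>b\<in>{1..4}. (?K (e j) (e i) (u a) (u b))\<^sup>2) / 2"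
        unfolding a1[of "e i" "e j"] ..
      show "(\<Sum>a\<in>{1..4}. \<Sum>b\<in>{1..4}. (?K (e i) (e i) (u a) (u b))\<^sup>2) / 2 = 0"
        unfolding a3 by simp
    qed
    also have "\<dots> = ?full e u / 4"
      by (simp add: sum_divide_distrib[symmetric])
    finally show ?thesis .
  qed
  have "?full e u = (\<Sum>i\<in>{1..4}. \<Sum>j\<in>{1..4}. \<Sum>a\<in>{1..4}. \<Sum>b\<in>{1..4}. (?K (e i) (e j) (?J a) (?J b))\<^sup>2)"
    by (intro sum.cong refl onb_sum_squares2[OF _ _ u onb_J[OF E]] linear_ricci_form)
  also have "\<dots> = (\<Sum>a\<in>{1..4}. \<Sum>b\<in>{1..4}. \<Sum>i\<in>{1..4}. \<Sum>j\<in>{1..4}. (?K (e i) (e j) (?J a) (?J b))\<^sup>2)"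
    by (rule sum_swap_pairs)
  also have "\<dots> = (\<Sum>a\<in>{1..4}. \<Sum>b\<in>{1..4}. \<Sum>i\<in>{1..4}. \<Sum>j\<in>{1..4}. (?K (E i) (E j) (?J a) (?J b))\<^sup>2)"
    by (intro sum.cong refl onb_sum_squares2[OF _ _ e E] linear_ricci_form)
  also have "\<dots> = ?full E ?J"
    by (rule sum_swap_pairs)
  finally have inv: "?half e u = ?half E ?J" unfolding half by simp
  have "(\<Sum>i\<in>{1..4}. \<Sum>j\<in>{i<..4}. \<Sum>a\<in>{1..4}. \<Sum>b\<in>{a<..4}.
      (normal_curv f x (e i) (e j) (u a) \<bullet> u b)\<^sup>2) = ?half e u"
  proof (intro sum.cong refl)
    fix i j a b :: nat assume "i \<in> {1..4}" "j \<in> {i<..4}" "a \<in> {1..4}" "b \<in> {a<..4}"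
    then have "e i \<in> T" "e j \<in> T" "u a \<in> N" "u b \<in> N"
      using onb_mem[OF e] onb_mem[OF u] by auto
    then show "(normal_curv f x (e i) (e j) (u a) \<bullet> u b)\<^sup>2 = (?K (e i) (e j) (u a) (u b))\<^sup>2"
      by (simp only: ricci[OF E])
  qed
  moreover have "?half E ?J = nscal_coeffs (\<lambda>i j k. cubic (E i) (E j) (E k))"
    unfolding nscal_coeffs_def
  proof (intro sum.cong refl)
    fix i j a b :: nat assume "i \<in> {1..4}" "j \<in> {i<..4}" "a \<in> {1..4}" "b \<in> {a<..4}"
    then have "E a \<in> T" "E b \<in> T" using onb_mem[OF E] by auto
    then show "(?K (E i) (E j) (?J a) (?J b))\<^sup>2 = (ncurv_coeffs (\<lambda>i j k. cubic (E i) (E j) (E k)) i j a b)\<^sup>2"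
      by (simp only: ricci_form_def ncurv_coeffs_def cubic_eq)
  qed
  ultimately show ?thesis
    using inv by (simp only: norm_normal_scal_def)
qed

text \<open>Contracting the Gauss equation gives the squared length of the trace of
  \<open>hess\<close> minus its squared norm. Both are traces, so \<open>e\<close> may be exchanged
  for \<open>E\<close>, and expansion in the normal frame \<open>J E\<close> produces the
  coefficients.\<close>

lemma norm_scal_eq:
  assumes E: "orthonormal_basis 4 E T" and e: "orthonormal_basis 4 e T"
  shows "norm_scal f x e = (1/6) * scal_coeffs (\<lambda>i j k. cubic (E i) (E j) (E k))"
proof -
  let ?g = "\<lambda>e i j. hess (e j) (e j) \<bullet> hess (e i) (e i) - hess (e i) (e j) \<bullet> hess (e i) (e j)"
  let ?tr = "\<lambda>e. \<Sum>i\<in>{1..4}. hess (e i) (e i)"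
  let ?sq = "\<lambda>e. \<Sum>i\<in>{1..4}. \<Sum>j\<in>{1..4}. hess (e i) (e j) \<bullet> hess (e i) (e j)"
  have sub: "{i<..4} \<subseteq> {1..4::nat}" if "i \<in> {1..4}" for i using that by auto
  have "(\<Sum>i\<in>{1..4}. \<Sum>j\<in>{i<..4}. riemann f x (e i) (e j) (e j) \<bullet> e i) = (\<Sum>i\<in>{1..4}. \<Sum>j\<in>{i<..4}. ?g e i j)"
  proof (intro sum.cong refl)
    fix i j :: nat assume "i \<in> {1..4}" "j \<in> {i<..4}"
    then have "e i \<in> T" "e j \<in> T" using onb_mem[OF e] by auto
    then show "riemann f x (e i) (e j) (e j) \<bullet> e i = ?g e i j"
      by (simp add: gauss hess_sym[of "e j" "e i"])
  qed
  also have "\<dots> = (\<Sum>i\<in>{1..4}. \<Sum>j\<in>{1..4}. ?g e i j) / 2"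
    by (rule symmetric_sum_half) (simp_all add: inner_commute hess_sym)
  also have "(\<Sum>i\<in>{1..4}. \<Sum>j\<in>{1..4}. ?g e i j) = ?tr e \<bullet> ?tr e - ?sq e"
    by (simp only: inner_sum_left inner_sum_right sum_subtractf inner_commute)
  also have "?tr e = ?tr E"
    by (rule onb_trace[OF linear_hess1 linear_hess2 e E])
  also have "?sq e = ?sq E"
  proof -
    have lin: "linear (\<lambda>X. hess X Y \<bullet> c)" "linear (\<lambda>X. c \<bullet> hess X Y)"
      "linear (\<lambda>X. hess Y X \<bullet> c)" "linear (\<lambda>X. c \<bullet> hess Y X)" for Y c
      by (rule linearI; simp add: linear_add[OF linear_hess1] linear_cmul[OF linear_hess1]
          linear_add[OF linear_hess2] linear_cmul[OF linear_hess2] inner_add_left inner_add_right)+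
    have "?sq e = (\<Sum>i\<in>{1..4}. \<Sum>j\<in>{1..4}. hess (e i) (E j) \<bullet> hess (e i) (E j))"
      by (intro sum.cong refl onb_trace[OF _ _ e E, of "\<lambda>X Y. hess (e i) X \<bullet> hess (e i) Y" for i] lin)
    also have "\<dots> = (\<Sum>j\<in>{1..4}. \<Sum>i\<in>{1..4}. hess (e i) (E j) \<bullet> hess (e i) (E j))"
      by (rule sum.swap)
    also have "\<dots> = (\<Sum>j\<in>{1..4}. \<Sum>i\<in>{1..4}. hess (E i) (E j) \<bullet> hess (E i) (E j))"
      by (intro sum.cong refl onb_trace[OF _ _ e E, of "\<lambda>X Y. hess X (E j) \<bullet> hess Y (E j)" for j] lin)
    also have "\<dots> = ?sq E" by (rule sum.swap)
    finally show ?thesis .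
  qed
  also have "?tr E \<bullet> ?tr E = (\<Sum>k\<in>{1..4}. (\<Sum>i\<in>{1..4}. cubic (E i) (E i) (E k))\<^sup>2)"
  proof -
    have "?tr E \<in> N" by (intro subspace_sum subspace_normal[OF x] hess_mem)
    from onb_inner_sum[OF onb_J[OF E] this, of "?tr E"] show ?thesis
      by (simp add: inner_sum_left cubic_eq[OF onb_mem[OF E]] power2_eq_square)
  qed
  also have "?sq E = (\<Sum>i\<in>{1..4}. \<Sum>j\<in>{1..4}. \<Sum>k\<in>{1..4}. (cubic (E i) (E j) (E k))\<^sup>2)"
  proof (intro sum.cong refl)
    fix i j
    have "hess (E i) (E j) \<bullet> hess (E i) (E j) =
        (\<Sum>k\<in>{1..4}. (hess (E i) (E j) \<bullet> cplx_J (E k)) * (hess (E i) (E j) \<bullet> cplx_J (E k)))"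
      by (rule onb_inner_sum[OF onb_J[OF E] hess_mem])
    also have "\<dots> = (\<Sum>k\<in>{1..4}. (cubic (E i) (E j) (E k))\<^sup>2)"
      by (rule sum.cong[OF refl]) (simp only: cubic_eq[OF onb_mem[OF E]] power2_eq_square)
    finally show "hess (E i) (E j) \<bullet> hess (E i) (E j) = (\<Sum>k\<in>{1..4}. (cubic (E i) (E j) (E k))\<^sup>2)" .
  qed
  finally show ?thesis by (simp add: norm_scal_def scal_coeffs_def)
qed

lemma shape_matrix_cubic:
  assumes "orthonormal_basis 4 E T" "i \<in> {1..4}" "j \<in> {1..4}" "k \<in> {1..4}"
  shows "shape_matrix f x E (cplx_J (E k)) i j = cubic (E i) (E j) (E k)"
proof -
  note m = onb_mem[OF assms(1)]
  have op: "shape_op f x U (E j) \<bullet> E i = hess (E i) (E j) \<bullet> U" if "U \<in> N" for U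
    using shape_op_dd[OF x that, of "tangent_coords f x (E j)" "tangent_coords f x (E i)"]
    unfolding dd_coords[OF m[OF assms(2)]] dd_coords[OF m[OF assms(3)]]
    by (simp add: hess_def hess_commute[OF x])
  show ?thesis
    unfolding shape_matrix_def cubic_eq[OF m[OF assms(4)]] by (rule op[OF J_mem[OF m[OF assms(4)]]])
qed

lemma special_coeffs_shape:
  assumes "orthonormal_basis 4 E T"
  shows "special_coeffs (\<lambda>i j k. cubic (E i) (E j) (E k)) a b \<longleftrightarrow>
    (\<forall>i\<in>{1..4}. \<forall>j\<in>{1..4}.
      shape_matrix f x E (cplx_J (E 1)) i j =
        matrix_rows [[a, b, 0, 0], [b, -a, 0, 0], [0, 0, 0, 0], [0, 0, 0, 0]] i j \<and>
      shape_matrix f x E (cplx_J (E 2)) i j =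
        matrix_rows [[b, -a, 0, 0], [-a, -b, 0, 0], [0, 0, 0, 0], [0, 0, 0, 0]] i j \<and>
      shape_matrix f x E (cplx_J (E 3)) i j = 0 \<and>
      shape_matrix f x E (cplx_J (E 4)) i j = 0)"
  unfolding special_coeffs_def
  by (intro ball_cong refl) (simp del: One_nat_def add: shape_matrix_cubic[OF assms])

lemma frame_estimate_exists:
  assumes E: "orthonormal_basis 4 E T" and U: "orthonormal_basis 4 U N"
    and ns: "ns \<noteq> []" "\<forall>k\<in>set ns. 1 \<le> (k::nat)" "sum_list ns \<le> 4" "hd ns \<noteq> 4"
    and blocks: "\<And>\<alpha>. \<alpha> \<in> {1..4} \<Longrightarrow> traceless_block_diag 4 ns (shape_matrix f x E (U \<alpha>))"
  obtains F where "orthonormal_basis 4 F T" "cubic_form.frame_estimate cubic T F"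
proof -
  interpret C: cubic_form cubic by (rule cubic_form_cubic)
  let ?c = "\<lambda>i j k. cubic (E i) (E j) (E k)"
  let ?A = "\<lambda>\<alpha>. shape_matrix f x E (U \<alpha>)"
  \<comment> \<open>For fixed \<open>k\<close>, expanding \<open>cplx_J (E k)\<close> in the given
    normal frame makes the coefficient matrix a linear combination of the shape matrices; common
    zeros and vanishing partial traces pass to it.\<close>
  have comb: "?c i j k = (\<Sum>\<alpha>\<in>{1..4}. (cplx_J (E k) \<bullet> U \<alpha>) * ?A \<alpha> i j)"
    if "i \<in> {1..4}" "j \<in> {1..4}" "k \<in> {1..4}" for i j k
  proof -
    note m = onb_mem[OF E]
    have A: "?A \<alpha> i j = hess (E i) (E j) \<bullet> U \<alpha>" if "\<alpha> \<in> {1..4}" for \<alpha>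
      using shape_op_dd[OF x onb_mem[OF U that], of "tangent_coords f x (E j)" "tangent_coords f x (E i)"]
        \<open>i \<in> {1..4}\<close> \<open>j \<in> {1..4}\<close>
      by (simp add: shape_matrix_def dd_coords m hess_def hess_commute[OF x])
    have "?c i j k = cplx_J (E k) \<bullet> hess (E i) (E j)"
      using that by (simp add: cubic_eq m inner_commute)
    also have "\<dots> = (\<Sum>\<alpha>\<in>{1..4}. (cplx_J (E k) \<bullet> U \<alpha>) * (hess (E i) (E j) \<bullet> U \<alpha>))"
      by (rule onb_inner_sum[OF U J_mem[OF m[OF that(3)]]])
    finally show ?thesis by (simp add: A)
  qed
  have zero: "?c i j k = 0" if "\<And>\<alpha>. \<alpha> \<in> {1..4} \<Longrightarrow> ?A \<alpha> i j = 0" "i \<in> {1..4}" "j \<in> {1..4}" "k \<in> {1..4}" for i j k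
    using that by (simp add: comb)
  have zsum: "(\<Sum>i\<in>I. ?c i i k) = 0"
    if "\<And>\<alpha>. \<alpha> \<in> {1..4} \<Longrightarrow> (\<Sum>i\<in>I. ?A \<alpha> i i) = 0" "I \<subseteq> {1..4}" "k \<in> {1..4}" for I k
  proof -
    have "(\<Sum>i\<in>I. ?c i i k) = (\<Sum>i\<in>I. \<Sum>\<alpha>\<in>{1..4}. (cplx_J (E k) \<bullet> U \<alpha>) * ?A \<alpha> i i)"
      using that by (intro sum.cong comb) auto
    also have "\<dots> = (\<Sum>\<alpha>\<in>{1..4}. (cplx_J (E k) \<bullet> U \<alpha>) * (\<Sum>i\<in>I. ?A \<alpha> i i))"
      by (subst sum.swap) (simp add: sum_distrib_left)
    finally show ?thesis using that(1) by simp
  qed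
  show thesis
  proof (rule block_shape_cases[OF ns])
    assume *: "\<And>A. traceless_block_diag 4 ns A \<Longrightarrow>
      (\<forall>j\<in>{1..4}. A 4 j = 0) \<and> A 1 1 + A 2 2 + A 3 3 = 0"
    have I: "{1..3} = {1, 2, 3::nat}" by auto
    show thesis
    proof (rule C.frame_estimate_space[OF E _ _ that])
      show "cubic (E 4) (E j) (E k) = 0" if "j \<in> {1..4}" "k \<in> {1..4}" for j k
        using that *[OF blocks] by (intro zero) auto
      show "(\<Sum>i\<in>{1..3}. cubic (E i) (E i) (E k)) = 0" if "k \<in> {1..4}" for k
      proof (rule zsum[OF _ _ that])
        show "(\<Sum>i\<in>{1..3}. ?A \<alpha> i i) = 0" if "\<alpha> \<in> {1..4}" for \<alpha>
          using *[OF blocks[OF that]] unfolding I by simp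
      qed auto
    qed
  next
    assume *: "\<And>A. traceless_block_diag 4 ns A \<Longrightarrow>
      (\<forall>j\<in>{1..4}. A 1 j = 0) \<and> A 2 2 + A 3 3 + A 4 4 = 0"
    \<comment> \<open>The annihilated vector \<open>E 1\<close> is moved to position 4, where
      \<open>frame_estimate_space\<close> expects it.\<close>
    obtain G where G: "orthonormal_basis 4 G T" "G 1 = E 2" "G 2 = E 3" "G 3 = E 4" "G 4 = E 1"
      by (rule onb_reorder[OF E, of 2 3 4 1]) auto
    have GE: "\<exists>i'\<in>{1..4}. G i = E i'" if "i \<in> {1..4}" for i
    proof -
      have "i = 1 \<or> i = 2 \<or> i = 3 \<or> i = 4" using that by auto
      then show ?thesis using G(2-5) by fastforce
    qed
    have I: "{1..3} = {1, 2, 3::nat}" by auto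
    show thesis
    proof (rule C.frame_estimate_space[OF G(1) _ _ that])
      show "cubic (G 4) (G j) (G k) = 0" if jk: "j \<in> {1..4}" "k \<in> {1..4}" for j k
      proof -
        obtain j' k' where "j' \<in> {1..4}" "G j = E j'" "k' \<in> {1..4}" "G k = E k'"
          using GE jk by meson
        then show ?thesis
          unfolding G(5) using *[OF blocks] by (simp only:) (intro zero, auto)
      qed
      show "(\<Sum>i\<in>{1..3}. cubic (G i) (G i) (G k)) = 0" if "k \<in> {1..4}" for k
      proof -
        obtain k' where k': "k' \<in> {1..4}" "G k = E k'" using GE \<open>k \<in> {1..4}\<close> by blast
        have "(\<Sum>i\<in>{2, 3, 4}. ?c i i k') = 0"
        proof (rule zsum[OF _ _ k'(1)])
          show "(\<Sum>i\<in>{2, 3, 4}. ?A \<alpha> i i) = 0" if "\<alpha> \<in> {1..4}" for \<alpha>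
            using *[OF blocks[OF that]] by simp
        qed auto
        then show ?thesis unfolding I k' using G(2-4) by simp
      qed
    qed
  next
    assume *: "\<And>A. traceless_block_diag 4 ns A \<Longrightarrow>
      A 1 3 = 0 \<and> A 1 4 = 0 \<and> A 2 3 = 0 \<and> A 2 4 = 0 \<and> A 1 1 + A 2 2 = 0 \<and> A 3 3 + A 4 4 = 0"
    have "C.frame_estimate T E"
    proof (rule C.frame_estimate_planes[OF E])
      show "?c i j k = 0" if "i \<in> {1, 2}" "j \<in> {3, 4}" "k \<in> {1..4}" for i j k
        using that *[OF blocks] by (intro zero) auto
      show "?c 1 1 k + ?c 2 2 k = 0" if "k \<in> {1..4}" for k
      proof -
        have "(\<Sum>i\<in>{1, 2}. ?c i i k) = 0"
          by (rule zsum[OF _ _ that]) (use *[OF blocks] in auto)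
        then show ?thesis by simp
      qed
      show "?c 3 3 k + ?c 4 4 k = 0" if "k \<in> {1..4}" for k
      proof -
        have "(\<Sum>i\<in>{3, 4}. ?c i i k) = 0"
          by (rule zsum[OF _ _ that]) (use *[OF blocks] in auto)
        then show ?thesis by simp
      qed
    qed
    then show thesis using E that by blast
  qed
qed

end
end

theorem theorem4p4:
  fixes M :: "'m topology" and \<phi> :: "'m \<Rightarrow> complex^4"
    and W :: "(real^4) set" and \<sigma> :: "real^4 \<Rightarrow> 'm" and x :: "real^4" and p :: 'm
    and e u :: "nat \<Rightarrow> complex^4"
  assumes "immersed_submanifold TYPE(4) M \<phi>"
    and "lagrangian M \<phi>"
    and "ultra_minimal TYPE(4) M \<phi>"
    and "p \<in> topspace M"
    and "local_param M \<phi> W \<sigma>" and "x \<in> W" and "\<sigma> x = p"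
    and "orthonormal_basis 4 e (tangent_fibre (\<phi> \<circ> \<sigma>) x)"
    and "orthonormal_basis 4 u (normal_fibre (\<phi> \<circ> \<sigma>) x)"
  shows "norm_scal (\<phi> \<circ> \<sigma>) x e \<le> - norm_normal_scal (\<phi> \<circ> \<sigma>) x e u \<and>
    (norm_scal (\<phi> \<circ> \<sigma>) x e = - norm_normal_scal (\<phi> \<circ> \<sigma>) x e u \<longleftrightarrow>
      (\<exists>E a b. orthonormal_basis 4 E (tangent_fibre (\<phi> \<circ> \<sigma>) x) \<and>
        (\<forall>i\<in>{1..4}. \<forall>j\<in>{1..4}.
          shape_matrix (\<phi> \<circ> \<sigma>) x E (cplx_J (E 1)) i j =
            matrix_rows [[a, b, 0, 0], [b, -a, 0, 0], [0, 0, 0, 0], [0, 0, 0, 0]] i j \<and>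
          shape_matrix (\<phi> \<circ> \<sigma>) x E (cplx_J (E 2)) i j =
            matrix_rows [[b, -a, 0, 0], [-a, -b, 0, 0], [0, 0, 0, 0], [0, 0, 0, 0]] i j \<and>
          shape_matrix (\<phi> \<circ> \<sigma>) x E (cplx_J (E 3)) i j = 0 \<and>
          shape_matrix (\<phi> \<circ> \<sigma>) x E (cplx_J (E 4)) i j = 0)))"
proof -
  let ?f = "\<phi> \<circ> \<sigma>"
  interpret lagrangian_immersion W ?f
    using assms(2,5) local_param_immersion[OF assms(5)]
    by (auto simp: lagrangian_def lagrangian_immersion_def lagrangian_immersion_axioms_def)
  note x = \<open>x \<in> W\<close>
  interpret C: cubic_form "cubic x" by (rule cubic_form_cubic[OF x])
  let ?c = "\<lambda>E i j k. cubic x (E i) (E j) (E k)"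
  \<comment> \<open>The real dimension of the ambient space is 8, so the codimension is 4 and both
    frames have four members.\<close>
  have "\<exists>(W' :: (real^4) set) \<sigma>' E U ns. local_param M \<phi> W' \<sigma>' \<and> p \<in> \<sigma>' ` W' \<and>
      ns \<noteq> [] \<and> (\<forall>k\<in>set ns. 1 \<le> k) \<and> sum_list ns \<le> 4 \<and> hd ns \<noteq> 4 \<and>
      (\<forall>x\<in>W'. orthonormal_basis 4 (\<lambda>i. E i x) (tangent_fibre (\<phi> \<circ> \<sigma>') x) \<and>
        orthonormal_basis 4 (\<lambda>\<alpha>. U \<alpha> x) (normal_fibre (\<phi> \<circ> \<sigma>') x) \<and>
        (\<forall>\<alpha>\<in>{1..4}. traceless_block_diag 4 ns (shape_matrix (\<phi> \<circ> \<sigma>') x (\<lambda>i. E i x) (U \<alpha> x))))"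
    using assms(3)[unfolded ultra_minimal_def, rule_format, OF assms(4)] by simp blast
  then obtain W' :: "(real^4) set" and \<sigma>' E U ns x'
    where p': "local_param M \<phi> W' \<sigma>'" and x': "x' \<in> W'" "\<sigma>' x' = p"
      and ns: "ns \<noteq> []" "\<forall>k\<in>set ns. 1 \<le> k" "sum_list ns \<le> 4" "hd ns \<noteq> 4"
      and E': "orthonormal_basis 4 (\<lambda>i. E i x') (tangent_fibre (\<phi> \<circ> \<sigma>') x')"
      and U': "orthonormal_basis 4 (\<lambda>\<alpha>. U \<alpha> x') (normal_fibre (\<phi> \<circ> \<sigma>') x')"
      and blocks': "\<And>\<alpha>. \<alpha> \<in> {1..4} \<Longrightarrow>
        traceless_block_diag 4 ns (shape_matrix (\<phi> \<circ> \<sigma>') x' (\<lambda>i. E i x') (U \<alpha> x'))"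
    by blast
  \<comment> \<open>The frames are given in the chart \<open>\<sigma>'\<close>, the claim in the
    chart \<open>\<sigma>\<close>; this transports tangent space, normal space and shape operators
    between them at the same point.\<close>
  interpret R: reparametrization W ?f W' "\<phi> \<circ> \<sigma>'" x x' "\<lambda>y. inv_into W \<sigma> (\<sigma>' y)"
    using local_param_reparametrization[OF assms(5) p' x x'(1)] assms(7) x'(2) by simp
  have E: "orthonormal_basis 4 (\<lambda>i. E i x') (tangent_fibre ?f x)"
    and U: "orthonormal_basis 4 (\<lambda>\<alpha>. U \<alpha> x') (normal_fibre ?f x)"
    using E' U' by (simp_all only: R.tangent_fibre_eq R.normal_fibre_eq)
  have "traceless_block_diag 4 ns (shape_matrix ?f x (\<lambda>i. E i x') (U \<alpha> x'))" if "\<alpha> \<in> {1..4}" for \<alpha>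
  proof -
    have "shape_matrix (\<phi> \<circ> \<sigma>') x' (\<lambda>i. E i x') (U \<alpha> x') i j = shape_matrix ?f x (\<lambda>i. E i x') (U \<alpha> x') i j"
      if "j \<in> {1..4}" for i j
      unfolding shape_matrix_def by (simp only: R.shape_op_eq[OF onb_mem[OF E that]])
    then show ?thesis
      using traceless_block_diag_cong[OF ns(3)] blocks'[OF \<open>\<alpha> \<in> {1..4}\<close>] by blast
  qed
  from frame_estimate_exists[OF x E U ns this]
  obtain F where F: "orthonormal_basis 4 F (tangent_fibre ?f x)"
    and est: "C.frame_estimate (tangent_fibre ?f x) F" by blast
  \<comment> \<open>The left-hand sides do not involve \<open>G\<close>, so the formulas may be used
    with \<open>F\<close> for the estimate and with the special frame for the converse.\<close>
  have scal: "norm_scal ?f x e = (1/6) * scal_coeffs (?c G)"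
    and nscal: "norm_normal_scal ?f x e u = (1/6) * sqrt (nscal_coeffs (?c G))"
    if "orthonormal_basis 4 G (tangent_fibre ?f x)" for G
    using norm_scal_eq[OF x that assms(8)] norm_normal_scal_eq[OF x that assms(8,9)] .
  have neg: "scal_coeffs (?c F) \<le> 0" and le: "nscal_coeffs (?c F) \<le> (scal_coeffs (?c F))\<^sup>2"
    and eq: "nscal_coeffs (?c F) = (scal_coeffs (?c F))\<^sup>2 \<Longrightarrow>
      \<exists>G a b. orthonormal_basis 4 G (tangent_fibre ?f x) \<and> special_coeffs (?c G) a b"
    using est unfolding C.frame_estimate_def Let_def by blast+
  have pos: "nscal_coeffs (?c F) \<ge> 0"
    unfolding nscal_coeffs_def by (intro sum_nonneg zero_le_power2)
  have "sqrt (nscal_coeffs (?c F)) \<le> - scal_coeffs (?c F)"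
    using neg le by (intro real_le_lsqrt) auto
  moreover have "(\<exists>G a b. orthonormal_basis 4 G (tangent_fibre ?f x) \<and> special_coeffs (?c G) a b)"
    if "norm_scal ?f x e = - norm_normal_scal ?f x e u"
  proof (rule eq)
    have "sqrt (nscal_coeffs (?c F)) = - scal_coeffs (?c F)"
      using that unfolding scal[OF F] nscal[OF F] by simp
    then have "(sqrt (nscal_coeffs (?c F)))\<^sup>2 = (scal_coeffs (?c F))\<^sup>2" by simp
    then show "nscal_coeffs (?c F) = (scal_coeffs (?c F))\<^sup>2" using pos by simp
  qed
  moreover have "norm_scal ?f x e = - norm_normal_scal ?f x e u"
    if G: "orthonormal_basis 4 G (tangent_fibre ?f x)" and s: "special_coeffs (?c G) a b" for G a b
  proof -
    \<comment> \<open>With this sign, the square root of the square of \<open>scal_coeffs\<close> is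
      its negative.\<close>
    have "scal_coeffs (?c G) \<le> 0"
      unfolding special_coeffs_curv(1)[OF s] by simp
    then show ?thesis
      unfolding scal[OF G] nscal[OF G] special_coeffs_curv(2)[OF s] by simp
  qed
  ultimately show ?thesis
    unfolding scal[OF F] nscal[OF F]
    using special_coeffs_shape[OF x] by (simp del: One_nat_def) blast
qed

end
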